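(* Let $n\ge 2$, $m=[n/2]$, $G=SL(n,\mathbb{C})$, $B\subset G$ the Borel subgroup of upper triangular matrices, and $Z=G/B$. Let $D\subset Z$ be an open $SL(n,\mathbb{R})$-orbit with base cycle $C_0$, and let $\mathcal{S}_{C_0}$ be the set of Schubert varieties $S_w\subset Z$ with $\dim S_w+\dim C_0=\dim Z$ and $S_w\cap C_0\neq\emptyset$. Let $S_w\in\mathcal{S}_{C_0}$, where $w=k_1\dots k_m\,l_*\,l_m\dots l_1$ in one-line notation ($l_*$ is removed if $n=2m$). Then $S_w$ intersects $C_0$ in $2^m$ points if $n=2m+1$, and in $2^{m-1}$ points if $n=2m$. If $n=2m+1$, the points are the flags $$\langle (\pm i)e_{l_1}+e_{k_1}\rangle\subset\dots\subset\langle (\pm i)e_{l_1}+e_{k_1},\dots,(\pm i)e_{l_m}+e_{k_m}\rangle\subset\langle (\pm i)e_{l_1}+e_{k_1},\dots,(\pm i)e_{l_m}+e_{k_m},e_{l_*}\rangle$$ $$\subset\langle (\pm i)e_{l_1}+e_{k_1},\dots,(\pm i)e_{l_m}+e_{k_m},e_{l_*},e_{l_m}\rangle\subset\dots\subset\mathbb{C}^n,$$ where the sign attached to each index $j\in\{1,\dots,m\}$ is arbitrary but the same throughout the flag, and the vectors adjoined after $e_{l_*}$ are successively $e_{l_m},e_{l_{m-1}},\dots,e_{l_1}$. If $n=2m$, the points are those flags given by the same expression with $e_{l_*}$ removed which lie in $D$ (i.e. which have the orientation of $D$).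
   Context: $Z=G/B$ is the manifold of complete flags $0\subset V_1\subset\dots\subset V_n=\mathbb{C}^n$, $\dim V_i=i$; $(e_1,\dots,e_n)$ is the standard basis of $\mathbb{C}^n$. Let $G_0=SL(n,\mathbb{R})$ and $K_0=SO(n,\mathbb{R})$. An open $G_0$-orbit $D$ in $Z$ contains a unique $K_0$-orbit $C_0$ which is a complex submanifold of $D$, called the base cycle. Let $b(v,w)=v^t w$ be the standard complex bilinear form on $\mathbb{C}^n$ and $\perp$ the orthogonal complement with respect to $b$; $C_0$ is the set of isotropic flags in $D$, i.e. flags in $D$ with $V_i\subset V_i^\perp$ and $V_{n-i}=V_i^\perp$ for all $1\le i\le m$. If $n=2m+1$ there is exactly one open orbit; if $n=2m$ there are two (positively and negatively oriented flags), interchanged by an orientation-reversing map, and $D$ is a fixed one of them. Schubert varieties: for a permutation $w$ of $\{1,\dots,n\}$, $V_w$ is the coordinate flag with $i$-th subspace $\langle e_{w(1)},\dots,e_{w(i)}\rangle$, and $S_w$ is the closure of the orbit $B\cdot V_w$. *)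

theory Defs
  imports "HOL-Analysis.Analysis"
begin

section \<open>Groups and flags\<close>

type_synonym 'n cvec = "(complex, 'n) vec"
type_synonym 'n cmat = "((complex, 'n) vec, 'n) vec"

text \<open>
  The index type \<^typ>\<open>'n\<close> is finite and linearly ordered, so it is a copy of \<open>{1..n}\<close> with
  \<open>n = CARD('n)\<close>; \<open>basis_vec j\<close> is the \<open>j\<close>-th standard basis vector, meaningful for \<open>1 \<le> j \<le> n\<close>.
\<close>

definition basis_vec :: "nat \<Rightarrow> ('n::{finite,wellorder}) cvec" where
  "basis_vec j = axis (sorted_list_of_set UNIV ! (j - 1)) 1"

definition SL_complex :: "('n::{finite,wellorder}) cmat set" where
  "SL_complex = {g. det g = 1}"

definition SL_real :: "('n::{finite,wellorder}) cmat set" where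
  "SL_real = {g \<in> SL_complex. \<forall>i j. g $ i $ j \<in> \<real>}"

definition SO_real :: "('n::{finite,wellorder}) cmat set" where
  "SO_real = {g \<in> SL_real. transpose g ** g = mat 1}"

definition Borel_subgroup :: "('n::{finite,wellorder}) cmat set" where
  "Borel_subgroup = {g \<in> SL_complex. \<forall>i j. j < i \<longrightarrow> g $ i $ j = 0}"

type_synonym 'n flag = "nat \<Rightarrow> 'n cvec set"

text \<open>
  A flag \<open>F\<close> has \<open>i\<close>-th subspace \<open>F i\<close> for \<open>0 \<le> i \<le> n\<close>; the values beyond \<open>n\<close> are pinned to the whole
  space, so that equality of functions is equality of flags.
\<close>

definition flags :: "('n::{finite,wellorder}) flag set" where
  "flags = {F. (\<forall>i \<le> CARD('n). vec.subspace (F i) \<and> vec.dim (F i) = i)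
             \<and> (\<forall>i < CARD('n). F i \<subseteq> F (Suc i))
             \<and> (\<forall>i > CARD('n). F i = UNIV)}"

definition flag_of :: "('n::{finite,wellorder}) cvec list \<Rightarrow> 'n flag" where
  "flag_of vs = (\<lambda>i. vec.span (set (take i vs)))"

definition coordinate_flag :: "(nat \<Rightarrow> nat) \<Rightarrow> ('n::{finite,wellorder}) flag" where
  "coordinate_flag w = flag_of (map (\<lambda>j. basis_vec (w j)) [1..<CARD('n) + 1])"

definition flag_act :: "'n cmat \<Rightarrow> ('n::{finite,wellorder}) flag \<Rightarrow> 'n flag" where
  "flag_act g F = (\<lambda>i. (\<lambda>v. g *v v) ` F i)"

definition flag_orbit ::
  "'n cmat set \<Rightarrow> ('n::{finite,wellorder}) flag \<Rightarrow> 'n flag set" where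
  "flag_orbit H F = (\<lambda>g. flag_act g F) ` H"

section \<open>Topology and complex structure of the flag manifold\<close>

text \<open>
  The stabilizer of \<open>coordinate_flag id\<close> is \<^const>\<open>Borel_subgroup\<close>, so this is the quotient topology
  of \<open>G/B\<close>.
\<close>

definition flag_topology :: "('n::{finite,wellorder}) flag topology" where
  "flag_topology = topology (\<lambda>U. U \<subseteq> flags \<and>
     openin (top_of_set SL_complex) {g \<in> SL_complex. flag_act g (coordinate_flag id) \<in> U})"

lemma openin_flag_topology:
  "openin flag_topology U \<longleftrightarrow> U \<subseteq> flags \<and>
     openin (top_of_set SL_complex) {g \<in> SL_complex. flag_act g (coordinate_flag id) \<in> U}"
proof -
  have "istopology (\<lambda>U. U \<subseteq> flags \<and>
     openin (top_of_set SL_complex) {g \<in> SL_complex. flag_act g (coordinate_flag id) \<in> U})"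
    unfolding istopology_def
  proof (intro conjI allI impI, goal_cases)
    case (2 S T)
    have "{g \<in> SL_complex. flag_act g (coordinate_flag id) \<in> S \<inter> T} =
        {g \<in> SL_complex. flag_act g (coordinate_flag id) \<in> S} \<inter>
        {g \<in> SL_complex. flag_act g (coordinate_flag id) \<in> T}" by auto
    with 2 show ?case by (simp add: openin_Int)
  next
    case (4 K)
    have "{g \<in> SL_complex. flag_act g (coordinate_flag id) \<in> \<Union>K} =
        (\<Union>S\<in>K. {g \<in> SL_complex. flag_act g (coordinate_flag id) \<in> S})" by auto
    with 4 show ?case by (force intro: openin_Union)
  qed blast+
  then show ?thesis unfolding flag_topology_def by (subst topology_inverse') auto
qed

text \<open>Holomorphic: real differentiable with complex linear derivative.\<close>

definition holomorphic_mat ::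
  "('n cmat \<Rightarrow> 'n cmat) \<Rightarrow> ('n::finite) cmat set \<Rightarrow> bool" where
  "holomorphic_mat f U \<longleftrightarrow> (\<forall>x\<in>U. \<exists>f'. (f has_derivative f') (at x) \<and>
     (\<forall>c h. f' (map_matrix (\<lambda>z. c * z) h) = map_matrix (\<lambda>z. c * z) (f' h)))"

text \<open>
  Near \<open>x\<close>, the set \<open>M\<close> is a \<open>d\<close>-dimensional embedded complex submanifold of the space of matrices:
  a biholomorphic map between open sets takes it to the coordinate plane of the \<open>d\<close> entries in \<open>I\<close>.
\<close>

definition mat_submanifold_at ::
  "nat \<Rightarrow> 'n cmat set \<Rightarrow> ('n::finite) cmat \<Rightarrow> bool" where
  "mat_submanifold_at d M x \<longleftrightarrow> (\<exists>U V \<phi> \<psi> I. open U \<and> x \<in> U \<and> open V \<and>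
     homeomorphism U V \<phi> \<psi> \<and> holomorphic_mat \<phi> U \<and> holomorphic_mat \<psi> V \<and>
     card I = d \<and> \<phi> ` (U \<inter> M) = V \<inter> {y. \<forall>i j. (i, j) \<notin> I \<longrightarrow> y $ i $ j = 0})"

definition strictly_lower :: "('n::{finite,wellorder}) cmat set" where
  "strictly_lower = {x. \<forall>i j. i \<le> j \<longrightarrow> x $ i $ j = 0}"

text \<open>
  The maps \<open>flag_chart g\<close> on the linear space \<^const>\<open>strictly_lower\<close>, for \<open>g\<close> in \<^const>\<open>SL_complex\<close>,
  are the inverses of the standard holomorphic charts of \<open>G/B\<close> (translates of the open cell
  \<open>N\<^sup>-B/B\<close>).
\<close>

definition flag_chart :: "'n cmat \<Rightarrow> 'n cmat \<Rightarrow> ('n::{finite,wellorder}) flag" where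
  "flag_chart g x = flag_act (g ** (mat 1 + x)) (coordinate_flag id)"

definition complex_submanifold :: "nat \<Rightarrow> ('n::{finite,wellorder}) flag set \<Rightarrow> bool" where
  "complex_submanifold d M \<longleftrightarrow> M \<subseteq> flags \<and>
     (\<forall>p\<in>M. \<exists>g\<in>SL_complex. \<exists>x\<in>strictly_lower. flag_chart g x = p \<and>
        mat_submanifold_at d {y \<in> strictly_lower. flag_chart g y \<in> M} x)"

text \<open>
  Dimension of a complex analytic subset (possibly singular): the largest dimension of a nonempty
  complex submanifold contained in it.
\<close>

definition complex_dim :: "('n::{finite,wellorder}) flag set \<Rightarrow> nat" where
  "complex_dim X = (GREATEST d. \<exists>M. M \<noteq> {} \<and> M \<subseteq> X \<and> complex_submanifold d M)"

section \<open>Flag domains, base cycles and Schubert varieties\<close>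

definition flag_domain :: "('n::{finite,wellorder}) flag set \<Rightarrow> bool" where
  "flag_domain D \<longleftrightarrow> (\<exists>F\<in>flags. D = flag_orbit SL_real F) \<and> openin flag_topology D"

definition base_cycle :: "('n::{finite,wellorder}) flag set \<Rightarrow> 'n flag set \<Rightarrow> bool" where
  "base_cycle D C \<longleftrightarrow> (\<exists>F\<in>D. C = flag_orbit SO_real F) \<and> (\<exists>d. complex_submanifold d C)"

definition schubert_variety :: "(nat \<Rightarrow> nat) \<Rightarrow> ('n::{finite,wellorder}) flag set" where
  "schubert_variety w = flag_topology closure_of (flag_orbit Borel_subgroup (coordinate_flag w))"

definition schubert_complementary :: "('n::{finite,wellorder}) flag set \<Rightarrow> 'n flag set set" where
  "schubert_complementary C = {S. (\<exists>w. w permutes {1..CARD('n)} \<and> S = schubert_variety w) \<and>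
     complex_dim S + complex_dim C = complex_dim (flags :: 'n flag set) \<and> S \<inter> C \<noteq> {}}"

text \<open>The list \<open>k\<^sub>1, \<dots>, k\<^sub>m, l\<^sub>*, l\<^sub>m, \<dots>, l\<^sub>1\<close>, where \<open>l\<^sub>*\<close> is present only for odd \<open>n\<close>.\<close>

definition one_line :: "nat \<Rightarrow> (nat \<Rightarrow> nat) \<Rightarrow> nat \<Rightarrow> (nat \<Rightarrow> nat) \<Rightarrow> nat list" where
  "one_line n k lstar l = map k [1..<n div 2 + 1] @ (if odd n then [lstar] else [])
     @ map l (rev [1..<n div 2 + 1])"

text \<open>Here \<open>s j\<close> is the coefficient \<open>\<plusminus>\<i>\<close> attached to the index \<open>j\<close>.\<close>

definition intersection_flag ::
  "(nat \<Rightarrow> nat) \<Rightarrow> nat \<Rightarrow> (nat \<Rightarrow> nat) \<Rightarrow> (nat \<Rightarrow> complex) \<Rightarrow> ('n::{finite,wellorder}) flag" where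
  "intersection_flag k lstar l s = flag_of (
     map (\<lambda>j. s j *s basis_vec (l j) + basis_vec (k j)) [1..<CARD('n) div 2 + 1]
     @ (if odd CARD('n) then [basis_vec lstar] else [])
     @ map (\<lambda>j. basis_vec (l j)) (rev [1..<CARD('n) div 2 + 1]))"

end

theory Submission
  imports Defs
begin

text \<open>
  A compact orbit \<open>K\<^sub>0 F\<close> has tangent space \<open>so(n, \<real>)\<close> modulo the stabilizer \<open>b\<^sub>F\<close>, so if it is a complex
  submanifold then \<open>so(n, \<complex>) = so(n, \<real>) + (so(n, \<complex>) \<inter> b\<^sub>F)\<close>. In a unitary basis adapted to \<open>F\<close> this forces
  complex conjugation to reverse the basis, that is, \<open>F\<close> is isotropic.

  Since \<open>so(n, \<complex>)\<close> and the upper triangular matrices span everything, the \<open>B\<close>-orbit of a point of \<open>C\<^sub>0\<close> is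
  transversal to \<open>C\<^sub>0\<close> there, and complementary dimensions make the sum of tangent spaces direct. By the
  Iwasawa decomposition the open cell of \<open>S\<^sub>w\<close> meets \<open>C\<^sub>0\<close> as soon as \<open>S\<^sub>w\<close> does. At such a point directness
  makes the real planes spanned by the conjugate pairs of basis vectors coordinate planes, and shows
  that at stage \<open>i\<close> no remaining index lies strictly between \<open>l\<^sub>i\<close> and \<open>k\<^sub>i\<close>, while \<open>l\<^sub>i < k\<^sub>i\<close>. This determines the isotropic
  flags satisfying the rank conditions of \<open>S\<^sub>w\<close>. For even \<open>n\<close>, changing one sign reverses the orientation,
  so half of the candidates lie in \<open>D\<close>.
\<close>

section \<open>Positions, triangular matrices and flags\<close>

text \<open>Flags are handled as cosets \<open>fl A\<close> of invertible matrices modulo upper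
  triangular ones, and tangent vectors at \<open>fl A\<close> as strictly lower triangular matrices,
  \<open>tau A X\<close> being the velocity of the infinitesimal motion \<open>X\<close>. The main
  obstacle is that the hypothesis on \<open>C\<^sub>0\<close> speaks of charts and of an orbit. To
  identify the tangent space with the image of \<open>so_real\<close> under \<open>tau A\<close>, a
  curve in the orbit must be lifted to SO(n, R) with first order control; a choice of maximal trace
  and compactness achieve this, and Cayley curves play the part of exponentials. Directness of the
  sum of tangent spaces follows from inequalities alone: lower bounds for the dimensions of base
  cycle and Schubert variety, an upper bound for that of the flag manifold. The closure of a cell
  enters through closed rank conditions, which suffice because the candidate flags turn out to lie
  in the open cell. The conditions extracted at one good point involve only \<open>w\<close> and
  hence govern every other point of the intersection.\<close>

definition rk :: "'n::{finite,wellorder} \<Rightarrow> nat" where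
  "rk x = card {..<x}"

definition en :: "nat \<Rightarrow> 'n::{finite,wellorder}" where
  "en j = sorted_list_of_set UNIV ! j"

lemma en_less:
  assumes "i < j" "j < CARD('n)"
  shows "(en i :: 'n::{finite,wellorder}) < en j"
  unfolding en_def using assms by (intro sorted_wrt_nth_less[of "(<)"]) auto

lemma en_surj: "\<exists>j<CARD('n). en j = (x :: 'n::{finite,wellorder})"
proof -
  have "x \<in> set (sorted_list_of_set (UNIV :: 'n set))" by simp
  then show ?thesis unfolding in_set_conv_nth en_def by auto
qed

lemma en_less_iff:
  assumes "i < CARD('n)" "j < CARD('n)"
  shows "(en i :: 'n::{finite,wellorder}) < en j \<longleftrightarrow> i < j"
  by (metis assms en_less linorder_neqE_nat order_less_asym order_less_irrefl)

lemma rk_en [simp]: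
  assumes "j < CARD('n)"
  shows "rk (en j :: 'n::{finite,wellorder}) = j"
proof -
  have "{..<en j :: 'n} = en ` {..<j}"
  proof (intro set_eqI iffI)
    fix x :: 'n assume "x \<in> {..<en j}"
    then show "x \<in> en ` {..<j}"
      by (metis assms en_less_iff en_surj image_eqI lessThan_iff)
  next
    fix x :: 'n assume "x \<in> en ` {..<j}"
    then show "x \<in> {..<en j}" using assms by (auto intro: en_less)
  qed
  moreover have "inj_on (en :: nat \<Rightarrow> 'n) {..<j}"
    by (intro inj_onI) (metis assms en_less lessThan_iff linorder_neqE_nat order.strict_trans order_less_irrefl)
  ultimately show ?thesis by (simp add: rk_def card_image)
qed

lemma en_rk [simp]: "en (rk x) = x"
  by (metis en_surj rk_en)

lemma rk_less [simp]: "rk (x :: 'n::{finite,wellorder}) < CARD('n)"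
  by (metis en_surj rk_en)

lemma rk_less_iff: "rk x < rk y \<longleftrightarrow> x < y"
  by (metis en_less_iff en_rk rk_less)

lemma rk_le_iff: "rk x \<le> rk y \<longleftrightarrow> x \<le> y"
  by (metis not_less rk_less_iff)

lemma rk_inject: "rk x = rk y \<longleftrightarrow> x = y"
  by (metis en_rk)

lemma card_rk_less:
  assumes "i \<le> CARD('n)"
  shows "card {x :: 'n::{finite,wellorder}. rk x < i} = i"
proof -
  have "{x :: 'n. rk x < i} = en ` {..<i}"
    using assms by (auto intro!: image_eqI[of _ en "rk _"])
  moreover have "inj_on (en :: nat \<Rightarrow> 'n) {..<i}"
    by (intro inj_onI) (metis assms lessThan_iff order_less_le_trans rk_en)
  ultimately show ?thesis by (simp add: card_image)
qed

lemma basis_vec_en: "basis_vec j = axis (en (j - 1)) 1"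
  by (simp add: basis_vec_def en_def)

definition upper :: "'n::{finite,wellorder} cmat \<Rightarrow> bool" where
  "upper A \<longleftrightarrow> (\<forall>i j. j < i \<longrightarrow> A $ i $ j = 0)"

text \<open>The projection along the upper triangular matrices, that is, a model of the quotient of
  gl(n) by its Borel subalgebra. Tangent vectors of the flag manifold are recorded in this
  form.\<close>

definition low :: "'n::{finite,wellorder} cmat \<Rightarrow> 'n cmat" where
  "low A = (\<chi> i j. if j < i then A $ i $ j else 0)"

lemma low_nth [simp]: "low A $ i $ j = (if j < i then A $ i $ j else 0)"
  by (simp add: low_def)

lemma upper_iff_low: "upper A \<longleftrightarrow> low A = 0"
  by (auto simp: upper_def vec_eq_iff)

lemma low_add: "low (A + B) = low A + low B"
  by (simp add: vec_eq_iff)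

lemma low_diff: "low (A - B) = low A - low B"
  by (simp add: vec_eq_iff)

lemma low_scaleR: "low (c *\<^sub>R A) = c *\<^sub>R low A"
  by (simp add: vec_eq_iff)

lemma linear_low: "linear low"
  by (intro linearI) (simp_all add: low_add low_scaleR)

lemma low_strictly_lower [simp]: "low A \<in> strictly_lower"
  by (simp add: strictly_lower_def not_less[symmetric])

lemma low_id: "A \<in> strictly_lower \<Longrightarrow> low A = A"
  unfolding strictly_lower_def vec_eq_iff low_nth mem_Collect_eq by (metis not_less)

lemma matrix_mult_nth: "(A ** B) $ i $ j = (\<Sum>k\<in>UNIV. A $ i $ k * B $ k $ j)"
  by (simp add: matrix_matrix_mult_def)

lemma upper_mult:
  assumes "upper A" "upper B"
  shows "upper (A ** B)"
  unfolding upper_def matrix_mult_nth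
proof (intro allI impI sum.neutral ballI)
  fix i j k :: 'a assume "j < i"
  then have "k < i \<or> j < k" by auto
  then show "A $ i $ k * B $ k $ j = 0" using assms by (auto simp: upper_def)
qed

lemma upper_add: "upper A \<Longrightarrow> upper B \<Longrightarrow> upper (A + B)"
  by (simp add: upper_def)

lemma upper_mat_1 [simp]: "upper (mat 1)"
  by (auto simp: upper_def mat_def)

lemma
  fixes A :: "'n::finite cmat"
  assumes "invertible A"
  shows matrix_inv_right: "A ** matrix_inv A = mat 1"
    and matrix_inv_left: "matrix_inv A ** A = mat 1"
proof -
  obtain B where "A ** B = mat 1 \<and> B ** A = mat 1"
    using assms by (auto simp: invertible_def)
  then have "A ** matrix_inv A = mat 1 \<and> matrix_inv A ** A = mat 1"
    unfolding matrix_inv_def by (rule someI)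
  then show "A ** matrix_inv A = mat 1" "matrix_inv A ** A = mat 1" by auto
qed

lemma matrix_inv_unique:
  fixes A B :: "'n::finite cmat"
  assumes "A ** B = mat 1"
  shows "matrix_inv A = B"
proof -
  have "invertible A" using assms by (auto simp: invertible_right_inverse)
  then have "matrix_inv A = (matrix_inv A ** A) ** B"
    by (simp add: assms flip: matrix_mul_assoc)
  then show ?thesis by (simp add: matrix_inv_left \<open>invertible A\<close>)
qed

lemma invertible_matrix_inv: "invertible (A :: 'n::finite cmat) \<Longrightarrow> invertible (matrix_inv A)"
  unfolding invertible_right_inverse[of "matrix_inv A"] using matrix_inv_left by blast

lemma matrix_inv_mult:
  fixes A B :: "'n::finite cmat"
  assumes "invertible A" "invertible B"
  shows "matrix_inv (A ** B) = matrix_inv B ** matrix_inv A"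
proof (rule matrix_inv_unique)
  have "A ** B ** (matrix_inv B ** matrix_inv A) = A ** (B ** matrix_inv B) ** matrix_inv A"
    by (simp add: matrix_mul_assoc)
  then show "A ** B ** (matrix_inv B ** matrix_inv A) = mat 1"
    by (simp add: assms matrix_inv_right)
qed

lemma matrix_inv_cancel_left: "invertible (A :: 'n::finite cmat) \<Longrightarrow> matrix_inv A ** (A ** B) = B"
  by (simp add: matrix_inv_left matrix_mul_assoc)

lemma matrix_inv_cancel_right: "invertible (A :: 'n::finite cmat) \<Longrightarrow> A ** (matrix_inv A ** B) = B"
  by (simp add: matrix_inv_right matrix_mul_assoc)

lemma SL_complex_invertible: "g \<in> SL_complex \<Longrightarrow> invertible g"
  by (simp add: SL_complex_def invertible_det_nz)

section \<open>Flags as cosets modulo upper triangular matrices\<close>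

definition std_space :: "nat \<Rightarrow> 'n::{finite,wellorder} cvec set" where
  "std_space i = {v. \<forall>x. i \<le> rk x \<longrightarrow> v $ x = 0}"

lemma span_axes:
  "vec.span ((\<lambda>x. axis x (1::complex)) ` S) = {v. \<forall>x::'n::finite. x \<notin> S \<longrightarrow> v $ x = 0}"
proof (intro set_eqI iffI)
  fix v :: "'n cvec"
  assume "v \<in> vec.span ((\<lambda>x. axis x 1) ` S)"
  then show "v \<in> {v. \<forall>x. x \<notin> S \<longrightarrow> v $ x = 0}"
    by (induction rule: vec.span_induct_alt) (auto simp: axis_def split: if_splits)
next
  fix v :: "'n cvec"
  assume v: "v \<in> {v. \<forall>x. x \<notin> S \<longrightarrow> v $ x = 0}"
  have "v = (\<Sum>x\<in>UNIV. v $ x *s axis x 1)"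
    by (simp add: vec_eq_iff axis_def if_distrib cong: if_cong)
  also have "\<dots> = (\<Sum>x\<in>S. v $ x *s axis x 1)"
    using v by (intro sum.mono_neutral_right) auto
  also have "\<dots> \<in> vec.span ((\<lambda>x. axis x 1) ` S)"
    by (intro vec.span_sum vec.span_scale vec.span_base) auto
  finally show "v \<in> vec.span ((\<lambda>x. axis x 1) ` S)" .
qed

lemma subspace_std_space [simp]: "vec.subspace (std_space i)"
  by (auto simp: std_space_def vec.subspace_def)

lemma dim_std_space:
  assumes "i \<le> CARD('n)"
  shows "vec.dim (std_space i :: 'n::{finite,wellorder} cvec set) = i"
proof -
  have "std_space i = {v::'n cvec. \<forall>x. x \<notin> {x. rk x < i} \<longrightarrow> v $ x = 0}"
    by (auto simp: std_space_def)
  then show ?thesis using dim_substandard_cart[of "{x::'n. rk x < i}"] card_rk_less[OF assms] by simp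
qed

lemma axis_mult_complex: "A *v axis j (1::complex) = (\<chi> i. A $ i $ j)"
  by (simp add: matrix_vector_mult_def axis_def vec_eq_iff if_distrib cong: if_cong)

lemma axis_mult_nth [simp]: "(A *v axis j (1::complex)) $ i = A $ i $ j"
  by (simp add: axis_mult_complex)

lemma matrix_vector_nth: "(A *v v) $ i = (\<Sum>k\<in>UNIV. A $ i $ k * v $ k)"
  by (simp add: matrix_vector_mult_def)

lemma upper_std_space:
  fixes A :: "'n::{finite,wellorder} cmat"
  assumes "upper A" "v \<in> std_space i"
  shows "A *v v \<in> std_space i"
  unfolding std_space_def matrix_vector_nth mem_Collect_eq
proof (intro allI impI sum.neutral ballI)
  fix x k :: 'n assume "i \<le> rk x"
  then have "k < x \<or> i \<le> rk k" by (meson dual_order.trans not_less rk_le_iff)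
  then show "A $ x $ k * v $ k = 0" using assms by (auto simp: upper_def std_space_def)
qed

lemma axis_std_space: "axis y 1 \<in> std_space (Suc (rk y))"
  by (auto simp: std_space_def axis_def)

lemma upper_if_std_space:
  assumes "\<And>y. A *v axis y 1 \<in> std_space (Suc (rk y))"
  shows "upper A"
  unfolding upper_def
proof (intro allI impI)
  fix i j :: 'a assume "j < i"
  then have "Suc (rk j) \<le> rk i" by (simp add: rk_less_iff Suc_le_eq)
  then have "(A *v axis j 1) $ i = 0" using assms[of j] by (auto simp: std_space_def)
  then show "A $ i $ j = 0" by simp
qed

lemma invertible_inj: "invertible (A :: 'n::finite cmat) \<Longrightarrow> inj ((*v) A)"
  by (simp add: invertible_eq_bij bij_is_inj)

lemma upper_image_std_space:
  fixes U :: "'n::{finite,wellorder} cmat"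
  assumes "upper U" "invertible U"
  shows "(*v) U ` std_space i = std_space i"
proof -
  have sub: "(*v) U ` std_space i \<subseteq> std_space i" using upper_std_space[OF assms(1)] by auto
  have "vec.dim ((*v) U ` std_space i) = vec.dim (std_space i :: 'n cvec set)"
    by (rule vec.dim_image_eq) (use invertible_inj[OF assms(2)] in \<open>auto intro: inj_on_subset\<close>)
  then show ?thesis
    by (intro vec.subspace_dim_equal sub) (auto intro: vec.subspace_image)
qed

lemma upper_matrix_inv:
  fixes U :: "'n::{finite,wellorder} cmat"
  assumes "upper U" "invertible U"
  shows "upper (matrix_inv U)"
proof (rule upper_if_std_space)
  fix y :: 'n
  obtain v where v: "v \<in> std_space (Suc (rk y))" "axis y 1 = U *v v"
    using axis_std_space[of y] upper_image_std_space[OF assms, of "Suc (rk y)"] by blast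
  then show "matrix_inv U *v axis y 1 \<in> std_space (Suc (rk y))"
    by (simp add: matrix_vector_mul_assoc matrix_inv_left[OF assms(2)])
qed

lemma coordinate_flag_span:
  "(coordinate_flag w :: 'n::{finite,wellorder} flag) i
     = {v. \<forall>x. x \<notin> (\<lambda>j. en (w j - 1)) ` {1..min i CARD('n)} \<longrightarrow> v $ x = 0}"
proof -
  have "set (take i (map (\<lambda>j. basis_vec (w j)) [1..<CARD('n) + 1]))
     = (\<lambda>j. basis_vec (w j) :: 'n cvec) ` {1..min i CARD('n)}"
    unfolding take_map set_map
    by (auto simp: take_upt min_def simp del: upt_Suc)
  also have "\<dots> = (\<lambda>x. axis x 1) ` (\<lambda>j. en (w j - 1)) ` {1..min i CARD('n)}"
    by (simp add: image_image basis_vec_en)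
  finally show ?thesis by (simp add: coordinate_flag_def flag_of_def span_axes del: upt_Suc)
qed

text \<open>The permutation \<open>w\<close> acts on numbers from 1 to n while \<open>rk\<close> and
  \<open>en\<close> count from 0; the \<open>Suc\<close> and the \<open>- 1\<close> carry
  \<open>w\<close> over to the index type.\<close>

definition wperm :: "(nat \<Rightarrow> nat) \<Rightarrow> 'n::{finite,wellorder} \<Rightarrow> 'n" where
  "wperm w x = en (w (Suc (rk x)) - 1)"

lemma coordinate_flag_wperm:
  "(coordinate_flag w :: 'n::{finite,wellorder} flag) i
     = {v. \<forall>x. x \<notin> wperm w ` {y. rk y < i} \<longrightarrow> v $ x = 0}"
proof -
  have "(\<lambda>j. en (w j - 1)) ` {1..min i CARD('n)} = (wperm w :: 'n \<Rightarrow> 'n) ` {y. rk y < i}"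
  proof (intro set_eqI iffI)
    fix x :: 'n assume "x \<in> (\<lambda>j. en (w j - 1)) ` {1..min i CARD('n)}"
    then obtain j where j: "j \<in> {1..min i CARD('n)}" "x = en (w j - 1)" by auto
    then have "x = wperm w (en (j - 1) :: 'n)" "rk (en (j - 1) :: 'n) < i"
      by (auto simp: wperm_def)
    then show "x \<in> wperm w ` {y. rk y < i}" by auto
  next
    fix x :: 'n assume "x \<in> wperm w ` {y. rk y < i}"
    then obtain y :: 'n where y: "rk y < i" "x = wperm w y" by auto
    moreover have "Suc (rk y) \<le> CARD('n)" by (simp add: Suc_le_eq)
    ultimately show "x \<in> (\<lambda>j. en (w j - 1)) ` {1..min i CARD('n)}"
      by (auto simp: wperm_def intro!: image_eqI[of _ _ "Suc (rk y)"])
  qed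
  then show ?thesis by (simp add: coordinate_flag_span)
qed

lemma coordinate_flag_id: "coordinate_flag id = (std_space :: 'n::{finite,wellorder} flag)"
proof -
  have "wperm id = (\<lambda>x :: 'n. x)"
    by (auto simp: wperm_def)
  then show ?thesis
    by (intro ext) (simp add: coordinate_flag_wperm std_space_def linorder_not_less)
qed

lemma wperm_bij:
  assumes "w permutes {1..CARD('n)}"
  shows "bij (wperm w :: 'n::{finite,wellorder} \<Rightarrow> 'n)"
proof -
  have r: "w (Suc (rk x)) \<in> {1..CARD('n)}" for x :: 'n
    by (metis Suc_leI assms atLeastAtMost_iff le_add1 permutes_in_image plus_1_eq_Suc rk_less)
  have "inj (wperm w :: 'n \<Rightarrow> 'n)"
  proof (rule injI)
    fix x y :: 'n assume *: "wperm w x = wperm w y"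
    have "rk (en (w (Suc (rk x)) - 1) :: 'n) = rk (en (w (Suc (rk y)) - 1) :: 'n)"
      using * by (simp add: wperm_def)
    then have "w (Suc (rk x)) - 1 = w (Suc (rk y)) - 1"
      using r[of x] r[of y] by (subst (asm) (1 2) rk_en) auto
    then have "w (Suc (rk x)) = w (Suc (rk y))" using r[of x] r[of y] by auto
    then show "x = y" using permutes_inj[OF assms] by (auto simp: inj_eq rk_inject)
  qed
  then show ?thesis by (simp add: finite_UNIV_inj_surj bij_def)
qed

text \<open>The coset of \<open>A\<close> in G/B seen as a flag, spanned by initial columns.
  Matrices of any determinant are allowed, which leaves room for unitary frames and rescaled
  columns.\<close>

definition fl :: "'n cmat \<Rightarrow> 'n::{finite,wellorder} flag" where
  "fl A = flag_act A (coordinate_flag id)"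

lemma fl_nth: "fl A i = (*v) A ` std_space i"
  by (simp add: fl_def flag_act_def coordinate_flag_id)

lemma flag_act_mult: "flag_act A (flag_act B F) = flag_act (A ** B) F"
  by (simp add: flag_act_def image_image matrix_vector_mul_assoc)

lemma flag_act_mat_1 [simp]: "flag_act (mat 1) F = F"
  by (simp add: flag_act_def)

lemma flag_act_fl: "flag_act A (fl B) = fl (A ** B)"
  by (simp add: fl_def flag_act_mult)

lemma mem_fl_iff:
  assumes "invertible A"
  shows "v \<in> fl A i \<longleftrightarrow> matrix_inv A *v v \<in> std_space i"
proof
  assume "v \<in> fl A i"
  then show "matrix_inv A *v v \<in> std_space i"
    by (auto simp: fl_nth matrix_vector_mul_assoc matrix_inv_left[OF assms])
next
  assume "matrix_inv A *v v \<in> std_space i"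
  moreover have "v = A *v (matrix_inv A *v v)"
    by (simp add: matrix_vector_mul_assoc matrix_inv_right[OF assms])
  ultimately show "v \<in> fl A i" by (auto simp: fl_nth)
qed

text \<open>Column \<open>y\<close> of \<open>B\<close> lies in the span of the columns of
  \<open>A\<close> up to \<open>y\<close> exactly when column \<open>y\<close> of
  \<open>matrix_inv A ** B\<close> ends at the diagonal. Equality of flags becomes a condition
  linear in \<open>B\<close>.\<close>

lemma fl_eq_iff:
  fixes A B :: "'n::{finite,wellorder} cmat"
  assumes "invertible A" "invertible B"
  shows "fl A = fl B \<longleftrightarrow> upper (matrix_inv A ** B)"
proof
  assume eq: "fl A = fl B"
  show "upper (matrix_inv A ** B)"
  proof (rule upper_if_std_space)
    fix y :: 'n
    have "B *v axis y 1 \<in> fl A (Suc (rk y))"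
      using axis_std_space by (auto simp: eq fl_nth)
    then show "matrix_inv A ** B *v axis y 1 \<in> std_space (Suc (rk y))"
      by (simp add: mem_fl_iff[OF assms(1)] matrix_vector_mul_assoc)
  qed
next
  assume up: "upper (matrix_inv A ** B)"
  have "B *v v = A *v (matrix_inv A ** B *v v)" for v
    by (simp add: matrix_vector_mul_assoc matrix_inv_right[OF assms(1)] matrix_mul_assoc)
  then have "fl B i = (*v) A ` (*v) (matrix_inv A ** B) ` std_space i" for i
    by (simp add: fl_nth image_image)
  also have "\<dots> i = fl A i" for i
    by (subst upper_image_std_space[OF up])
      (auto simp: fl_nth invertible_mult invertible_matrix_inv assms)
  finally show "fl A = fl B" by auto
qed

lemma fl_mult_upper:
  assumes "invertible A" "invertible U" "upper U"
  shows "fl (A ** U) = fl A"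
  using fl_eq_iff[of A "A ** U"] assms by (simp add: invertible_mult matrix_inv_cancel_left)

lemma fl_subspace [simp]: "vec.subspace (fl A i)"
  by (auto simp: fl_nth intro: vec.subspace_image)

lemma dim_fl:
  assumes "invertible A" "i \<le> CARD('n)"
  shows "vec.dim (fl A i :: 'n::{finite,wellorder} cvec set) = i"
  unfolding fl_nth using invertible_inj[OF assms(1)] dim_std_space[OF assms(2)]
  by (subst vec.dim_image_eq) (auto intro: inj_on_subset)

lemma fl_in_flags:
  fixes A :: "'n::{finite,wellorder} cmat"
  assumes "invertible A"
  shows "fl A \<in> flags"
proof -
  have "std_space i \<subseteq> (std_space (Suc i) :: 'n cvec set)" for i
    by (auto simp: std_space_def)
  moreover have "std_space i = (UNIV :: 'n cvec set)" if "i > CARD('n)" for i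
  proof -
    have "\<not> i \<le> rk x" for x :: 'n using that rk_less[of x] by linarith
    then show ?thesis by (simp add: std_space_def)
  qed
  moreover have "surj ((*v) A)" using assms by (simp add: invertible_eq_bij bij_is_surj)
  ultimately show ?thesis
    unfolding flags_def mem_Collect_eq
    by (intro conjI allI impI fl_subspace dim_fl[OF assms]) (auto simp: fl_nth)
qed

text \<open>The Borel subalgebra attached to \<open>F\<close>, taken inside gl(n) with no condition
  on the trace.\<close>

definition stab :: "'n::{finite,wellorder} flag \<Rightarrow> 'n cmat \<Rightarrow> bool" where
  "stab F X \<longleftrightarrow> (\<forall>i. \<forall>v \<in> F i. X *v v \<in> F i)"

lemma stab_fl:
  fixes A :: "'n::{finite,wellorder} cmat"
  assumes "invertible A"
  shows "stab (fl A) X \<longleftrightarrow> upper (matrix_inv A ** X ** A)"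
proof
  assume st: "stab (fl A) X"
  show "upper (matrix_inv A ** X ** A)"
  proof (rule upper_if_std_space)
    fix y :: 'n
    have "A *v axis y 1 \<in> fl A (Suc (rk y))"
      using axis_std_space by (auto simp: fl_nth)
    then have "X *v (A *v axis y 1) \<in> fl A (Suc (rk y))" using st by (simp add: stab_def)
    then show "matrix_inv A ** X ** A *v axis y 1 \<in> std_space (Suc (rk y))"
      by (simp add: mem_fl_iff[OF assms(1)] matrix_vector_mul_assoc matrix_mul_assoc)
  qed
next
  assume up: "upper (matrix_inv A ** X ** A)"
  show "stab (fl A) X" unfolding stab_def
  proof (intro allI ballI)
    fix i v assume "v \<in> fl A i"
    then obtain u where u: "u \<in> std_space i" "v = A *v u" by (auto simp: fl_nth)
    then show "X *v v \<in> fl A i"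
      using upper_std_space[OF up, of u i] by (simp add: mem_fl_iff[OF assms] matrix_vector_mul_assoc matrix_mul_assoc)
  qed
qed

section \<open>Unitary frames\<close>

definition ct :: "'n::finite cmat \<Rightarrow> 'n cmat" where
  "ct A = (\<chi> i j. cnj (A $ j $ i))"

lemma ct_nth [simp]: "ct A $ i $ j = cnj (A $ j $ i)"
  by (simp add: ct_def)

definition unitary :: "'n::finite cmat \<Rightarrow> bool" where
  "unitary A \<longleftrightarrow> ct A ** A = mat 1"

definition real_mat :: "'n::finite cmat \<Rightarrow> bool" where
  "real_mat A \<longleftrightarrow> (\<forall>i j. A $ i $ j \<in> \<real>)"

abbreviation cscale :: "complex \<Rightarrow> 'n::finite cmat \<Rightarrow> 'n cmat" where
  "cscale c A \<equiv> map_matrix (\<lambda>z. c * z) A"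

lemma cscale_nth [simp]: "cscale c A $ i $ j = c * A $ i $ j"
  by (simp add: map_matrix_def)

definition so_real :: "'n::finite cmat set" where
  "so_real = {X. real_mat X \<and> transpose X = - X}"

text \<open>The longest element of the symmetric group. In the frames used below, a column and its
  partner under \<open>rho\<close> are complex conjugates of each other.\<close>

definition rho :: "'n::{finite,wellorder} \<Rightarrow> 'n" where
  "rho x = en (CARD('n) - 1 - rk x)"

text \<open>The form \<open>b\<close> pairs a column only with its complex conjugate, which sits in the opposite position,
  so the flag spanned by the columns is isotropic.\<close>

definition iso_frame :: "'n::{finite,wellorder} cmat \<Rightarrow> bool" where
  "iso_frame A \<longleftrightarrow> unitary A \<and> (\<forall>x y. A $ x $ rho y = cnj (A $ x $ y))"

lemma unitary_inv: "unitary A \<Longrightarrow> matrix_inv A = ct A"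
  unfolding unitary_def by (intro matrix_inv_unique) (simp add: matrix_left_right_inverse)

lemma unitary_right: "unitary A \<Longrightarrow> A ** ct A = mat 1"
  unfolding unitary_def by (simp add: matrix_left_right_inverse)

lemma unitary_invertible: "unitary A \<Longrightarrow> invertible A"
  unfolding unitary_def invertible_left_inverse by blast

lemma unitary_columns:
  "unitary A \<longleftrightarrow> (\<forall>a b. (\<Sum>z\<in>UNIV. cnj (A $ z $ a) * A $ z $ b) = (if a = b then 1 else 0))"
  unfolding unitary_def vec_eq_iff matrix_mult_nth mat_def by simp

lemma unitary_rows:
  "unitary A \<Longrightarrow> (\<Sum>z\<in>UNIV. A $ a $ z * cnj (A $ b $ z)) = (if a = b then 1 else 0)"
  by (drule unitary_right) (simp add: vec_eq_iff matrix_mult_nth mat_def)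

lemma so_real_nth:
  assumes "X \<in> so_real"
  shows "X $ i $ j = - X $ j $ i"
proof -
  have "transpose X $ j $ i = (- X) $ j $ i" using assms by (simp add: so_real_def)
  then show ?thesis by (simp add: transpose_def)
qed

lemma so_real_cnj: "X \<in> so_real \<Longrightarrow> cnj (X $ i $ j) = X $ i $ j"
  by (simp add: so_real_def real_mat_def Reals_cnj_iff)

definition unit_mat :: "'n \<Rightarrow> 'n \<Rightarrow> 'n::finite cmat" where
  "unit_mat p q = (\<chi> i j. if i = p \<and> j = q then 1 else 0)"

lemma unit_mat_nth: "unit_mat p q $ i $ j = (if i = p then if j = q then 1 else 0 else 0)"
  by (simp add: unit_mat_def)

lemma mult_unit_mat: "(A ** unit_mat p q) $ i $ j = (if j = q then A $ i $ p else 0)"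
  by (simp add: matrix_mult_nth unit_mat_nth if_distrib cong: if_cong)

lemma unit_mat_so_real: "unit_mat p q - unit_mat q p \<in> so_real"
  by (auto simp: so_real_def real_mat_def transpose_def vec_eq_iff unit_mat_nth)

text \<open>Testing an identity on the generators \<open>unit_mat p q - unit_mat q p\<close> of
  so(n, R) turns it into a relation between two columns of \<open>A\<close> for every pair of rows;
  this is how statements about all of \<open>so_real\<close> are exploited.\<close>

lemma sandwich_unit_mat:
  "(ct A ** (unit_mat p q - unit_mat q p) ** A) $ b $ a
     = cnj (A $ p $ b) * A $ q $ a - cnj (A $ q $ b) * A $ p $ a"
proof -
  have *: "(ct A ** unit_mat p q ** A) $ b $ a = cnj (A $ p $ b) * A $ q $ a" for p q
    unfolding matrix_mult_nth[of "ct A ** unit_mat p q"] mult_unit_mat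
    by (simp add: if_distrib[of "\<lambda>x. x * _"] cong: if_cong)
  have "ct A ** (unit_mat p q - unit_mat q p) ** A
    = ct A ** unit_mat p q ** A - ct A ** unit_mat q p ** A"
    by (simp add: matrix_mult_nth vec_eq_iff sum_subtractf left_diff_distrib right_diff_distrib)
  then show ?thesis by (simp add: *)
qed

lemma rho_rk: "rk (rho x :: 'n::{finite,wellorder}) = CARD('n) - 1 - rk x"
  unfolding rho_def by (rule rk_en) simp

lemma rho_rho [simp]: "rho (rho x) = (x :: 'n::{finite,wellorder})"
proof -
  have "rk (rho (rho x)) = rk x" unfolding rho_rk using rk_less[of x] by linarith
  then show ?thesis by (simp add: rk_inject)
qed

section \<open>Gram-Schmidt orthonormalization\<close>

definition herm :: "'n::finite cvec \<Rightarrow> 'n cvec \<Rightarrow> complex" where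
  "herm u v = (\<Sum>x\<in>UNIV. u $ x * cnj (v $ x))"

lemma herm_sum_left: "herm (\<Sum>i\<in>I. c i *s u i) v = (\<Sum>i\<in>I. c i * herm (u i) v)"
  unfolding herm_def sum_component vector_smult_component sum_distrib_left sum_distrib_right
  by (subst sum.swap) (simp add: mult.assoc)

lemma herm_diff_left: "herm (u - u') v = herm u v - herm u' v"
  by (simp add: herm_def left_diff_distrib sum_subtractf)

lemma herm_scale_left: "herm (c *s u) v = c * herm u v"
  by (simp add: herm_def sum_distrib_left mult.assoc)

lemma herm_scale_right: "herm u (c *s v) = cnj c * herm u v"
  by (simp add: herm_def sum_distrib_left mult_ac)

lemma herm_swap: "herm v u = cnj (herm u v)"
  by (simp add: herm_def mult.commute)

lemma herm_self: "herm u u = of_real ((norm u)\<^sup>2)"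
proof -
  have "(norm u)\<^sup>2 = (\<Sum>x\<in>UNIV. (norm (u $ x))\<^sup>2)"
    by (simp add: norm_vec_def L2_set_def sum_nonneg)
  then show ?thesis by (simp add: herm_def flip: complex_norm_square)
qed

text \<open>\<open>W\<close> contains what is already built: as \<open>v\<close> lies outside it,
  subtracting the projection \<open>p\<close> leaves a nonzero vector. The clause on real data is
  what lets the same construction produce the Iwasawa decomposition over the reals.\<close>

lemma gram_schmidt_step:
  fixes f :: "'n::{finite,wellorder} \<Rightarrow> 'n cvec"
  assumes "\<And>y z. y \<in> K \<Longrightarrow> z \<in> K \<Longrightarrow> herm (f y) (f z) = (if y = z then 1 else 0)"
    and V: "vec.subspace V" "f ` K \<subseteq> V" "v \<in> V" and W: "vec.subspace W" "f ` K \<subseteq> W" "v \<notin> W"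
  shows "\<exists>u\<in>V. herm u u = 1 \<and> (\<forall>y\<in>K. herm u (f y) = 0) \<and>
    ((\<forall>x. v $ x \<in> \<real>) \<longrightarrow> (\<forall>y\<in>K. \<forall>x. f y $ x \<in> \<real>) \<longrightarrow> (\<forall>x. u $ x \<in> \<real>))"
proof -
  define p where "p = (\<Sum>z\<in>K. herm v (f z) *s f z)"
  define t where "t = v - p"
  have "p \<in> W" unfolding p_def using W by (auto intro!: vec.subspace_sum vec.subspace_scale)
  then have "t \<noteq> 0" using W unfolding t_def by auto
  have "p \<in> V" unfolding p_def using V by (auto intro!: vec.subspace_sum vec.subspace_scale)
  then have tV: "t \<in> V" unfolding t_def using V by (auto intro: vec.subspace_diff)
  have tf: "herm t (f y) = 0" if "y \<in> K" for y
  proof -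
    have "herm p (f y) = (\<Sum>z\<in>K. herm v (f z) * (if z = y then 1 else 0))"
      unfolding p_def herm_sum_left using that assms(1) by (intro sum.cong) auto
    also have "\<dots> = herm v (f y)" using that by (simp add: if_distrib cong: if_cong)
    finally show ?thesis by (simp add: t_def herm_diff_left)
  qed
  define u where "u = complex_of_real (1 / norm t) *s t"
  show ?thesis
  proof (intro bexI[of _ u] conjI impI allI ballI)
    show "u \<in> V" unfolding u_def using tV V by (auto intro: vec.subspace_scale)
    show "herm u u = 1"
      unfolding u_def herm_scale_left herm_scale_right herm_self[of t]
      using \<open>t \<noteq> 0\<close> by (simp add: power2_eq_square)
    show "herm u (f y) = 0" if "y \<in> K" for y
      using tf[OF that] by (simp add: u_def herm_scale_left)
    show "u $ x \<in> \<real>" if "\<forall>x. v $ x \<in> \<real>" and "\<forall>y\<in>K. \<forall>x. f y $ x \<in> \<real>" for x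
    proof -
      have v: "v $ x \<in> \<real>" and f: "y \<in> K \<Longrightarrow> f y $ x \<in> \<real>" for x y using that by auto
      have "herm v (f y) \<in> \<real>" if "y \<in> K" for y
        unfolding herm_def using v f[OF that] by (intro sum_in_Reals) (simp add: Reals_cnj_iff)
      then have "p $ x \<in> \<real>" unfolding p_def sum_component vector_smult_component
        by (intro sum_in_Reals Reals_mult f)
      then show ?thesis unfolding u_def t_def vector_smult_component vector_minus_component
        by (intro Reals_mult Reals_diff v Reals_of_real)
    qed
  qed
qed

lemma gram_schmidt:
  fixes A :: "'n::{finite,wellorder} cmat"
  assumes "invertible A"
  shows "\<exists>Q. unitary Q \<and> fl Q = fl A \<and> (real_mat A \<longrightarrow> real_mat Q)"
proof -
  have "\<exists>f :: 'n \<Rightarrow> 'n cvec.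
      (\<forall>y z. rk y < k \<longrightarrow> rk z < k \<longrightarrow> herm (f y) (f z) = (if y = z then 1 else 0)) \<and>
      (\<forall>y. rk y < k \<longrightarrow> f y \<in> fl A (Suc (rk y))) \<and>
      (real_mat A \<longrightarrow> (\<forall>y x. rk y < k \<longrightarrow> f y $ x \<in> \<real>))" if "k \<le> CARD('n)" for k
    using that
  proof (induction k)
    case 0
    then show ?case by auto
  next
    case (Suc k)
    then have "k \<le> CARD('n)" by simp
    from Suc.IH[OF this] obtain f :: "'n \<Rightarrow> 'n cvec" where
      f1: "\<And>y z. rk y < k \<Longrightarrow> rk z < k \<Longrightarrow> herm (f y) (f z) = (if y = z then 1 else 0)" and
      f2: "\<And>y. rk y < k \<Longrightarrow> f y \<in> fl A (Suc (rk y))" and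
      f3: "\<And>y x. real_mat A \<Longrightarrow> rk y < k \<Longrightarrow> f y $ x \<in> \<real>" by metis
    define y where "y = (en k :: 'n)"
    have rky: "rk y = k" using Suc.prems by (simp add: y_def)
    have mono: "fl A i \<subseteq> fl A j" if "i \<le> j" for i j
      using that unfolding fl_nth std_space_def by (intro image_mono) auto
    have vW: "A *v axis y 1 \<notin> fl A k"
      by (simp add: mem_fl_iff[OF assms] matrix_vector_mul_assoc matrix_inv_left[OF assms] std_space_def axis_def)
        (use rky in auto)
    have vV: "A *v axis y 1 \<in> fl A (Suc k)"
      using axis_std_space[of y] by (auto simp: fl_nth rky)
    have W: "f ` {z. rk z < k} \<subseteq> fl A k"
    proof clarify
      fix z :: 'n assume "rk z < k"
      then show "f z \<in> fl A k" using f2[of z] mono[of "Suc (rk z)" k] by auto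
    qed
    then have V: "f ` {z. rk z < k} \<subseteq> fl A (Suc k)" using mono[of k "Suc k"] by auto
    obtain u where u: "u \<in> fl A (Suc k)" "herm u u = 1" "\<And>z. rk z < k \<Longrightarrow> herm u (f z) = 0"
      "(\<forall>x. (A *v axis y 1) $ x \<in> \<real>) \<longrightarrow> (\<forall>z x. rk z < k \<longrightarrow> f z $ x \<in> \<real>) \<longrightarrow> (\<forall>x. u $ x \<in> \<real>)"
      using gram_schmidt_step[of "{z. rk z < k}" f "fl A (Suc k)" "A *v axis y 1" "fl A k"] f1 vW vV V W
      by auto
    have u': "herm (f z) u = 0" if "rk z < k" for z :: 'n
      using u(3)[OF that] herm_swap[of "f z" u] by simp
    have cases: "rk z < Suc k \<longleftrightarrow> rk z < k \<or> z = y" for z :: 'n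
      using rky by (metis less_Suc_eq rk_inject)
    show ?case
    proof (intro exI[of _ "f(y := u)"] conjI allI impI)
      fix a b :: 'n assume "rk a < Suc k" "rk b < Suc k"
      then show "herm ((f(y := u)) a) ((f(y := u)) b) = (if a = b then 1 else 0)"
        using f1 u u' rky by (auto simp: cases)
    next
      fix a :: 'n assume "rk a < Suc k"
      then show "(f(y := u)) a \<in> fl A (Suc (rk a))" using f2 u rky by (auto simp: cases)
    next
      fix a x :: 'n assume "real_mat A" "rk a < Suc k"
      moreover have "u $ x \<in> \<real>" using u(4) f3 \<open>real_mat A\<close> by (auto simp: real_mat_def)
      ultimately show "(f(y := u)) a $ x \<in> \<real>" using f3 by (auto simp: cases)
    qed
  qed
  from this[of "CARD('n)"] obtain f :: "'n \<Rightarrow> 'n cvec" where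
    f: "\<And>y z. herm (f y) (f z) = (if y = z then 1 else 0)" "\<And>y. f y \<in> fl A (Suc (rk y))"
    "\<And>y x. real_mat A \<Longrightarrow> f y $ x \<in> \<real>" by (metis rk_less order_refl)
  define Q :: "'n cmat" where "Q = (\<chi> i j. f j $ i)"
  have "unitary Q"
    unfolding unitary_columns
  proof (intro allI)
    fix a b
    show "(\<Sum>z\<in>UNIV. cnj (Q $ z $ a) * Q $ z $ b) = (if a = b then 1 else 0)"
      using f(1)[of b a] by (auto simp: herm_def Q_def mult.commute)
  qed
  moreover have "upper (matrix_inv A ** Q)"
  proof (rule upper_if_std_space)
    fix y :: 'n
    have "Q *v axis y 1 = f y" by (simp add: vec_eq_iff Q_def)
    then show "matrix_inv A ** Q *v axis y 1 \<in> std_space (Suc (rk y))"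
      using f(2)[of y] by (simp add: mem_fl_iff[OF assms] flip: matrix_vector_mul_assoc)
  qed
  ultimately show ?thesis
    using f(3) fl_eq_iff[OF assms, of Q] unitary_invertible[of Q]
    by (intro exI[of _ Q]) (auto simp: real_mat_def Q_def)
qed

text \<open>An order reversing bijection sends \<open>x\<close> to the element with as many
  predecessors as \<open>x\<close> has successors.\<close>

lemma strict_antimono_eq_rho:
  fixes \<sigma> :: "'n::{finite,wellorder} \<Rightarrow> 'n"
  assumes anti: "\<And>a b. a < b \<Longrightarrow> \<sigma> b < \<sigma> a"
  shows "\<sigma> = rho"
proof
  fix x
  have inj: "inj \<sigma>" by (rule injI) (metis anti not_less_iff_gr_or_eq)
  then have surj: "surj \<sigma>" by (simp add: finite_UNIV_inj_surj)
  have "{..<\<sigma> x} = \<sigma> ` {x<..}"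
  proof (intro set_eqI iffI)
    fix z assume z: "z \<in> {..<\<sigma> x}"
    obtain y where y: "z = \<sigma> y" using surj by blast
    then have "x < y" using z anti[of y x] by (cases x y rule: linorder_cases) auto
    then show "z \<in> \<sigma> ` {x<..}" using y by auto
  qed (use anti in auto)
  then have "rk (\<sigma> x) = card {x<..}"
    using inj by (simp add: rk_def card_image inj_on_subset)
  moreover have "card {x<..} + card {..<x} + 1 = CARD('n)"
  proof -
    have "(UNIV :: 'n set) = insert x ({x<..} \<union> {..<x})" by auto
    then have "CARD('n) = card (insert x ({x<..} \<union> {..<x}))" by simp
    also have "\<dots> = Suc (card ({x<..} \<union> {..<x}))" by (subst card_insert_disjoint) auto
    also have "card ({x<..} \<union> {..<x}) = card {x<..} + card {..<x}"
      by (rule card_Un_disjoint) auto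
    finally show ?thesis by simp
  qed
  ultimately have "rk (\<sigma> x) = rk (rho x)" unfolding rho_rk by (simp add: rk_def)
  then show "\<sigma> x = rho x" by (simp add: rk_inject)
qed

section \<open>Compact orbits with complex tangent spaces are isotropic\<close>

lemma ct_mult: "ct (A ** B) = ct B ** ct A"
  by (simp add: vec_eq_iff matrix_mult_nth mult.commute)

lemma matrix_diff_left: "A ** (B - C) = A ** B - A ** (C :: 'n::finite cmat)"
  by (simp add: vec_eq_iff matrix_mult_nth right_diff_distrib sum_subtractf)

lemma matrix_diff_right: "(B - C) ** A = B ** A - (C :: 'n::finite cmat) ** A"
  by (simp add: vec_eq_iff matrix_mult_nth left_diff_distrib sum_subtractf)

lemma matrix_add_right: "(B + C) ** A = B ** A + (C :: 'n::finite cmat) ** A"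
  by (simp add: vec_eq_iff matrix_mult_nth distrib_right sum.distrib)

lemma cscale_mult_left: "cscale c A ** B = cscale c (A ** B)"
  by (simp add: vec_eq_iff matrix_mult_nth sum_distrib_left mult.assoc)

lemma cscale_mult_right: "A ** cscale c B = cscale c (A ** B)"
  by (simp add: vec_eq_iff matrix_mult_nth sum_distrib_left mult_ac)

lemma so_real_ct:
  assumes "X \<in> so_real"
  shows "ct X = - X"
  unfolding vec_eq_iff
proof (intro allI)
  fix i j
  show "ct X $ i $ j = (- X) $ i $ j"
    using so_real_nth[OF assms, of j i] so_real_cnj[OF assms, of j i] by simp
qed

lemma sandwich_skew:
  assumes "X \<in> so_real"
  shows "(ct A ** X ** A) $ b $ a = - cnj ((ct A ** X ** A) $ a $ b)"
proof -
  have "ct (ct A ** X ** A) = ct A ** ct X ** A"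
    by (simp add: ct_mult matrix_mul_assoc) (simp add: vec_eq_iff matrix_mult_nth)
  also have "\<dots> = - (ct A ** X ** A)"
    by (simp add: so_real_ct[OF assms]) (simp add: vec_eq_iff matrix_mult_nth sum_negf)
  finally have "ct (ct A ** X ** A) $ b $ a = (- (ct A ** X ** A)) $ b $ a" by simp
  then show ?thesis by simp
qed

lemma mult_sum_nonzero_term:
  assumes "\<And>c. c \<noteq> b \<Longrightarrow> f c * g c = (0::complex)"
  shows "(\<Sum>c\<in>(UNIV::'n::finite set). f c * g c) = f b * g b"
proof -
  have "(\<Sum>c\<in>UNIV. f c * g c) = (\<Sum>c\<in>{b}. f c * g c)"
    using assms by (intro sum.mono_neutral_right) auto
  then show ?thesis by simp
qed

text \<open>The hypothesis \<open>st\<close> says that multiplication by \<open>\<i>\<close>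
  preserves the tangent space of the orbit. Conjugation is shown to carry each column to a multiple
  of a single column \<open>\<sigma> a\<close>, with \<open>\<sigma>\<close> reversing the order; an
  adjustment of phases then makes the multiples equal to 1.\<close>

lemma iso_frame_exists:
  fixes A :: "'n::{finite,wellorder} cmat"
  assumes un: "unitary A"
    and st: "\<And>X. X \<in> so_real \<Longrightarrow> \<exists>Y\<in>so_real. stab (fl A) (cscale \<i> X - Y)"
  shows "\<exists>B. iso_frame B \<and> fl B = fl A"
proof -
  \<comment> \<open>The Gram matrix of the bilinear form in the columns of \<open>A\<close>. As the
    columns are unitary, the conjugate of column \<open>a\<close> is the combination of all columns
    with \<open>cnj (J $ a $ c)\<close> in front of column \<open>c\<close>.\<close>
  define J where "J = transpose A ** A"
  have J: "J $ a $ b = (\<Sum>z\<in>UNIV. A $ z $ a * A $ z $ b)" for a b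
    by (simp add: J_def matrix_mult_nth transpose_def)
  have Jsym: "J $ a $ b = J $ b $ a" for a b by (simp add: J mult.commute)
  have col: "(\<Sum>z\<in>UNIV. cnj (A $ z $ a) * A $ z $ b) = (if a = b then 1 else 0)" for a b
    using un by (simp add: unitary_columns)
  have col': "(\<Sum>z\<in>UNIV. A $ z $ a * cnj (A $ z $ b)) = (if a = b then 1 else 0)" for a b
    using col[of b a] by (simp add: mult.commute)
  have colJ: "(\<Sum>z\<in>UNIV. cnj (A $ z $ a) * cnj (A $ z $ b)) = cnj (J $ a $ b)" for a b
    by (simp add: J)
  have col_nz: "\<exists>p. A $ p $ a \<noteq> 0" for a
  proof (rule ccontr)
    assume "\<nexists>p. A $ p $ a \<noteq> 0"
    then show False using col[of a a] by simp
  qed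

  text \<open>With \<open>U = A\<^sup>* (\<i> X - Y) A\<close> upper triangular, skewness of \<open>\<i> X - Y\<close> reads \<open>J U + U\<^sup>t J = 0\<close>.\<close>
  have UP: "\<exists>Y\<in>so_real. \<forall>a b. (a < b \<longrightarrow> \<i> * (ct A ** X ** A) $ b $ a = (ct A ** Y ** A) $ b $ a) \<and>
      (J $ a $ b \<noteq> 0 \<longrightarrow> (\<forall>c<b. J $ a $ c = 0) \<longrightarrow> (\<forall>c<a. J $ c $ b = 0) \<longrightarrow>
         (ct A ** X ** A) $ a $ a + (ct A ** X ** A) $ b $ b = 0)"
    if X: "X \<in> so_real" for X
  proof -
    obtain Y where Y: "Y \<in> so_real" and sY: "stab (fl A) (cscale \<i> X - Y)" using st[OF X] by blast
    define \<beta> where "\<beta> = cscale \<i> X - Y"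
    define U where "U = ct A ** \<beta> ** A"
    have U: "upper U"
      using sY unfolding stab_fl[OF unitary_invertible[OF un]] unitary_inv[OF un] U_def \<beta>_def .
    have Unth: "U $ a $ b = \<i> * (ct A ** X ** A) $ a $ b - (ct A ** Y ** A) $ a $ b" for a b
      by (simp add: U_def \<beta>_def matrix_diff_left matrix_diff_right cscale_mult_left cscale_mult_right)
    have \<beta>t: "transpose \<beta> = - \<beta>"
      unfolding \<beta>_def vec_eq_iff
    proof (intro allI)
      fix i j
      show "transpose (cscale \<i> X - Y) $ i $ j = (- (cscale \<i> X - Y)) $ i $ j"
        using so_real_nth[OF X, of j i] so_real_nth[OF Y, of j i] by (simp add: transpose_def)
    qed
    have AU: "\<beta> ** A = A ** U"
      by (simp add: U_def matrix_mul_assoc unitary_right[OF un])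
    have "transpose U ** J = transpose (A ** U) ** A"
      by (simp add: J_def matrix_mul_assoc matrix_transpose_mul)
    also have "\<dots> = transpose A ** transpose \<beta> ** A"
      by (simp add: AU[symmetric] matrix_transpose_mul)
    also have "\<dots> = - (transpose A ** (\<beta> ** A))"
      by (simp add: \<beta>t matrix_mul_assoc) (simp add: vec_eq_iff matrix_mult_nth sum_negf)
    also have "\<dots> = - (J ** U)" by (simp add: AU J_def matrix_mul_assoc)
    finally have sum0: "(\<Sum>c\<in>UNIV. U $ c $ a * J $ c $ b) + (\<Sum>c\<in>UNIV. J $ a $ c * U $ c $ b) = 0" for a b
      by (simp add: vec_eq_iff matrix_mult_nth transpose_def)
    \<comment> \<open>At an entry of \<open>J\<close> that is the first nonzero one of its row and
      of its column, triangularity of \<open>U\<close> leaves only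
      \<open>(U $ a $ a + U $ b $ b) * J $ a $ b\<close>. Diagonal entries of
      \<open>ct A ** Z ** A\<close> are imaginary for \<open>Z\<close> in \<open>so_real\<close>, so
      the real part of the vanishing sum involves \<open>X\<close> alone.\<close>
    have corner: "(ct A ** X ** A) $ a $ a + (ct A ** X ** A) $ b $ b = 0"
      if nz: "J $ a $ b \<noteq> 0" and z1: "\<forall>c<b. J $ a $ c = 0" and z2: "\<forall>c<a. J $ c $ b = 0" for a b
    proof -
      have U0: "U $ c $ d = 0" if "d < c" for c d using U that by (simp add: upper_def)
      have "(\<Sum>c\<in>UNIV. U $ c $ a * J $ c $ b) = U $ a $ a * J $ a $ b"
        by (rule mult_sum_nonzero_term) (metis U0 z2 mult_eq_0_iff linorder_neqE)
      moreover have "(\<Sum>c\<in>UNIV. J $ a $ c * U $ c $ b) = J $ a $ b * U $ b $ b"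
        by (rule mult_sum_nonzero_term) (metis U0 z1 mult_eq_0_iff linorder_neqE)
      ultimately have "(U $ a $ a + U $ b $ b) * J $ a $ b = 0"
        using sum0[of a b] by (simp add: algebra_simps)
      then have UU: "U $ a $ a + U $ b $ b = 0" using nz by simp
      have imag: "Re ((ct A ** Z ** A) $ c $ c) = 0" if "Z \<in> so_real" for Z c
        using arg_cong[OF sandwich_skew[OF that, of A c c], of Re] by simp
      have "Im ((ct A ** X ** A) $ a $ a + (ct A ** X ** A) $ b $ b) = 0"
        using arg_cong[OF UU, of Re] imag[OF Y] by (simp add: Unth)
      then show ?thesis using imag[OF X] by (simp add: complex_eq_iff)
    qed
    have lower0: "\<i> * (ct A ** X ** A) $ b $ a = (ct A ** Y ** A) $ b $ a" if "a < b" for a b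
      using U that Unth[of b a] by (simp add: upper_def)
    show ?thesis using Y corner lower0 by blast
  qed

  have step: "\<exists>b. \<forall>p. cnj (A $ p $ a) = cnj (J $ a $ b) * A $ p $ b" for a
  proof (induction a rule: less_induct)
    case (less a)
    have "\<exists>b. J $ a $ b \<noteq> 0"
    proof (rule ccontr)
      assume *: "\<nexists>b. J $ a $ b \<noteq> 0"
      have "cnj (A $ p $ a) = 0" for p
      proof -
        have "cnj (A $ p $ a) = (\<Sum>z\<in>UNIV. cnj (A $ z $ a) * (\<Sum>b\<in>UNIV. A $ p $ b * cnj (A $ z $ b)))"
          by (simp add: unitary_rows[OF un] if_distrib cong: if_cong)
        also have "\<dots> = (\<Sum>b\<in>UNIV. A $ p $ b * (\<Sum>z\<in>UNIV. cnj (A $ z $ a) * cnj (A $ z $ b)))"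
          unfolding sum_distrib_left by (subst sum.swap) (simp add: mult_ac)
        also have "\<dots> = 0" using * by (simp add: colJ)
        finally show ?thesis .
      qed
      then show False using col_nz[of a] by auto
    qed
    define b where "b = (LEAST b. J $ a $ b \<noteq> 0)"
    have Jab: "J $ a $ b \<noteq> 0" and min: "\<And>c. c < b \<Longrightarrow> J $ a $ c = 0"
      using LeastI_ex[OF \<open>\<exists>b. J $ a $ b \<noteq> 0\<close>] not_less_Least[of _ "\<lambda>b. J $ a $ b \<noteq> 0"]
      unfolding b_def by auto
    show ?case
    \<comment> \<open>If \<open>b < a\<close>, the conjugate of column \<open>b\<close> is already a
      multiple of one column, which must be column \<open>a\<close> because \<open>J $ b $ a\<close>
      is nonzero; conjugating back proves the claim. Otherwise \<open>b\<close> is minimal in its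
      row by choice and \<open>z2\<close> gives minimality in the column, so that \<open>UP\<close>
      applies.\<close>
    proof (cases "b < a")
      case True
      obtain d where d: "\<And>p. cnj (A $ p $ b) = cnj (J $ b $ d) * A $ p $ d"
        using less.IH[OF True] by blast
      have d': "A $ p $ b = J $ b $ d * cnj (A $ p $ d)" for p
        using arg_cong[OF d[of p], of cnj] by simp
      have e: "J $ b $ a = J $ b $ d * (\<Sum>z\<in>UNIV. cnj (A $ z $ d) * A $ z $ a)"
        unfolding J[of b a] sum_distrib_left by (simp add: d' mult.assoc)
      have "(\<Sum>z\<in>UNIV. cnj (A $ z $ d) * A $ z $ a) \<noteq> 0"
        using Jab unfolding Jsym[of a b] e by simp
      then have [simp]: "d = a" by (simp add: col split: if_splits)
      have "1 = (\<Sum>z\<in>UNIV. cnj (A $ z $ b) * A $ z $ b)" by (simp add: col)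
      also have "\<dots> = cnj (J $ b $ a) * J $ b $ a * (\<Sum>z\<in>UNIV. A $ z $ a * cnj (A $ z $ a))"
        unfolding sum_distrib_left by (simp add: d d' mult_ac)
      also have "\<dots> = cnj (J $ b $ a) * J $ b $ a" by (simp add: col')
      finally have one: "cnj (J $ b $ a) * J $ b $ a = 1" by simp
      have "cnj (A $ p $ a) = cnj (J $ a $ b) * A $ p $ b" for p
        using one by (simp add: d'[of p] Jsym[of a b] flip: mult.assoc)
      then show ?thesis by blast
    next
      case False
      \<comment> \<open>Otherwise the conjugate of column \<open>c\<close> would be a multiple of
        column \<open>b\<close>, and \<open>J $ a $ b\<close> would be proportional to the hermitian
        product of columns \<open>a\<close> and \<open>c\<close>, which is 0.\<close>
      have z2: "J $ c $ b = 0" if c: "c < a" for c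
      proof (rule ccontr)
        assume nz: "J $ c $ b \<noteq> 0"
        obtain d where d: "\<And>p. cnj (A $ p $ c) = cnj (J $ c $ d) * A $ p $ d"
          using less.IH[OF c] by blast
        have d': "A $ p $ c = J $ c $ d * cnj (A $ p $ d)" for p
          using arg_cong[OF d[of p], of cnj] by simp
        have e: "J $ c $ b = J $ c $ d * (\<Sum>z\<in>UNIV. cnj (A $ z $ d) * A $ z $ b)"
          unfolding J[of c b] sum_distrib_left by (simp add: d' mult.assoc)
        have "(\<Sum>z\<in>UNIV. cnj (A $ z $ d) * A $ z $ b) \<noteq> 0"
          using nz unfolding e by simp
        then have [simp]: "d = b" by (simp add: col split: if_splits)
        have "cnj (J $ c $ b) * J $ a $ b = (\<Sum>z\<in>UNIV. A $ z $ a * cnj (A $ z $ c))"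
          unfolding J[of a b] sum_distrib_left by (simp add: d mult_ac)
        also have "\<dots> = 0" using c by (simp add: col')
        finally show False using nz Jab by simp
      qed
      \<comment> \<open>Up to transposition these are the entries of the orthogonal projection onto
        the span of the two columns (of twice the projection if \<open>a = b\<close>). Symmetry
        makes it real, so the span is closed under conjugation.\<close>
      have sym: "cnj (A $ p $ a) * A $ q $ a + cnj (A $ p $ b) * A $ q $ b
          = cnj (A $ q $ a) * A $ p $ a + cnj (A $ q $ b) * A $ p $ b" for p q
        using UP[OF unit_mat_so_real[of p q]] Jab min z2
        by (auto simp: sandwich_unit_mat algebra_simps)
      \<comment> \<open>Multiplying \<open>sym\<close> by \<open>cnj (A $ q $ a)\<close> and summing
        over \<open>q\<close> expresses the conjugate of column \<open>a\<close> through columns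
        \<open>a\<close> and \<open>b\<close>. For \<open>a < b\<close> the first of these drops
        out, as \<open>J $ a $ a = 0\<close> by minimality of \<open>b\<close>.\<close>
      have eq: "cnj (A $ p $ a) + cnj (A $ p $ b) * (if a = b then 1 else 0)
          = A $ p $ a * cnj (J $ a $ a) + A $ p $ b * cnj (J $ a $ b)" for p
      proof -
        have "(\<Sum>q\<in>UNIV. (cnj (A $ p $ a) * A $ q $ a + cnj (A $ p $ b) * A $ q $ b) * cnj (A $ q $ a))
          = (\<Sum>q\<in>UNIV. (cnj (A $ q $ a) * A $ p $ a + cnj (A $ q $ b) * A $ p $ b) * cnj (A $ q $ a))"
          by (simp only: sym)
        moreover have "(\<Sum>q\<in>UNIV. (cnj (A $ p $ a) * A $ q $ a + cnj (A $ p $ b) * A $ q $ b) * cnj (A $ q $ a))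
          = cnj (A $ p $ a) * (\<Sum>q\<in>UNIV. A $ q $ a * cnj (A $ q $ a))
            + cnj (A $ p $ b) * (\<Sum>q\<in>UNIV. A $ q $ b * cnj (A $ q $ a))"
          by (simp add: sum_distrib_left distrib_right sum.distrib mult.assoc)
        moreover have "(\<Sum>q\<in>UNIV. (cnj (A $ q $ a) * A $ p $ a + cnj (A $ q $ b) * A $ p $ b) * cnj (A $ q $ a))
          = A $ p $ a * (\<Sum>q\<in>UNIV. cnj (A $ q $ a) * cnj (A $ q $ a))
            + A $ p $ b * (\<Sum>q\<in>UNIV. cnj (A $ q $ a) * cnj (A $ q $ b))"
          unfolding sum_distrib_left sum.distrib[symmetric] by (simp add: algebra_simps)
        ultimately show ?thesis by (simp only: col' colJ) (auto split: if_splits)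
      qed
      show ?thesis
      proof (cases "a = b")
        case True
        then show ?thesis using eq by (intro exI[of _ b]) (simp add: mult.commute)
      next
        case nab: False
        then have "J $ a $ a = 0" using False min by auto
        then show ?thesis using eq nab by (intro exI[of _ b]) (simp add: mult.commute)
      qed
    qed
  qed
  then obtain \<sigma> where \<sigma>: "\<And>a p. cnj (A $ p $ a) = cnj (J $ a $ \<sigma> a) * A $ p $ \<sigma> a" by metis
  have \<sigma>': "A $ p $ a = J $ a $ \<sigma> a * cnj (A $ p $ \<sigma> a)" for a p
    using arg_cong[OF \<sigma>[of p a], of cnj] by simp
  have J\<sigma>: "J $ a $ b \<noteq> 0 \<longleftrightarrow> b = \<sigma> a" for a b
  proof -
    have "J $ a $ b = J $ a $ \<sigma> a * (\<Sum>z\<in>UNIV. cnj (A $ z $ \<sigma> a) * A $ z $ b)"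
      unfolding J[of a b] sum_distrib_left by (simp add: \<sigma>'[of _ a] mult.assoc)
    then have *: "J $ a $ b = J $ a $ \<sigma> a * (if \<sigma> a = b then 1 else 0)" by (simp add: col)
    moreover have "J $ a $ \<sigma> a \<noteq> 0" using \<sigma>'[of _ a] col_nz[of a] by auto
    ultimately show ?thesis by auto
  qed
  have \<sigma>\<sigma>: "\<sigma> (\<sigma> a) = a" for a using J\<sigma>[of a "\<sigma> a"] J\<sigma>[of "\<sigma> a" a] Jsym[of a "\<sigma> a"] by auto
  have Jnorm: "cnj (J $ a $ \<sigma> a) * J $ a $ \<sigma> a = 1" for a
  proof -
    have "1 = (\<Sum>z\<in>UNIV. cnj (A $ z $ a) * A $ z $ a)" by (simp add: col)
    also have "\<dots> = cnj (J $ a $ \<sigma> a) * J $ a $ \<sigma> a * (\<Sum>z\<in>UNIV. A $ z $ \<sigma> a * cnj (A $ z $ \<sigma> a))"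
      unfolding sum_distrib_left by (simp add: \<sigma>[of _ a] \<sigma>'[of _ a] mult_ac)
    finally show ?thesis by (simp add: col')
  qed
  \<comment> \<open>If \<open>\<sigma>\<close> preserved the order of \<open>a < b\<close>, the
    entries at \<open>(b, a)\<close> and \<open>(\<sigma> b, \<sigma> a)\<close> would both lie
    below the diagonal. They are conjugate up to a factor common to \<open>X\<close> and
    \<open>Y\<close>, so the relation with factor \<open>\<i>\<close> holds together with its
    conjugate and the entry vanishes for all \<open>X\<close>.\<close>
  have anti: "\<sigma> b < \<sigma> a" if ab: "a < b" for a b
  proof (rule ccontr)
    assume "\<not> \<sigma> b < \<sigma> a"
    moreover have "\<sigma> a \<noteq> \<sigma> b" using ab by (metis \<sigma>\<sigma> less_irrefl)
    ultimately have \<sigma>ab: "\<sigma> a < \<sigma> b" by auto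
    have P0: "(ct A ** X ** A) $ b $ a = 0" if X: "X \<in> so_real" for X
    proof -
      obtain Y where Y: "Y \<in> so_real"
        and e1: "\<i> * (ct A ** X ** A) $ b $ a = (ct A ** Y ** A) $ b $ a"
        and e2: "\<i> * (ct A ** X ** A) $ \<sigma> b $ \<sigma> a = (ct A ** Y ** A) $ \<sigma> b $ \<sigma> a"
        using UP[OF X] ab \<sigma>ab by blast
      have sw: "cnj ((ct A ** Z ** A) $ b $ a)
          = cnj (J $ a $ \<sigma> a) * J $ b $ \<sigma> b * (ct A ** Z ** A) $ \<sigma> b $ \<sigma> a"
        if Z: "Z \<in> so_real" for Z
        by (simp add: matrix_mult_nth sum_distrib_left sum_distrib_right so_real_cnj[OF Z]
            \<sigma>[of _ a] \<sigma>'[of _ b] mult_ac)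
      have "\<i> * cnj ((ct A ** X ** A) $ b $ a) = cnj ((ct A ** Y ** A) $ b $ a)"
        unfolding sw[OF X] sw[OF Y] e2[symmetric] by simp
      then have "cnj (\<i> * cnj ((ct A ** X ** A) $ b $ a)) = \<i> * (ct A ** X ** A) $ b $ a"
        by (simp add: e1)
      then show ?thesis by simp
    qed
    \<comment> \<open>On generators the vanishing makes the conjugate of column \<open>b\<close> a
      multiple of column \<open>a\<close>, so \<open>\<sigma>\<close> exchanges \<open>a\<close> and
      \<open>b\<close>, which is incompatible with the two inequalities.\<close>
    have sym: "cnj (A $ p $ b) * A $ q $ a = cnj (A $ q $ b) * A $ p $ a" for p q
      using P0[OF unit_mat_so_real[of p q]] by (simp add: sandwich_unit_mat)
    have "cnj (A $ p $ b) = A $ p $ a * cnj (J $ b $ a)" for p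
    proof -
      have "(\<Sum>q\<in>UNIV. cnj (A $ p $ b) * A $ q $ a * cnj (A $ q $ a))
          = (\<Sum>q\<in>UNIV. cnj (A $ q $ b) * A $ p $ a * cnj (A $ q $ a))"
        by (simp only: sym)
      moreover have "(\<Sum>q\<in>UNIV. cnj (A $ p $ b) * A $ q $ a * cnj (A $ q $ a)) = cnj (A $ p $ b)"
        using col'[of a a] by (simp add: mult.assoc flip: sum_distrib_left)
      moreover have "(\<Sum>q\<in>UNIV. cnj (A $ q $ b) * A $ p $ a * cnj (A $ q $ a)) = A $ p $ a * cnj (J $ b $ a)"
        unfolding colJ[symmetric] sum_distrib_left by (simp add: mult_ac)
      ultimately show ?thesis by simp
    qed
    then have "J $ b $ a \<noteq> 0" using col_nz[of b] by auto
    then have "a = \<sigma> b" "b = \<sigma> a" using J\<sigma> Jsym by metis+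
    then show False using ab \<sigma>ab by auto
  qed
  have rho: "\<sigma> = rho" using strict_antimono_eq_rho anti by blast
  \<comment> \<open>Columns of the first half keep their phase, their partners absorb the unimodular
    factor, and a middle column fixed by \<open>rho\<close> needs a square root of it.\<close>
  define d where "d y = (if y < rho y then 1 else if rho y < y then cnj (J $ rho y $ y)
      else csqrt (cnj (J $ y $ y)))" for y
  have dd: "cnj (d y) * d y = 1" for y
  proof -
    have n: "cmod (J $ a $ \<sigma> a) = 1" for a
      using arg_cong[OF Jnorm[of a], of cmod] by (simp add: norm_mult power2_eq_square[symmetric] abs_square_eq_1)
    have "cmod (d y) = 1"
      unfolding d_def using n[of y] n[of "rho y"] rho
      by (auto simp: norm_csqrt)
    then show ?thesis by (metis complex_mod_mult_cnj mult.commute of_real_1 one_power2 complex_norm_square)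
  qed
  have dcnj: "d (rho y) = cnj (d y) * cnj (J $ y $ rho y)" for y
  proof (cases "y < rho y \<or> rho y < y")
    case True
    then show ?thesis
    proof
      assume "y < rho y"
      then show ?thesis by (auto simp: d_def)
    next
      assume "rho y < y"
      then show ?thesis using Jnorm[of y] rho Jsym[of y "rho y"] by (auto simp: d_def mult.commute)
    qed
  next
    case False
    then have e: "rho y = y" by auto
    have "d y * d y = cnj (J $ y $ y)" using e by (simp add: d_def flip: power2_eq_square)
    then have "cnj (d y) * cnj (J $ y $ y) = (cnj (d y) * d y) * d y" by (simp add: mult.assoc)
    then show ?thesis using dd[of y] e by simp
  qed
  define B :: "'n cmat" where "B = (\<chi> x y. d y * A $ x $ y)"
  have "unitary B"
    unfolding unitary_columns
  proof (intro allI)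
    fix a b
    have "(\<Sum>z\<in>UNIV. cnj (B $ z $ a) * B $ z $ b) = cnj (d a) * d b * (\<Sum>z\<in>UNIV. cnj (A $ z $ a) * A $ z $ b)"
      unfolding sum_distrib_left by (simp add: B_def mult_ac)
    then show "(\<Sum>z\<in>UNIV. cnj (B $ z $ a) * B $ z $ b) = (if a = b then 1 else 0)"
      using dd by (simp add: col)
  qed
  moreover have "B $ x $ rho y = cnj (B $ x $ y)" for x y
    using \<sigma>[of x y] rho by (simp add: B_def dcnj mult_ac)
  moreover have "fl A = fl B"
  proof -
    have "(ct A ** B) $ a $ b = d b * (\<Sum>z\<in>UNIV. cnj (A $ z $ a) * A $ z $ b)" for a b
      unfolding sum_distrib_left by (simp add: B_def matrix_mult_nth mult_ac)
    then have "upper (ct A ** B)" by (auto simp: upper_def col)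
    then show ?thesis
      using fl_eq_iff[OF unitary_invertible[OF un] unitary_invertible[OF \<open>unitary B\<close>]]
      by (simp add: unitary_inv[OF un])
  qed
  ultimately show ?thesis unfolding iso_frame_def by metis
qed

section \<open>Tangent spaces of submanifolds\<close>

lemma bounded_bilinear_matrix_mult:
  "bounded_bilinear ((**) :: 'n::finite cmat \<Rightarrow> 'n cmat \<Rightarrow> 'n cmat)"
  unfolding bilinear_conv_bounded_bilinear[symmetric] bilinear_def
  by (auto intro!: linearI
      simp: vec_eq_iff matrix_mult_nth algebra_simps sum.distrib scaleR_sum_right)

lemmas bounded_linear_mult_left = bounded_bilinear.bounded_linear_right[OF bounded_bilinear_matrix_mult]
lemmas bounded_linear_mult_right = bounded_bilinear.bounded_linear_left[OF bounded_bilinear_matrix_mult]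

lemma bounded_linear_low: "bounded_linear (low :: 'n::{finite,wellorder} cmat \<Rightarrow> 'n cmat)"
  by (simp add: linear_low flip: linear_conv_bounded_linear)

text \<open>\<open>dim\<close> is the real dimension, so each free complex entry counts twice; a
  complex dimension \<open>d\<close> shows up as \<open>2 * d\<close> from here on.\<close>

lemma dim_support:
  "dim {y :: 'n::finite cmat. \<forall>i j. (i, j) \<notin> I \<longrightarrow> y $ i $ j = 0} = 2 * card I"
proof -
  define f :: "('n \<times> 'n) \<times> complex \<Rightarrow> 'n cmat" where "f = (\<lambda>((i, j), b). axis i (axis j b))"
  define d where "d = f ` (I \<times> Basis)"
  have nz: "b \<noteq> 0" if "b \<in> Basis" for b :: complex using that nonzero_Basis by auto
  have "inj_on f (I \<times> Basis)"
    by (auto simp: inj_on_def f_def axis_eq_axis nz)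
  then have "card d = 2 * card I"
    by (simp add: d_def card_image card_cartesian_product)
  moreover have "d \<subseteq> Basis"
    by (auto simp: d_def f_def Basis_vec_def)
  moreover have "{y :: 'n cmat. \<forall>i j. (i, j) \<notin> I \<longrightarrow> y $ i $ j = 0}
      = {x. \<forall>i\<in>Basis. i \<notin> d \<longrightarrow> x \<bullet> i = 0}"
  proof (intro set_eqI iffI)
    fix y :: "'n cmat" assume y: "y \<in> {y. \<forall>i j. (i, j) \<notin> I \<longrightarrow> y $ i $ j = 0}"
    have "y \<bullet> e = 0" if e: "e \<in> Basis" "e \<notin> d" for e
    proof -
      obtain i j b where b: "b \<in> Basis" "e = axis i (axis j (b::complex))"
        using e by (auto simp: Basis_vec_def)
      then have "(i, j) \<notin> I" using e by (force simp: d_def f_def)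
      then show ?thesis using y b by (simp add: inner_axis)
    qed
    then show "y \<in> {x. \<forall>i\<in>Basis. i \<notin> d \<longrightarrow> x \<bullet> i = 0}" by simp
  next
    fix y :: "'n cmat" assume y: "y \<in> {x. \<forall>i\<in>Basis. i \<notin> d \<longrightarrow> x \<bullet> i = 0}"
    have "y $ i $ j = 0" if "(i, j) \<notin> I" for i j
    proof (rule euclidean_eqI)
      fix b :: complex assume b: "b \<in> Basis"
      have "axis i (axis j b) \<in> Basis" using b by (auto simp: Basis_vec_def)
      moreover have "axis i (axis j b) \<notin> d"
        using that b by (auto simp: d_def f_def axis_eq_axis nz)
      ultimately have "y \<bullet> axis i (axis j b) = 0" using y by auto
      then show "y $ i $ j \<bullet> b = 0 \<bullet> b" by (simp add: inner_axis)
    qed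
    then show "y \<in> {y. \<forall>i j. (i, j) \<notin> I \<longrightarrow> y $ i $ j = 0}" by simp
  qed
  ultimately show ?thesis by (simp add: dim_substandard)
qed

lemma subspace_support:
  "subspace {y :: 'n::finite cmat. \<forall>i j. (i, j) \<notin> I \<longrightarrow> y $ i $ j = 0}"
  by (auto simp: subspace_def)

text \<open>The curves are differentiable at time 0 only. So weak a notion is easily met by
  factorized matrix curves, and it can still be exploited along a sequence of times tending to
  0.\<close>

definition tangent :: "'n::finite cmat set \<Rightarrow> 'n cmat \<Rightarrow> 'n cmat set" where
  "tangent M x = {\<eta>. \<exists>\<gamma>. \<gamma> (0::real) = x \<and> (\<forall>\<^sub>F t in at 0. \<gamma> t \<in> M) \<and>
     (\<gamma> has_vector_derivative \<eta>) (at 0)}"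

lemma vector_derivative_tendsto:
  fixes \<gamma> :: "real \<Rightarrow> 'a::real_normed_vector"
  assumes "(\<gamma> has_vector_derivative \<eta>) (at 0)"
  shows "((\<lambda>t. (\<gamma> t - \<gamma> 0) /\<^sub>R t) \<longlongrightarrow> \<eta>) (at 0)"
proof -
  have "((\<lambda>t. norm (\<gamma> t - \<gamma> 0 - t *\<^sub>R \<eta>) / norm t) \<longlongrightarrow> 0) (at 0)"
    using assms unfolding has_vector_derivative_def has_derivative_at by (auto elim: LIM_cong[THEN iffD1, rotated -1])
  moreover have "\<forall>\<^sub>F t in at 0. norm (\<gamma> t - \<gamma> 0 - t *\<^sub>R \<eta>) / norm t = norm ((\<gamma> t - \<gamma> 0) /\<^sub>R t - \<eta>)"
  proof (rule eventually_at_filter[THEN iffD2], rule always_eventually, intro allI impI)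
    fix t :: real assume "t \<noteq> 0"
    then have "(\<gamma> t - \<gamma> 0) /\<^sub>R t - \<eta> = (\<gamma> t - \<gamma> 0 - t *\<^sub>R \<eta>) /\<^sub>R t"
      by (simp add: scaleR_diff_right)
    then show "norm (\<gamma> t - \<gamma> 0 - t *\<^sub>R \<eta>) / norm t = norm ((\<gamma> t - \<gamma> 0) /\<^sub>R t - \<eta>)"
      by (simp add: divide_inverse mult.commute)
  qed
  ultimately have "((\<lambda>t. norm ((\<gamma> t - \<gamma> 0) /\<^sub>R t - \<eta>)) \<longlongrightarrow> 0) (at 0)"
    by (simp add: tendsto_cong)
  then show ?thesis by (simp add: tendsto_norm_zero_iff LIM_zero_iff)
qed

lemma closed_vector_derivative_in_subspace:
  fixes \<gamma> :: "real \<Rightarrow> 'a::euclidean_space"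
  assumes "subspace V" "(\<gamma> has_vector_derivative \<eta>) (at 0)" "\<gamma> 0 \<in> V" "\<forall>\<^sub>F t in at 0. \<gamma> t \<in> V"
  shows "\<eta> \<in> V"
proof (rule Lim_in_closed_set[OF closed_subspace[OF assms(1)]])
  show "((\<lambda>t. (\<gamma> t - \<gamma> 0) /\<^sub>R t) \<longlongrightarrow> \<eta>) (at 0)"
    by (rule vector_derivative_tendsto[OF assms(2)])
  show "\<forall>\<^sub>F t in at 0. (\<gamma> t - \<gamma> 0) /\<^sub>R t \<in> V"
    using assms(4) by eventually_elim (use assms in \<open>auto intro: subspace_scale subspace_diff\<close>)
qed simp

text \<open>In the straightening chart the tangent space is a coordinate plane, and it comes back as
  the image under the derivative \<open>\<psi>'\<close>. Complex linearity of \<open>\<psi>'\<close>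
  gives the closure under \<open>cscale\<close>, injectivity gives the dimension.\<close>

lemma mat_submanifold_tangent:
  fixes M :: "'n::finite cmat set"
  assumes M: "mat_submanifold_at d M x" and x: "x \<in> M"
  shows "subspace (tangent M x)" "dim (tangent M x) = 2 * d"
    "\<And>c \<eta>. \<eta> \<in> tangent M x \<Longrightarrow> cscale c \<eta> \<in> tangent M x"
proof -
  obtain U V \<phi> \<psi> I where U: "open U" "x \<in> U" and V: "open V" and hom: "homeomorphism U V \<phi> \<psi>"
    and hol: "holomorphic_mat \<phi> U" "holomorphic_mat \<psi> V" and I: "card I = d"
    and im: "\<phi> ` (U \<inter> M) = V \<inter> {y. \<forall>i j. (i, j) \<notin> I \<longrightarrow> y $ i $ j = 0}"
    using M unfolding mat_submanifold_at_def by blast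
  define P where "P = {y :: 'n cmat. \<forall>i j. (i, j) \<notin> I \<longrightarrow> y $ i $ j = 0}"
  have \<psi>\<phi>: "\<And>u. u \<in> U \<Longrightarrow> \<psi> (\<phi> u) = u" and \<phi>\<psi>: "\<And>v. v \<in> V \<Longrightarrow> \<phi> (\<psi> v) = v"
    and \<phi>U: "\<phi> ` U = V" using hom by (auto simp: homeomorphism_def)
  have \<phi>x: "\<phi> x \<in> V" "\<phi> x \<in> P" using im U x \<phi>U unfolding P_def by blast+
  obtain \<phi>' where \<phi>': "(\<phi> has_derivative \<phi>') (at x)"
    using hol(1) U unfolding holomorphic_mat_def by blast
  obtain \<psi>' where \<psi>': "(\<psi> has_derivative \<psi>') (at (\<phi> x))"
    and clin: "\<And>c h. \<psi>' (cscale c h) = cscale c (\<psi>' h)"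
    using hol(2) \<phi>x unfolding holomorphic_mat_def by blast
  have "((\<psi> \<circ> \<phi>) has_derivative (\<psi>' \<circ> \<phi>')) (at x)" by (rule diff_chain_at[OF \<phi>' \<psi>'])
  moreover have "((\<psi> \<circ> \<phi>) has_derivative id) (at x)"
    by (rule has_derivative_transform_within_open[OF has_derivative_id U]) (simp add: \<psi>\<phi>)
  ultimately have c1: "\<psi>' \<circ> \<phi>' = id" by (rule has_derivative_unique)
  have "(\<phi> has_derivative \<phi>') (at (\<psi> (\<phi> x)))" using \<phi>' \<psi>\<phi>[OF U(2)] by simp
  then have "((\<phi> \<circ> \<psi>) has_derivative (\<phi>' \<circ> \<psi>')) (at (\<phi> x))" by (rule diff_chain_at[OF \<psi>'])
  moreover have "((\<phi> \<circ> \<psi>) has_derivative id) (at (\<phi> x))"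
    by (rule has_derivative_transform_within_open[OF has_derivative_id V \<phi>x(1)]) (simp add: \<phi>\<psi>)
  ultimately have c2: "\<phi>' \<circ> \<psi>' = id" by (rule has_derivative_unique)
  have lin: "linear \<psi>'" using \<psi>' has_derivative_linear by blast
  have sub: "subspace P" unfolding P_def by (rule subspace_support)
  have eq: "tangent M x = \<psi>' ` P"
  proof (intro set_eqI iffI)
    fix \<eta> assume "\<eta> \<in> tangent M x"
    then obtain \<gamma> where \<gamma>: "\<gamma> 0 = x" "\<forall>\<^sub>F t in at 0. \<gamma> t \<in> M" "(\<gamma> has_vector_derivative \<eta>) (at 0)"
      unfolding tangent_def by blast
    have "((\<phi> \<circ> \<gamma>) has_derivative (\<phi>' \<circ> (\<lambda>t. t *\<^sub>R \<eta>))) (at 0)"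
      using \<gamma>(3) \<phi>' \<gamma>(1) unfolding has_vector_derivative_def by (intro diff_chain_at) auto
    moreover have "\<phi>' \<circ> (\<lambda>t. t *\<^sub>R \<eta>) = (\<lambda>t. t *\<^sub>R \<phi>' \<eta>)"
      using linear_scale[OF has_derivative_linear[OF \<phi>']] by auto
    ultimately have d: "((\<phi> \<circ> \<gamma>) has_vector_derivative \<phi>' \<eta>) (at 0)"
      by (simp add: has_vector_derivative_def)
    have "(\<gamma> \<longlongrightarrow> x) (at 0)"
      using has_vector_derivative_continuous[OF \<gamma>(3)] \<gamma>(1) by (simp add: continuous_at isCont_def)
    then have "\<forall>\<^sub>F t in at 0. \<gamma> t \<in> U" using U by (rule topological_tendstoD)
    with \<gamma>(2) have "\<forall>\<^sub>F t in at 0. (\<phi> \<circ> \<gamma>) t \<in> P"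
    proof eventually_elim
      case (elim t)
      then have "\<phi> (\<gamma> t) \<in> \<phi> ` (U \<inter> M)" by blast
      then show ?case unfolding im P_def by simp
    qed
    then have "\<phi>' \<eta> \<in> P"
      by (intro closed_vector_derivative_in_subspace[OF sub d]) (use \<gamma>(1) \<phi>x in auto)
    moreover have "\<eta> = \<psi>' (\<phi>' \<eta>)" using fun_cong[OF c1, of \<eta>] by simp
    ultimately show "\<eta> \<in> \<psi>' ` P" by blast
  next
    fix \<eta> assume "\<eta> \<in> \<psi>' ` P"
    then obtain \<xi> where \<xi>: "\<xi> \<in> P" "\<eta> = \<psi>' \<xi>" by blast
    define \<gamma> where "\<gamma> t = \<psi> (\<phi> x + t *\<^sub>R \<xi>)" for t :: real
    have "((\<lambda>t. \<phi> x + t *\<^sub>R \<xi>) has_derivative (\<lambda>t. t *\<^sub>R \<xi>)) (at 0)"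
      by (auto intro!: derivative_eq_intros)
    then have "((\<psi> \<circ> (\<lambda>t. \<phi> x + t *\<^sub>R \<xi>)) has_derivative (\<psi>' \<circ> (\<lambda>t. t *\<^sub>R \<xi>))) (at 0)"
      by (rule diff_chain_at) (use \<psi>' in auto)
    moreover have "\<psi>' \<circ> (\<lambda>t. t *\<^sub>R \<xi>) = (\<lambda>t. t *\<^sub>R \<eta>)"
      using linear_scale[OF lin] \<xi> by auto
    ultimately have "(\<gamma> has_vector_derivative \<eta>) (at 0)"
      by (simp add: has_vector_derivative_def \<gamma>_def[abs_def] o_def)
    moreover have "\<gamma> 0 = x" by (simp add: \<gamma>_def \<psi>\<phi> U)
    moreover have "\<forall>\<^sub>F t in at 0. \<gamma> t \<in> M"
    proof -
      have "((\<lambda>t. \<phi> x + t *\<^sub>R \<xi>) \<longlongrightarrow> \<phi> x + 0 *\<^sub>R \<xi>) (at 0)" by (intro tendsto_intros)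
      then have "\<forall>\<^sub>F t in at 0. \<phi> x + t *\<^sub>R \<xi> \<in> V"
        by (rule topological_tendstoD) (use V \<phi>x in auto)
      then show ?thesis
      proof eventually_elim
        case (elim t)
        then have "\<phi> x + t *\<^sub>R \<xi> \<in> \<phi> ` (U \<inter> M)"
          unfolding im using subspace_add[OF sub \<phi>x(2) subspace_scale[OF sub \<xi>(1)]] by (auto simp: P_def)
        then show ?case by (auto simp: \<gamma>_def \<psi>\<phi>)
      qed
    qed
    ultimately show "\<eta> \<in> tangent M x" unfolding tangent_def by blast
  qed
  show "subspace (tangent M x)" unfolding eq by (rule linear_subspace_image[OF lin sub])
  have "inj \<psi>'" using c2 by (metis inj_on_id inj_on_imageI2)
  then show "dim (tangent M x) = 2 * d"
    unfolding eq using dim_image_eq[OF lin, of P] dim_support[of I] I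
    by (auto simp: P_def inj_on_subset)
  show "cscale c \<eta> \<in> tangent M x" if "\<eta> \<in> tangent M x" for c \<eta>
    using that unfolding eq by (auto simp: clin[symmetric] P_def)
qed

section \<open>Triangular decomposition\<close>

lemma upper_diag_invertible:
  assumes "upper U" "\<And>i. U $ i $ i \<noteq> 0"
  shows "invertible U"
proof -
  have "det U = (\<Prod>i\<in>UNIV. U $ i $ i)" using assms(1) by (intro det_upperdiagonal) (auto simp: upper_def)
  then show ?thesis using assms(2) by (simp add: invertible_det_nz)
qed

lemma det_unilower:
  assumes "l \<in> strictly_lower"
  shows "det (mat 1 + l) = 1"
proof -
  have "det (mat 1 + l) = (\<Prod>i\<in>UNIV. (mat 1 + l) $ i $ i)"
    using assms by (intro det_lowerdiagonal) (auto simp: strictly_lower_def mat_def)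
  also have "\<dots> = 1" using assms by (auto simp: strictly_lower_def mat_def intro!: prod.neutral)
  finally show ?thesis .
qed

lemma unilower_invertible: "l \<in> strictly_lower \<Longrightarrow> invertible (mat 1 + l)"
  by (simp add: invertible_det_nz det_unilower)

lemma strictly_lower_unilower_mult:
  assumes "l \<in> strictly_lower" "k \<in> strictly_lower"
  shows "(mat 1 + l) ** k \<in> strictly_lower"
  unfolding strictly_lower_def mem_Collect_eq matrix_mult_nth
proof (intro allI impI sum.neutral ballI)
  fix i j z :: 'a assume "i \<le> j"
  then have "i < z \<or> z \<le> j" by auto
  then show "(mat 1 + l) $ i $ z * k $ z $ j = 0"
    using assms by (auto simp: strictly_lower_def mat_def)
qed

lemma matrix_inv_transpose:
  assumes "invertible (A :: 'n::finite cmat)"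
  shows "matrix_inv (transpose A) = transpose (matrix_inv A)"
  by (rule matrix_inv_unique)
    (simp add: matrix_inv_left[OF assms] flip: matrix_transpose_mul)

lemma lower_matrix_inv:
  fixes L :: "'n::{finite,wellorder} cmat"
  assumes "L \<in> strictly_lower" "i < j"
  shows "matrix_inv (mat 1 + L) $ i $ j = 0"
proof -
  define N where "N = matrix_inv (mat 1 + L)"
  have inv: "invertible (mat 1 + L)" by (rule unilower_invertible[OF assms(1)])
  have prod: "(mat 1 + L) ** N = mat 1" unfolding N_def by (rule matrix_inv_right[OF inv])
  have "\<forall>j>i. N $ i $ j = 0" for i
  proof (induction i rule: less_induct)
    case (less i)
    show ?case
    proof (intro allI impI)
      fix j assume ij: "i < j"
      have "0 = ((mat 1 + L) ** N) $ i $ j" unfolding prod using ij by (simp add: mat_def)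
      also have "\<dots> = (\<Sum>z\<in>UNIV. (mat 1 + L) $ i $ z * N $ z $ j)" by (rule matrix_mult_nth)
      also have "\<dots> = (\<Sum>z\<in>{i}. (mat 1 + L) $ i $ z * N $ z $ j)"
      proof (intro sum.mono_neutral_right ballI)
        fix z assume "z \<in> UNIV - {i}"
        then have "z < i \<or> i < z" by auto
        then show "(mat 1 + L) $ i $ z * N $ z $ j = 0"
        proof
          assume "z < i"
          then show ?thesis using less.IH[of z] ij by auto
        next
          assume "i < z"
          then show ?thesis using assms(1) by (auto simp: strictly_lower_def mat_def)
        qed
      qed auto
      also have "\<dots> = N $ i $ j" using assms(1) by (simp add: strictly_lower_def mat_def)
      finally show "N $ i $ j = 0" by simp
    qed
  qed
  then show ?thesis using assms(2) by (simp add: N_def)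
qed

text \<open>The quotient \<open>D\<close> is upper triangular by hypothesis and lower triangular
  like its factors, hence diagonal; the unit diagonals force it to be the identity.\<close>

lemma unilower_unique:
  fixes l l' :: "'n::{finite,wellorder} cmat"
  assumes l: "l \<in> strictly_lower" and l': "l' \<in> strictly_lower"
    and up: "upper (matrix_inv (mat 1 + l) ** (mat 1 + l'))"
  shows "l = l'"
proof -
  define D where "D = matrix_inv (mat 1 + l) ** (mat 1 + l')"
  have e: "mat 1 + l' = (mat 1 + l) ** D"
    unfolding D_def by (simp add: matrix_inv_cancel_right[OF unilower_invertible[OF l]])
  have D0: "D $ i $ j = 0" if "i \<noteq> j" for i j
  proof (cases "j < i")
    case True
    then show ?thesis using up by (simp add: upper_def D_def)
  next
    case False
    then have "i < j" using that by auto
    show ?thesis unfolding D_def matrix_mult_nth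
    proof (intro sum.neutral ballI)
      fix z
      have "i < z \<or> z < j" using \<open>i < j\<close> by auto
      then show "matrix_inv (mat 1 + l) $ i $ z * (mat 1 + l') $ z $ j = 0"
        using lower_matrix_inv[OF l] l' by (auto simp: strictly_lower_def mat_def)
    qed
  qed
  have nth: "((mat 1 + l) ** D) $ i $ j = (mat 1 + l) $ i $ j * D $ j $ j" for i j
    unfolding matrix_mult_nth by (rule mult_sum_nonzero_term) (simp add: D0)
  have "D $ j $ j = 1" for j
    using arg_cong[OF e, of "\<lambda>A. A $ j $ j"] l l' unfolding nth by (simp add: strictly_lower_def mat_def)
  then have "mat 1 + l' = mat 1 + l"
    unfolding vec_eq_iff e nth by simp
  then show ?thesis by simp
qed

lemma unilower_upper_unique:
  fixes l l' u u' :: "'n::{finite,wellorder} cmat"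
  assumes l: "l \<in> strictly_lower" and l': "l' \<in> strictly_lower"
    and u: "upper u" "invertible u" and u': "upper u'" "invertible u'"
    and eq: "(mat 1 + l) ** u = (mat 1 + l') ** u'"
  shows "l = l'" "u = u'"
proof -
  have "(mat 1 + l') = (mat 1 + l) ** (u ** matrix_inv u')"
    by (simp add: matrix_mul_assoc eq) (simp add: matrix_inv_right[OF u'(2)] flip: matrix_mul_assoc)
  then have "matrix_inv (mat 1 + l) ** (mat 1 + l') = u ** matrix_inv u'"
    by (simp add: matrix_inv_cancel_left[OF unilower_invertible[OF l]])
  then show "l = l'"
    using upper_mult[OF u(1) upper_matrix_inv[OF u']] by (intro unilower_unique[OF l l']) simp
  then show "u = u'"
    using eq matrix_inv_cancel_left[OF unilower_invertible[OF l']] by metis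
qed

text \<open>Reads a curve of matrices in a chart of the flag manifold: the strictly lower factor
  \<open>y\<close> of \<open>G t\<close> is its chart coordinate. After left translation the
  velocity is the class of \<open>G'\<close> modulo upper triangular matrices.\<close>

lemma lu_curve:
  fixes x :: "'n::{finite,wellorder} cmat" and G :: "real \<Rightarrow> 'n cmat"
  assumes x: "x \<in> strictly_lower" and G0: "G 0 = mat 1 + x"
    and G': "(G has_vector_derivative G') (at 0)"
  shows "\<exists>y. y 0 = x \<and> (\<forall>\<^sub>F t in at 0. y t \<in> strictly_lower \<and> (\<exists>U. upper U \<and> invertible U \<and> G t = (mat 1 + y t) ** U))
    \<and> (y has_vector_derivative (mat 1 + x) ** low (matrix_inv (mat 1 + x) ** G')) (at 0)"
proof -
  \<comment> \<open>Both factors are packed into one matrix \<open>z\<close>, so that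
    \<open>\<Phi>\<close> maps an open set of matrices to matrices of the same size and an inverse
    function theorem applies.\<close>
  define up :: "'n cmat \<Rightarrow> 'n cmat" where "up z = z - low z" for z
  define \<Phi> where "\<Phi> z = (mat 1 + low z) ** up z" for z :: "'n cmat"
  define S where "S = {z :: 'n cmat. \<forall>i. z $ i $ i \<noteq> 0}"
  define z0 where "z0 = x + mat 1"
  have upu: "upper (up z)" for z by (simp add: up_def upper_def)
  have upi: "invertible (up z)" if "z \<in> S" for z
    by (rule upper_diag_invertible[OF upu]) (use that in \<open>auto simp: S_def up_def\<close>)
  have bup: "bounded_linear up" unfolding up_def
    by (intro bounded_linear_sub bounded_linear_ident bounded_linear_low)
  have opS: "open S"
  proof -
    have "S = (\<Inter>i. {z. z $ i $ i \<noteq> 0})" by (auto simp: S_def)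
    moreover have "open {z :: 'n cmat. z $ i $ i \<noteq> 0}" for i
      by (intro open_Collect_neq continuous_intros)
    ultimately show ?thesis by auto
  qed
  have dPhi: "(\<Phi> has_derivative (\<lambda>h. (mat 1 + low z) ** up h + low h ** up z)) (at z)" for z
  proof -
    have "((\<lambda>z. mat 1 + low z) has_derivative (\<lambda>h. 0 + low h)) (at z)"
      by (intro has_derivative_add has_derivative_const bounded_linear_imp_has_derivative bounded_linear_low)
    from bounded_bilinear.FDERIV[OF bounded_bilinear_matrix_mult this bounded_linear_imp_has_derivative[OF bup]]
    show ?thesis unfolding \<Phi>_def by simp
  qed
  have contPhi: "continuous_on S \<Phi>"
    using dPhi by (meson continuous_at_imp_continuous_on has_derivative_continuous)
  have inj: "inj_on \<Phi> S"
  proof (rule inj_onI)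
    fix z z' assume z: "z \<in> S" "z' \<in> S" "\<Phi> z = \<Phi> z'"
    have "low z = low z'" "up z = up z'"
      using unilower_upper_unique[OF low_strictly_lower low_strictly_lower upu upi[OF z(1)] upu upi[OF z(2)]] z(3)
      by (auto simp: \<Phi>_def)
    then show "z = z'" unfolding up_def by simp
  qed
  have lowx: "low x = x" by (rule low_id[OF x])
  have low1: "low (mat 1) = (0 :: 'n cmat)" by (simp add: vec_eq_iff mat_def)
  have z0: "z0 \<in> S" "low z0 = x" "up z0 = mat 1" "\<Phi> z0 = G 0"
  proof -
    show "z0 \<in> S" using x by (auto simp: z0_def S_def mat_def strictly_lower_def)
    show l: "low z0 = x" by (simp add: z0_def low_add lowx low1)
    show u: "up z0 = mat 1" by (simp add: up_def l) (simp add: z0_def)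
    show "\<Phi> z0 = G 0" by (simp add: \<Phi>_def l u G0)
  qed
  define g where "g = inv_into S \<Phi>"
  have g\<Phi>: "g (\<Phi> z) = z" if "z \<in> S" for z using that inj by (simp add: g_def)
  define N where "N = matrix_inv (mat 1 + x)"
  \<comment> \<open>The inverse of the derivative of \<open>\<Phi>\<close> at \<open>z0\<close>: to
    solve \<open>(mat 1 + x) ** u + l = k\<close> with \<open>u\<close> upper and \<open>l\<close>
    strictly lower, multiply by \<open>N\<close> and split the result into its triangular
    parts.\<close>
  define g' where "g' k = (mat 1 + x) ** low (N ** k) + up (N ** k)" for k
  have dg: "(g has_derivative g') (at (\<Phi> z0))"
  proof (rule has_derivative_inverse_strong[OF opS z0(1) contPhi g\<Phi> dPhi])
    show "(\<lambda>h. (mat 1 + low z0) ** up h + low h ** up z0) \<circ> g' = id"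
    proof
      fix k
      have s: "low ((mat 1 + x) ** low (N ** k)) = (mat 1 + x) ** low (N ** k)"
        by (intro low_id strictly_lower_unilower_mult x low_strictly_lower)
      have lu: "low (up m) = 0" for m using upu[of m] by (simp add: upper_iff_low)
      have 1: "low (g' k) = (mat 1 + x) ** low (N ** k)" by (simp add: g'_def low_add s lu)
      have 2: "up (g' k) = up (N ** k)" unfolding up_def[of "g' k"] 1 by (simp add: g'_def)
      have "(mat 1 + x) ** up (N ** k) + (mat 1 + x) ** low (N ** k) = (mat 1 + x) ** (N ** k)"
        by (simp add: up_def matrix_diff_left)
      also have "\<dots> = k" unfolding N_def by (rule matrix_inv_cancel_right[OF unilower_invertible[OF x]])
      finally show "((\<lambda>h. (mat 1 + low z0) ** up h + low h ** up z0) \<circ> g') k = id k"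
        by (simp add: 1 2 z0)
    qed
  qed
  define y where "y t = low (g (G t))" for t
  have y0: "y 0 = x" by (simp add: y_def z0(4)[symmetric] g\<Phi>[OF z0(1)] z0(2))
  \<comment> \<open>Invariance of domain makes the image open, so every \<open>G t\<close> near
    \<open>G 0\<close> has a factorization.\<close>
  have "open (\<Phi> ` S)" by (rule invariance_of_domain[OF contPhi opS inj])
  moreover have "(G \<longlongrightarrow> G 0) (at 0)"
    using has_vector_derivative_continuous[OF G'] by (simp add: continuous_at)
  moreover have "G 0 \<in> \<Phi> ` S" using z0 by (metis imageI)
  ultimately have "\<forall>\<^sub>F t in at 0. G t \<in> \<Phi> ` S" using topological_tendstoD by blast
  then have ev: "\<forall>\<^sub>F t in at 0. y t \<in> strictly_lower \<and> (\<exists>U. upper U \<and> invertible U \<and> G t = (mat 1 + y t) ** U)"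
  proof eventually_elim
    case (elim t)
    then obtain z where z: "z \<in> S" "G t = \<Phi> z" by blast
    then have "y t = low z" by (simp add: y_def g\<Phi>)
    then show ?case
      using upu[of z] upi[OF z(1)] z(2) by (intro conjI exI[of _ "up z"]) (auto simp: \<Phi>_def)
  qed
  have "((g \<circ> G) has_derivative (g' \<circ> (\<lambda>t. t *\<^sub>R G'))) (at 0)"
    using G' dg unfolding has_vector_derivative_def by (intro diff_chain_at) (auto simp: z0)
  then have "((low \<circ> (g \<circ> G)) has_derivative (low \<circ> (g' \<circ> (\<lambda>t. t *\<^sub>R G')))) (at 0)"
    by (rule diff_chain_at) (rule bounded_linear_imp_has_derivative[OF bounded_linear_low])
  moreover have "low \<circ> (g' \<circ> (\<lambda>t. t *\<^sub>R G')) = (\<lambda>t. t *\<^sub>R ((mat 1 + x) ** low (N ** G')))"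
  proof
    fix t
    have s: "low ((mat 1 + x) ** low (N ** k)) = (mat 1 + x) ** low (N ** k)" for k
      by (intro low_id strictly_lower_unilower_mult x low_strictly_lower)
    have lu: "low (up m) = 0" for m using upu[of m] by (simp add: upper_iff_low)
    show "(low \<circ> (g' \<circ> (\<lambda>t. t *\<^sub>R G'))) t = t *\<^sub>R ((mat 1 + x) ** low (N ** G'))"
      by (simp add: g'_def low_add s lu low_scaleR linear_scale[OF bounded_linear.linear[OF bounded_linear_mult_left]])
  qed
  ultimately have "(y has_vector_derivative (mat 1 + x) ** low (N ** G')) (at 0)"
    by (simp add: has_vector_derivative_def y_def[abs_def] o_def)
  then show ?thesis using y0 ev unfolding N_def by blast
qed

section \<open>The Cayley transform\<close>

lemma matrix_add_left: "A ** (B + C) = A ** B + A ** (C :: 'n::finite cmat)"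
  by (simp add: vec_eq_iff matrix_mult_nth distrib_left sum.distrib)

lemma norm_mat_le:
  assumes "\<And>i j. cmod (A $ i $ j) \<le> 1"
  shows "norm (A :: 'n::finite cmat) \<le> real CARD('n) * real CARD('n)"
proof -
  have "norm (A $ i) \<le> real CARD('n)" for i
  proof -
    have "norm (A $ i) \<le> (\<Sum>j\<in>UNIV. cmod (A $ i $ j))"
      unfolding norm_vec_def by (rule L2_set_le_sum) auto
    also have "\<dots> \<le> (\<Sum>j\<in>(UNIV::'n set). 1)" by (rule sum_mono) (rule assms)
    finally show ?thesis by simp
  qed
  then have "(\<Sum>i\<in>UNIV. norm (A $ i)) \<le> (\<Sum>i\<in>(UNIV::'n set). real CARD('n))" by (rule sum_mono)
  moreover have "norm A \<le> (\<Sum>i\<in>UNIV. norm (A $ i))"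
    unfolding norm_vec_def[of A] by (rule L2_set_le_sum) auto
  ultimately show ?thesis by simp
qed

lemma real_mat_mult: "real_mat A \<Longrightarrow> real_mat B \<Longrightarrow> real_mat (A ** B)"
  by (simp add: real_mat_def matrix_mult_nth sum_in_Reals)

lemma real_mat_add: "real_mat A \<Longrightarrow> real_mat B \<Longrightarrow> real_mat (A + B)"
  by (simp add: real_mat_def)

lemma real_mat_diff: "real_mat A \<Longrightarrow> real_mat B \<Longrightarrow> real_mat (A - B)"
  by (simp add: real_mat_def)

lemma real_mat_transpose: "real_mat A \<Longrightarrow> real_mat (transpose A)"
  by (simp add: real_mat_def transpose_def)

lemma real_mat_1 [simp]: "real_mat (mat 1)"
  by (simp add: real_mat_def mat_def)

lemma real_mat_inv:
  fixes A :: "'n::finite cmat"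
  assumes "invertible A" "real_mat A"
  shows "real_mat (matrix_inv A)"
proof -
  define N where "N = map_matrix cnj (matrix_inv A)"
  have "A ** N = mat 1"
  proof -
    have "(A ** N) $ i $ j = cnj ((A ** matrix_inv A) $ i $ j)" for i j
      using assms(2) unfolding matrix_mult_nth N_def
      by (simp add: map_matrix_def real_mat_def Reals_cnj_iff)
    then show ?thesis unfolding matrix_inv_right[OF assms(1)] by (simp add: vec_eq_iff mat_def)
  qed
  then have "matrix_inv A = N" by (rule matrix_inv_unique)
  then have "cnj (matrix_inv A $ i $ j) = matrix_inv A $ i $ j" for i j
    by (simp add: N_def map_matrix_def vec_eq_iff)
  then show ?thesis by (simp add: real_mat_def Reals_cnj_iff)
qed

lemma SO_real_iff: "R \<in> SO_real \<longleftrightarrow> det R = 1 \<and> real_mat R \<and> transpose R ** R = mat 1"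
  by (auto simp: SO_real_def SL_real_def SL_complex_def real_mat_def)

lemma SO_real_mult: "R \<in> SO_real \<Longrightarrow> R' \<in> SO_real \<Longrightarrow> R ** R' \<in> SO_real"
proof -
  assume R: "R \<in> SO_real" and R': "R' \<in> SO_real"
  have "transpose (R ** R') ** (R ** R') = transpose R' ** (transpose R ** R) ** R'"
    by (simp add: matrix_transpose_mul matrix_mul_assoc)
  then show ?thesis using R R' by (auto simp: SO_real_iff det_mul real_mat_mult)
qed

lemma SO_real_transpose: "R \<in> SO_real \<Longrightarrow> transpose R \<in> SO_real"
  unfolding SO_real_iff by (auto simp: real_mat_transpose matrix_left_right_inverse)

lemma SO_real_right: "R \<in> SO_real \<Longrightarrow> R ** transpose R = mat 1"
  unfolding SO_real_iff by (auto simp: matrix_left_right_inverse)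

lemma SO_real_invertible: "R \<in> SO_real \<Longrightarrow> invertible R"
  unfolding SO_real_iff by (simp add: invertible_det_nz)

lemma so_real_subspace: "subspace (so_real :: 'n::finite cmat set)"
proof -
  have "transpose X = - X \<longleftrightarrow> transpose X + X = 0" for X :: "'n cmat"
    by (metis add.left_inverse add_eq_0_iff2)
  then have so: "so_real = {X :: 'n cmat. real_mat X \<and> transpose X + X = 0}"
    by (simp add: so_real_def)
  show ?thesis unfolding so
  proof (rule subspaceI)
    fix X Y :: "'n cmat"
    assume *: "X \<in> {X. real_mat X \<and> transpose X + X = 0}" "Y \<in> {X. real_mat X \<and> transpose X + X = 0}"
    have e: "transpose (X + Y) + (X + Y) = (transpose X + X) + (transpose Y + Y)"
      by (simp add: vec_eq_iff transpose_def)
    show "X + Y \<in> {X. real_mat X \<and> transpose X + X = 0}"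
      unfolding mem_Collect_eq e using * by (simp add: real_mat_add)
  next
    fix X :: "'n cmat" and c :: real
    assume *: "X \<in> {X. real_mat X \<and> transpose X + X = 0}"
    have "transpose (c *\<^sub>R X) + c *\<^sub>R X = c *\<^sub>R (transpose X + X)"
      by (simp add: vec_eq_iff transpose_def scaleR_add_right)
    moreover have "real_mat (c *\<^sub>R X)" using * by (simp add: real_mat_def complex_is_Real_iff)
    ultimately show "c *\<^sub>R X \<in> {X. real_mat X \<and> transpose X + X = 0}" using * by simp
  qed (simp add: real_mat_def vec_eq_iff transpose_def)
qed

lemma so_real_inner:
  assumes "X \<in> so_real"
  shows "(X *v v) \<bullet> v = 0"
proof -
  have "(X *v v) \<bullet> v = (\<Sum>i\<in>UNIV. \<Sum>j\<in>UNIV. (X $ i $ j * v $ j) \<bullet> v $ i)"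
    by (simp add: inner_vec_def matrix_vector_nth inner_sum_left)
  also have "\<dots> = (\<Sum>i\<in>UNIV. \<Sum>j\<in>UNIV. - ((X $ j $ i * v $ i) \<bullet> v $ j))"
  proof (intro sum.cong refl)
    fix i j
    have "X $ i $ j = of_real (Re (X $ i $ j))"
      using so_real_cnj[OF assms, of i j] by (metis Reals_cnj_iff of_real_Re)
    moreover have "X $ j $ i = - X $ i $ j" by (rule so_real_nth[OF assms])
    ultimately obtain r where "X $ i $ j = of_real r" "X $ j $ i = - of_real r" by metis
    then show "(X $ i $ j * v $ j) \<bullet> v $ i = - ((X $ j $ i * v $ i) \<bullet> v $ j)"
      by (simp add: inner_complex_def algebra_simps)
  qed
  also have "\<dots> = - (\<Sum>i\<in>UNIV. \<Sum>j\<in>UNIV. (X $ j $ i * v $ i) \<bullet> v $ j)"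
    by (simp add: sum_negf)
  also have "\<dots> = - ((X *v v) \<bullet> v)"
    by (subst sum.swap) (simp add: inner_vec_def matrix_vector_nth inner_sum_left)
  finally show ?thesis by simp
qed

lemma so_real_uminus: "X \<in> so_real \<Longrightarrow> - X \<in> so_real"
  using subspace_neg[OF so_real_subspace] by blast

text \<open>As \<open>X *v v\<close> is orthogonal to \<open>v\<close> in the real inner product,
  pairing the right-hand vector with \<open>v\<close> gives the square of \<open>norm v\<close>. The
  resulting bound for the inverse does not depend on \<open>X\<close>; the remainder estimates below
  rest on this uniformity.\<close>

lemma norm_minus_so_real:
  assumes "X \<in> so_real"
  shows "norm v \<le> norm ((mat 1 - X) *v v)"
proof (cases "v = 0")
  case False
  have e: "(mat 1 - X) *v v = v - X *v v"
    by (simp add: matrix_vector_mult_diff_rdistrib)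
  have "norm v * norm v = ((mat 1 - X) *v v) \<bullet> v"
    by (simp add: e inner_diff_left so_real_inner[OF assms] dot_square_norm power2_eq_square)
  also have "\<dots> \<le> norm ((mat 1 - X) *v v) * norm v" by (rule norm_cauchy_schwarz)
  finally show ?thesis using False by simp
qed simp

lemma so_real_minus_invertible:
  assumes "X \<in> so_real"
  shows "invertible (mat 1 - X)"
  unfolding invertible_left_inverse matrix_left_invertible_ker
proof (intro allI impI)
  fix v assume "(mat 1 - X) *v v = 0"
  then show "v = 0" using norm_minus_so_real[OF assms, of v] by simp
qed

lemma so_real_plus_invertible:
  assumes "X \<in> so_real"
  shows "invertible (mat 1 + X)"
  using so_real_minus_invertible[OF so_real_uminus[OF assms]] by simp

definition resolvent :: "'n::finite cmat \<Rightarrow> 'n cmat" where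
  "resolvent X = matrix_inv (mat 1 - X)"

text \<open>A rational substitute for the exponential map from so(n, R) to SO(n, R). Its first order
  term is \<open>2 *\<^sub>R X\<close>, which explains the parameter \<open>t / 2\<close> in curves
  of velocity \<open>X\<close>.\<close>

definition cayley :: "'n::finite cmat \<Rightarrow> 'n cmat" where
  "cayley X = resolvent X ** (mat 1 + X)"

lemma norm_resolvent:
  assumes "X \<in> so_real"
  shows "norm (resolvent X :: 'n::finite cmat) \<le> real CARD('n) * real CARD('n)"
proof (rule norm_mat_le)
  fix i j
  have "cmod (resolvent X $ i $ j) = cmod ((resolvent X *v axis j 1) $ i)"
    by simp
  also have "\<dots> \<le> norm (resolvent X *v axis j 1)" by (rule Finite_Cartesian_Product.norm_nth_le)
  also have "\<dots> \<le> norm ((mat 1 - X) *v (resolvent X *v axis j 1))"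
    by (rule norm_minus_so_real[OF assms])
  also have "\<dots> = norm (axis j (1::complex))"
    by (simp add: resolvent_def matrix_vector_mul_assoc matrix_inv_right so_real_minus_invertible[OF assms])
  also have "\<dots> = 1"
    by (rule norm_Basis) (auto simp: Basis_vec_def Basis_complex_def)
  finally show "cmod (resolvent X $ i $ j) \<le> 1" .
qed

lemma cayley_expand:
  assumes "X \<in> so_real"
  shows "cayley X = mat 1 + 2 *\<^sub>R X + 2 *\<^sub>R (X ** X ** resolvent X)"
proof -
  define M where "M = resolvent X"
  have 1: "(mat 1 - X) ** M = mat 1" and 2: "M ** (mat 1 - X) = mat 1"
    unfolding M_def resolvent_def
    by (simp_all add: matrix_inv_right matrix_inv_left so_real_minus_invertible[OF assms])
  have M1: "M = mat 1 + X ** M" using 1 by (simp add: matrix_diff_right algebra_simps)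
  have "M - X ** M = M - M ** X" using 1 2 by (simp add: matrix_diff_left matrix_diff_right)
  then have M2: "M ** X = X ** M" by simp
  have "cayley X = M + X ** M" unfolding cayley_def M_def[symmetric] by (simp add: matrix_add_left M2)
  also have "\<dots> = mat 1 + 2 *\<^sub>R (X ** M)" by (subst M1) (simp add: scaleR_2)
  also have "X ** M = X + X ** X ** M" by (subst M1) (simp add: matrix_add_left matrix_mul_assoc)
  finally show ?thesis by (simp add: M_def scaleR_add_right add.assoc)
qed

text \<open>Transposition exchanges the commuting matrices \<open>mat 1 - X\<close> and
  \<open>mat 1 + X\<close>. Hence they have the same determinant, and the transpose of their
  quotient is its inverse.\<close>

lemma cayley_SO:
  assumes X: "X \<in> so_real"
  shows "cayley X \<in> SO_real"
proof -
  define M where "M = mat 1 - X"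
  define P where "P = mat 1 + X"
  have iM: "invertible M" and iP: "invertible P"
    using so_real_minus_invertible[OF X] so_real_plus_invertible[OF X] by (auto simp: M_def P_def)
  have tX: "transpose X = - X" using X by (simp add: so_real_def)
  have "transpose M = mat 1 - transpose X" "transpose P = mat 1 + transpose X"
    by (auto simp: M_def P_def vec_eq_iff transpose_def mat_def)
  then have tM: "transpose M = P" and tP: "transpose P = M"
    unfolding tX by (simp_all add: M_def P_def)
  have MP: "M ** P = P ** M"
    by (simp add: M_def P_def matrix_diff_left matrix_diff_right matrix_add_left matrix_add_right)
  have C: "cayley X = matrix_inv M ** P" by (simp add: cayley_def resolvent_def M_def P_def)
  have "det M * det (matrix_inv M) = 1"
    using arg_cong[OF matrix_inv_right[OF iM], of det] by (simp add: det_mul)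
  moreover have "det P = det M" using tM det_transpose[of M] by simp
  ultimately have "det (cayley X) = 1" by (simp add: C det_mul mult.commute)
  moreover have "real_mat (cayley X)"
  proof -
    have "real_mat X" using X by (simp add: so_real_def)
    then show ?thesis unfolding C
      by (intro real_mat_mult real_mat_inv iM) (auto simp: M_def P_def intro: real_mat_add real_mat_diff)
  qed
  moreover have "transpose (cayley X) ** cayley X = mat 1"
  proof -
    have "transpose (cayley X) = M ** matrix_inv P"
      by (simp add: C matrix_transpose_mul tP flip: matrix_inv_transpose[OF iM]) (simp add: tM)
    then have "transpose (cayley X) ** cayley X = M ** (matrix_inv P ** matrix_inv M) ** P"
      by (simp add: C matrix_mul_assoc)
    also have "matrix_inv P ** matrix_inv M = matrix_inv M ** matrix_inv P"
      using matrix_inv_mult[OF iM iP] matrix_inv_mult[OF iP iM] MP by simp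
    also have "M ** (matrix_inv M ** matrix_inv P) ** P = mat 1"
      by (simp add: matrix_inv_cancel_right[OF iM] matrix_inv_left[OF iP])
    finally show ?thesis .
  qed
  ultimately show ?thesis by (simp add: SO_real_iff)
qed

lemma upper_sandwich_1:
  assumes "invertible A" "stab (fl A) X"
  shows "upper (matrix_inv A ** ((mat 1 + X) ** A))"
proof -
  have "matrix_inv A ** ((mat 1 + X) ** A) = mat 1 + matrix_inv A ** X ** A"
    by (simp add: matrix_add_right matrix_add_left matrix_inv_left[OF assms(1)] matrix_mul_assoc)
  then show ?thesis using assms stab_fl[OF assms(1)] by (simp add: upper_add)
qed

lemma stab_uminus: "stab (fl A) X \<Longrightarrow> stab (fl A) (- X)"
  unfolding stab_def
proof (intro allI ballI)
  fix i v assume *: "\<forall>i. \<forall>v\<in>fl A i. X *v v \<in> fl A i" "v \<in> fl A i"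
  have "(- X) *v v = - (X *v v)"
    by (simp add: vec_eq_iff matrix_vector_nth sum_negf)
  then show "(- X) *v v \<in> fl A i" using * by (simp add: vec.subspace_neg)
qed

text \<open>If \<open>X\<close> stabilizes the flag, the invertible matrices
  \<open>mat 1 + X\<close> and \<open>mat 1 - X\<close> fix it, and so does their quotient: Cayley
  curves of the isotropy algebra stay in the isotropy group.\<close>

lemma cayley_fixes:
  assumes A: "invertible A" and X: "X \<in> so_real" and st: "stab (fl A) X"
  shows "flag_act (cayley X) (fl A) = fl A"
proof -
  have P: "flag_act (mat 1 + X) (fl A) = fl A" if "X \<in> so_real" "stab (fl A) X" for X
    unfolding flag_act_fl
    using fl_eq_iff[OF A invertible_mult[OF so_real_plus_invertible[OF that(1)] A]]
      upper_sandwich_1[OF A that(2)] by auto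
  have "flag_act (mat 1 - X) (fl A) = fl A"
    using P[OF so_real_uminus[OF X] stab_uminus[OF st]] by simp
  then have "flag_act (resolvent X) (fl A) = flag_act (resolvent X) (flag_act (mat 1 - X) (fl A))"
    by simp
  also have "\<dots> = fl A"
    by (simp add: flag_act_mult resolvent_def matrix_inv_left so_real_minus_invertible[OF X])
  finally show ?thesis using P[OF X st] by (simp add: cayley_def flip: flag_act_mult)
qed

lemma bound_quadratic:
  fixes X :: "'n::finite cmat"
  assumes "X \<in> so_real"
  shows "\<exists>B. \<forall>s. norm (X ** X ** resolvent (s *\<^sub>R X)) \<le> B"
proof -
  obtain K where K: "\<And>a b. norm ((a :: 'n cmat) ** (b :: 'n cmat)) \<le> norm a * norm b * K" "K > 0"
    using bounded_bilinear.pos_bounded[OF bounded_bilinear_matrix_mult] by metis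
  show ?thesis
  proof (intro exI allI)
    fix s
    have "norm (X ** X ** resolvent (s *\<^sub>R X)) \<le> norm (X ** X) * norm (resolvent (s *\<^sub>R X)) * K" by (rule K)
    also have "\<dots> \<le> norm (X ** X) * (real CARD('n) * real CARD('n)) * K"
      using norm_resolvent[OF subspace_scale[OF so_real_subspace assms], of s] K(2)
      by (intro mult_right_mono mult_left_mono) auto
    finally show "norm (X ** X ** resolvent (s *\<^sub>R X)) \<le> norm (X ** X) * (real CARD('n) * real CARD('n)) * K" .
  qed
qed

lemma matrix_scaleR_left: "(c *\<^sub>R A :: 'n::finite cmat) ** B = c *\<^sub>R (A ** (B :: 'n cmat))"
  using bounded_bilinear.scaleR_left[OF bounded_bilinear_matrix_mult] .

lemma matrix_scaleR_right: "(A :: 'n::finite cmat) ** (c *\<^sub>R B) = c *\<^sub>R (A ** (B :: 'n cmat))"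
  using bounded_bilinear.scaleR_right[OF bounded_bilinear_matrix_mult] .

lemma cayley_expand_scaled:
  assumes "X \<in> so_real"
  shows "cayley (s *\<^sub>R X) = mat 1 + (2 * s) *\<^sub>R X + (2 * s\<^sup>2) *\<^sub>R (X ** X ** resolvent (s *\<^sub>R X))"
  using cayley_expand[OF subspace_scale[OF so_real_subspace assms], of s]
  by (simp add: matrix_scaleR_left matrix_scaleR_right power2_eq_square mult_ac)

lemma cayley_derivative:
  assumes X: "X \<in> so_real"
  shows "((\<lambda>t. cayley ((t / 2) *\<^sub>R X)) has_vector_derivative X) (at 0)"
proof -
  obtain B where B: "\<And>s. norm (X ** X ** resolvent (s *\<^sub>R X)) \<le> B" using bound_quadratic[OF X] by blast
  have e: "cayley ((t / 2) *\<^sub>R X) = mat 1 + t *\<^sub>R X + (t\<^sup>2 / 2) *\<^sub>R (X ** X ** resolvent ((t / 2) *\<^sub>R X))" for t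
    using cayley_expand_scaled[OF X, of "t / 2"] by (simp add: power_divide)
  have "((\<lambda>h. norm (cayley (((0 + h) / 2) *\<^sub>R X) - cayley ((0 / 2) *\<^sub>R X) - h *\<^sub>R X) / norm h) \<longlongrightarrow> 0) (at 0)"
  proof (rule Lim_null_comparison)
    show "\<forall>\<^sub>F h in at 0. norm (norm (cayley (((0 + h) / 2) *\<^sub>R X) - cayley ((0 / 2) *\<^sub>R X) - h *\<^sub>R X) / norm h) \<le> \<bar>h\<bar> / 2 * B"
    proof (rule eventually_at_filter[THEN iffD2], rule always_eventually, intro allI impI)
      fix h :: real assume "h \<noteq> 0"
      have "norm (cayley (((0 + h) / 2) *\<^sub>R X) - cayley ((0 / 2) *\<^sub>R X) - h *\<^sub>R X)
          = h\<^sup>2 / 2 * norm (X ** X ** resolvent ((h / 2) *\<^sub>R X))"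
        using e[of h] e[of 0] by simp
      also have "\<dots> \<le> h\<^sup>2 / 2 * B" by (intro mult_left_mono B) auto
      finally show "norm (norm (cayley (((0 + h) / 2) *\<^sub>R X) - cayley ((0 / 2) *\<^sub>R X) - h *\<^sub>R X) / norm h) \<le> \<bar>h\<bar> / 2 * B"
        using \<open>h \<noteq> 0\<close> by (simp add: divide_le_eq power2_eq_square abs_mult_self_eq mult.commute mult.left_commute)
    qed
    show "((\<lambda>h. \<bar>h\<bar> / 2 * B) \<longlongrightarrow> 0) (at 0)"
      by (auto intro!: tendsto_eq_intros)
  qed
  then show ?thesis
    unfolding has_vector_derivative_def has_derivative_at
    by (auto intro: bounded_linear_scaleR_left)
qed

lemma quadratic_first_order_zero:
  fixes a :: real
  assumes "\<And>s. s * a \<le> s\<^sup>2 * b"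
  shows "a = 0"
proof (rule ccontr)
  assume "a \<noteq> 0"
  \<comment> \<open>At \<open>s = a / c\<close> with \<open>c > \<bar>b\<bar>\<close> the linear
    side beats the quadratic one.\<close>
  define c where "c = \<bar>b\<bar> + 1"
  have "a / c * a \<le> (a / c)\<^sup>2 * b" by (rule assms)
  also have "\<dots> \<le> (a / c)\<^sup>2 * \<bar>b\<bar>" by (intro mult_left_mono) auto
  also have "\<dots> < (a / c)\<^sup>2 * c" using \<open>a \<noteq> 0\<close> by (intro mult_strict_left_mono) (auto simp: c_def)
  also have "\<dots> = a / c * a" by (simp add: power2_eq_square c_def)
  finally show False by simp
qed

section \<open>The tangent space of an orbit of the compact group\<close>

text \<open>The tangent vector at \<open>fl A\<close> generated by \<open>X\<close>, written as a
  class modulo upper triangular matrices in the frame \<open>A\<close>.\<close>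

definition tau :: "'n cmat \<Rightarrow> 'n::{finite,wellorder} cmat \<Rightarrow> 'n cmat" where
  "tau A X = low (matrix_inv A ** X ** A)"

lemma tau_eq_0_iff: "invertible A \<Longrightarrow> tau A X = 0 \<longleftrightarrow> stab (fl A) X"
  by (simp add: tau_def stab_fl upper_iff_low)

lemma linear_tau: "linear (tau A)"
  unfolding tau_def
  by (intro linearI)
    (simp_all add: low_add low_scaleR matrix_add_left matrix_add_right matrix_scaleR_left matrix_scaleR_right)

lemma tau_cscale: "tau A (cscale c X) = cscale c (tau A X)"
  by (simp add: tau_def cscale_mult_left cscale_mult_right) (simp add: vec_eq_iff)

section \<open>Elements of SO(n, R) of maximal trace\<close>

lemma compact_SO_real: "compact (SO_real :: 'n::{finite,wellorder} cmat set)"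
proof -
  have e: "(SO_real :: 'n cmat set) = {R. det R = 1} \<inter> (\<Inter>i. \<Inter>j. {R. Im (R $ i $ j) = 0}) \<inter> {R. transpose R ** R = mat 1}"
    by (auto simp: SO_real_iff real_mat_def complex_is_Real_iff)
  have "closed {R :: 'n cmat. det R = 1}"
    unfolding det_def by (intro closed_Collect_eq continuous_intros)
  moreover have "closed {R :: 'n cmat. Im (R $ i $ j) = 0}" for i j
    by (intro closed_Collect_eq continuous_intros)
  moreover have "closed {R :: 'n cmat. transpose R ** R = mat 1}"
    unfolding transpose_def matrix_matrix_mult_def
    by (intro closed_Collect_eq continuous_intros)
  ultimately have "closed (SO_real :: 'n cmat set)" unfolding e by (intro closed_Int closed_INT) auto
  moreover have "bounded (SO_real :: 'n cmat set)"
  proof (rule boundedI)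
    fix R :: "'n cmat" assume R: "R \<in> SO_real"
    show "norm R \<le> real CARD('n) * real CARD('n)"
    proof (rule norm_mat_le)
      fix i j
      have sq: "R $ k $ j * R $ k $ j = of_real ((cmod (R $ k $ j))\<^sup>2)" for k
      proof -
        have "cnj (R $ k $ j) = R $ k $ j" using R by (simp add: SO_real_iff real_mat_def Reals_cnj_iff)
        then show ?thesis unfolding complex_norm_square by simp
      qed
      have "(transpose R ** R) $ j $ j = 1" using R by (simp add: SO_real_iff mat_def)
      then have "(\<Sum>k\<in>UNIV. complex_of_real ((cmod (R $ k $ j))\<^sup>2)) = 1"
        by (simp add: matrix_mult_nth transpose_def sq)
      then have "(\<Sum>k\<in>UNIV. (cmod (R $ k $ j))\<^sup>2) = 1"
        by (metis of_real_eq_1_iff of_real_sum)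
      moreover have "(cmod (R $ i $ j))\<^sup>2 \<le> (\<Sum>k\<in>UNIV. (cmod (R $ k $ j))\<^sup>2)"
        by (rule member_le_sum) auto
      ultimately show "cmod (R $ i $ j) \<le> 1" by (simp add: abs_square_le_1)
    qed
  qed
  ultimately show ?thesis by (simp add: compact_eq_bounded_closed)
qed

text \<open>The inner product with the identity serves as the trace from here on; on SO(n, R) it
  measures closeness to the identity.\<close>

lemma inner_mat_1: "A \<bullet> (mat 1 :: 'n::finite cmat) = (\<Sum>i\<in>UNIV. Re (A $ i $ i))"
  by (simp add: inner_vec_def mat_def if_distrib if_distrib[of "\<lambda>x. _ \<bullet> x"] inner_complex_def cong: if_cong)

text \<open>Columns have norm 1, so no diagonal entry exceeds 1. The trace bound forces all of them
  to be 1 and leaves nothing for the other entries.\<close>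

lemma SO_real_trace:
  fixes R :: "'n::{finite,wellorder} cmat"
  assumes R: "R \<in> SO_real" and tr: "R \<bullet> mat 1 \<ge> real CARD('n)"
  shows "R = mat 1"
proof -
  have RR: "transpose R ** R = mat 1" "real_mat R" using R by (auto simp: SO_real_iff)
  have re: "R $ i $ j = of_real (Re (R $ i $ j))" for i j
    using RR(2) by (simp add: real_mat_def complex_is_Real_iff complex_eq_iff)
  have one: "(\<Sum>k\<in>UNIV. (Re (R $ k $ j))\<^sup>2) = 1" for j
  proof -
    have "(transpose R ** R) $ j $ j = 1" using RR by (simp add: mat_def)
    then have "(\<Sum>k\<in>UNIV. R $ k $ j * R $ k $ j) = 1" by (simp add: matrix_mult_nth transpose_def)
    then have "(\<Sum>k\<in>UNIV. complex_of_real ((Re (R $ k $ j))\<^sup>2)) = 1"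
      by (subst (asm) (1 2) re) (simp add: power2_eq_square)
    then show ?thesis by (metis of_real_eq_1_iff of_real_sum)
  qed
  have le: "Re (R $ j $ j) \<le> 1" for j
  proof -
    have "(Re (R $ j $ j))\<^sup>2 \<le> (\<Sum>k\<in>UNIV. (Re (R $ k $ j))\<^sup>2)" by (rule member_le_sum) auto
    then show ?thesis unfolding one by (simp add: abs_square_le_1 abs_le_iff)
  qed
  have diag: "Re (R $ j $ j) = 1" for j
  proof (rule ccontr)
    assume "Re (R $ j $ j) \<noteq> 1"
    then have "Re (R $ j $ j) < 1" using le[of j] by simp
    then have "(\<Sum>i\<in>UNIV. Re (R $ i $ i)) < (\<Sum>i\<in>(UNIV::'n set). 1)"
      using le by (intro sum_strict_mono_ex1) auto
    then show False using tr by (simp add: inner_mat_1)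
  qed
  have off: "Re (R $ i $ j) = 0" if "i \<noteq> j" for i j
  proof -
    have "(\<Sum>k\<in>UNIV. (Re (R $ k $ j))\<^sup>2) = (Re (R $ j $ j))\<^sup>2 + (\<Sum>k\<in>UNIV - {j}. (Re (R $ k $ j))\<^sup>2)"
      by (rule sum.remove) auto
    then have "(\<Sum>k\<in>UNIV - {j}. (Re (R $ k $ j))\<^sup>2) = 0" using one[of j] diag[of j] by simp
    then have "\<forall>k\<in>UNIV - {j}. (Re (R $ k $ j))\<^sup>2 = 0" by (subst (asm) sum_nonneg_eq_0_iff) auto
    then show ?thesis using that by auto
  qed
  show ?thesis unfolding vec_eq_iff
  proof (intro allI)
    fix i j show "R $ i $ j = mat 1 $ i $ j"
      using diag[of j] off[of i j] by (subst re) (simp add: mat_def)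
  qed
qed

lemma inner_transpose: "transpose A \<bullet> (B :: 'n::finite cmat) = A \<bullet> transpose B"
  unfolding inner_vec_def transpose_def by (subst sum.swap) simp

lemma inner_mult_1:
  assumes "real_mat A" "real_mat B"
  shows "(A ** B) \<bullet> mat 1 = transpose A \<bullet> (B :: 'n::finite cmat)"
proof -
  have r: "Im (A $ i $ j) = 0" "Im (B $ i $ j) = 0" for i j
    using assms by (auto simp: real_mat_def complex_is_Real_iff)
  have "(A ** B) \<bullet> mat 1 = (\<Sum>i\<in>UNIV. \<Sum>k\<in>UNIV. Re (A $ i $ k) * Re (B $ k $ i))"
    by (simp add: inner_mat_1 matrix_mult_nth r)
  also have "\<dots> = transpose A \<bullet> B"
    unfolding inner_vec_def transpose_def by (subst sum.swap) (simp add: inner_complex_def r)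
  finally show ?thesis .
qed

text \<open>First variation: along \<open>R ** cayley (s *\<^sub>R S)\<close> the trace has linear
  coefficient \<open>2 * (transpose R \<bullet> S)\<close>, which must vanish at a maximum. The
  remainder is quadratic in \<open>s\<close> with a uniform constant because the resolvent is
  bounded.\<close>

lemma maximal_trace_orthogonal:
  assumes R: "R \<in> SO_real" and S: "S \<in> so_real"
    and max: "\<And>s. (R ** cayley (s *\<^sub>R S)) \<bullet> mat 1 \<le> R \<bullet> mat 1"
  shows "R \<bullet> S = 0"
proof -
  obtain B where B: "\<And>s. norm (S ** S ** resolvent (s *\<^sub>R S)) \<le> B" using bound_quadratic[OF S] by blast
  have rR: "real_mat R" using R by (simp add: SO_real_iff)
  have "2 * (transpose R \<bullet> S) = 0"
  proof (rule quadratic_first_order_zero)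
    fix s
    have sS: "s *\<^sub>R S \<in> so_real" by (rule subspace_scale[OF so_real_subspace S])
    have "(R ** cayley (s *\<^sub>R S)) \<bullet> mat 1 = transpose R \<bullet> cayley (s *\<^sub>R S)"
      using cayley_SO[OF sS] by (intro inner_mult_1 rR) (simp add: SO_real_iff)
    also have "\<dots> = transpose R \<bullet> mat 1 + 2 * s * (transpose R \<bullet> S)
        + 2 * s\<^sup>2 * (transpose R \<bullet> (S ** S ** resolvent (s *\<^sub>R S)))"
      by (simp add: cayley_expand_scaled[OF S] inner_add_right)
    also have "transpose R \<bullet> mat 1 = R \<bullet> mat 1" by (simp add: inner_transpose transpose_mat)
    finally have "2 * s * (transpose R \<bullet> S) + 2 * s\<^sup>2 * (transpose R \<bullet> (S ** S ** resolvent (s *\<^sub>R S))) \<le> 0"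
      using max[of s] by simp
    moreover have "- (norm (transpose R) * B) \<le> transpose R \<bullet> (S ** S ** resolvent (s *\<^sub>R S))"
    proof -
      have "\<bar>transpose R \<bullet> (S ** S ** resolvent (s *\<^sub>R S))\<bar> \<le> norm (transpose R) * norm (S ** S ** resolvent (s *\<^sub>R S))"
        by (rule Cauchy_Schwarz_ineq2)
      also have "\<dots> \<le> norm (transpose R) * B" by (intro mult_left_mono B) auto
      finally show ?thesis by linarith
    qed
    then have "2 * s\<^sup>2 * - (norm (transpose R) * B) \<le> 2 * s\<^sup>2 * (transpose R \<bullet> (S ** S ** resolvent (s *\<^sub>R S)))"
      by (intro mult_left_mono) auto
    ultimately show "s * (2 * (transpose R \<bullet> S)) \<le> s\<^sup>2 * (2 * (norm (transpose R) * B))" by (simp add: algebra_simps)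
  qed
  moreover have "transpose R \<bullet> S = - (R \<bullet> S)" using S by (simp add: inner_transpose so_real_def)
  ultimately show ?thesis by simp
qed

text \<open>The easy inclusion: the point moves along a Cayley curve of velocity \<open>X\<close>,
  and \<open>lu_curve\<close> reads the motion in the chart.\<close>

lemma orbit_tangent_sup:
  fixes C :: "'n::{finite,wellorder} flag set"
  assumes inv: "\<And>R q. R \<in> SO_real \<Longrightarrow> q \<in> C \<Longrightarrow> flag_act R q \<in> C"
    and g: "g \<in> SL_complex" and x: "x \<in> strictly_lower" and xC: "flag_chart g x \<in> C"
    and X: "X \<in> so_real"
  shows "(mat 1 + x) ** tau (g ** (mat 1 + x)) X \<in> tangent {y \<in> strictly_lower. flag_chart g y \<in> C} x"
proof -
  define A where "A = g ** (mat 1 + x)"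
  have ig: "invertible g" using g by (rule SL_complex_invertible)
  have ix: "invertible (mat 1 + x)" by (rule unilower_invertible[OF x])
  define R where "R t = cayley ((t / 2) *\<^sub>R X)" for t :: real
  define G where "G t = matrix_inv g ** (R t ** A)" for t
  have R0: "R 0 = mat 1" using cayley_expand_scaled[OF X, of 0] by (simp add: R_def)
  have G0: "G 0 = mat 1 + x"
    by (simp add: G_def R0 A_def matrix_inv_cancel_left[OF ig])
  have "(R has_vector_derivative X) (at 0)"
    unfolding R_def[abs_def] by (rule cayley_derivative[OF X])
  moreover have "bounded_linear (\<lambda>Z. matrix_inv g ** (Z ** A))"
    using bounded_linear_compose[OF bounded_linear_mult_left bounded_linear_mult_right] by blast
  ultimately have "(G has_vector_derivative matrix_inv g ** (X ** A)) (at 0)"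
    unfolding G_def[abs_def] by (rule bounded_linear.has_vector_derivative[rotated])
  from lu_curve[OF x G0 this] obtain y where y: "y 0 = x"
    and ev: "\<forall>\<^sub>F t in at 0. y t \<in> strictly_lower \<and> (\<exists>U. upper U \<and> invertible U \<and> G t = (mat 1 + y t) ** U)"
    and dy: "(y has_vector_derivative (mat 1 + x) ** low (matrix_inv (mat 1 + x) ** (matrix_inv g ** (X ** A)))) (at 0)"
    by blast
  have "\<forall>\<^sub>F t in at 0. y t \<in> {y \<in> strictly_lower. flag_chart g y \<in> C}"
    using ev
  proof eventually_elim
    case (elim t)
    then obtain U where U: "upper U" "invertible U" "G t = (mat 1 + y t) ** U" by blast
    have iy: "invertible (g ** (mat 1 + y t))"
      using elim ig by (simp add: invertible_mult unilower_invertible)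
    have "flag_chart g (y t) = fl (g ** (mat 1 + y t))" by (simp add: flag_chart_def fl_def)
    also have "\<dots> = fl (g ** (mat 1 + y t) ** U)" by (rule fl_mult_upper[OF iy U(2,1), symmetric])
    also have "g ** (mat 1 + y t) ** U = g ** G t" by (simp add: U matrix_mul_assoc)
    also have "\<dots> = R t ** A" unfolding G_def by (rule matrix_inv_cancel_right[OF ig])
    also have "fl (R t ** A) = flag_act (R t) (flag_chart g x)"
      by (simp add: flag_chart_def A_def fl_def flag_act_mult)
    also have "\<dots> \<in> C"
      unfolding R_def by (intro inv xC cayley_SO subspace_scale[OF so_real_subspace X])
    finally show ?case using elim by simp
  qed
  moreover have "matrix_inv (mat 1 + x) ** (matrix_inv g ** (X ** A)) = matrix_inv A ** X ** A"
    by (simp add: A_def matrix_inv_mult ig ix matrix_mul_assoc)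
  ultimately show ?thesis using y dy unfolding tangent_def tau_def A_def by auto
qed

text \<open>Bringing \<open>R\<close> to the other side yields a condition linear in
  \<open>transpose R\<close>: its solutions form a closed set, and it can be expanded to first
  order.\<close>

lemma fl_eq_iff_SO:
  assumes "R \<in> SO_real" "invertible A" "invertible B"
  shows "fl (R ** A) = fl B \<longleftrightarrow> low (matrix_inv A ** (transpose R ** B)) = 0"
proof -
  have tR: "invertible (transpose R)" using SO_real_transpose[OF assms(1)] SO_real_invertible by blast
  have "fl (R ** A) = fl B \<longleftrightarrow> fl A = fl (transpose R ** B)"
  proof
    assume "fl (R ** A) = fl B"
    then have "flag_act (transpose R) (fl (R ** A)) = flag_act (transpose R) (fl B)" by simp
    then show "fl A = fl (transpose R ** B)"
      using assms(1) by (simp add: flag_act_fl matrix_mul_assoc SO_real_iff)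
  next
    assume "fl A = fl (transpose R ** B)"
    then have "flag_act R (fl A) = flag_act R (fl (transpose R ** B))" by simp
    then show "fl (R ** A) = fl B"
      using SO_real_right[OF assms(1)] by (simp add: flag_act_fl matrix_mul_assoc)
  qed
  then show ?thesis
    using fl_eq_iff[OF assms(2) invertible_mult[OF tR assms(3)]] by (simp add: upper_iff_low)
qed

lemma bounded_linear_transpose: "bounded_linear (transpose :: 'n::finite cmat \<Rightarrow> 'n cmat)"
  unfolding linear_conv_bounded_linear[symmetric]
  by (intro linearI) (simp_all add: vec_eq_iff transpose_def)

text \<open>Maximal trace selects, among all rotations with the same effect on the flag, one closest
  to the identity; it exists because they form a compact set.\<close>

lemma exists_max_trace:
  fixes A B :: "'n::{finite,wellorder} cmat"
  assumes "invertible A" "invertible B" "R0 \<in> SO_real" "fl (R0 ** A) = fl B"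
  shows "\<exists>R\<in>SO_real. fl (R ** A) = fl B \<and> (\<forall>R'\<in>SO_real. fl (R' ** A) = fl B \<longrightarrow> R' \<bullet> mat 1 \<le> R \<bullet> mat 1)"
proof -
  define K where "K = SO_real \<inter> {R. low (matrix_inv A ** (transpose R ** B)) = 0}"
  have K: "K = {R \<in> SO_real. fl (R ** A) = fl B}"
    using fl_eq_iff_SO[OF _ assms(1,2)] by (auto simp: K_def)
  have "closed {R. low (matrix_inv A ** (transpose R ** B)) = 0}"
    by (intro closed_Collect_eq bounded_linear.continuous_on[OF bounded_linear_low]
        bounded_bilinear.continuous_on[OF bounded_bilinear_matrix_mult] continuous_on_const
        bounded_linear.continuous_on[OF bounded_linear_transpose] continuous_on_id)
  then have "compact K" unfolding K_def by (intro compact_Int_closed compact_SO_real)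
  moreover have "K \<noteq> {}" using assms by (auto simp: K)
  moreover have "continuous_on K (\<lambda>R. R \<bullet> mat 1)" by (intro continuous_intros)
  ultimately show ?thesis using continuous_attains_sup[of K "\<lambda>R. R \<bullet> mat 1"] by (auto simp: K)
qed

text \<open>Points of the orbit approaching \<open>fl A\<close> are written as \<open>R k\<close> applied to \<open>fl A\<close> with \<open>R k\<close> of maximal trace.
  Then \<open>R k\<close> tends to the identity and its skew part is orthogonal to the isotropy algebra, hence bounded
  by a multiple of the displacement, and the difference quotients converge.\<close>

lemma orbit_tangent_sub:
  fixes C :: "'n::{finite,wellorder} flag set"
  assumes trans: "\<And>q q'. q \<in> C \<Longrightarrow> q' \<in> C \<Longrightarrow> \<exists>R\<in>SO_real. q' = flag_act R q"
    and g: "g \<in> SL_complex" and x: "x \<in> strictly_lower" and xC: "flag_chart g x \<in> C"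
    and \<zeta>: "\<zeta> \<in> tangent {y \<in> strictly_lower. flag_chart g y \<in> C} x"
  shows "matrix_inv (mat 1 + x) ** \<zeta> \<in> tau (g ** (mat 1 + x)) ` so_real"
proof -
  define A where "A = g ** (mat 1 + x)"
  define N where "N = matrix_inv (mat 1 + x)"
  have ig: "invertible g" using g by (rule SL_complex_invertible)
  have ix: "invertible (mat 1 + x)" by (rule unilower_invertible[OF x])
  have iA: "invertible A" unfolding A_def by (rule invertible_mult[OF ig ix])
  obtain \<gamma> where \<gamma>0: "\<gamma> 0 = x" and \<gamma>M: "\<forall>\<^sub>F t in at 0. \<gamma> t \<in> {y \<in> strictly_lower. flag_chart g y \<in> C}"
    and d\<gamma>: "(\<gamma> has_vector_derivative \<zeta>) (at (0::real))"
    using \<zeta> unfolding tangent_def by blast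
  obtain \<epsilon> where \<epsilon>: "\<epsilon> > 0" "\<And>t. t \<noteq> 0 \<Longrightarrow> \<bar>t\<bar> < \<epsilon> \<Longrightarrow> \<gamma> t \<in> {y \<in> strictly_lower. flag_chart g y \<in> C}"
    using \<gamma>M unfolding eventually_at by (auto simp: dist_real_def)
  define \<tau> where "\<tau> k = \<epsilon> / 2 * inverse (real (Suc k))" for k :: nat
  have \<tau>: "\<tau> k > 0" "\<tau> k < \<epsilon>" for k
  proof -
    have "inverse (real (Suc k)) \<le> 1" by (simp add: inverse_le_1_iff)
    then have "\<tau> k \<le> \<epsilon> / 2 * 1" unfolding \<tau>_def using \<epsilon>(1) by (intro mult_left_mono) auto
    then show "\<tau> k < \<epsilon>" using \<epsilon>(1) by simp
  qed (use \<epsilon>(1) in \<open>simp add: \<tau>_def\<close>)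
  have \<tau>0: "\<tau> \<longlonglongrightarrow> 0"
    using tendsto_mult_left[OF LIMSEQ_inverse_real_of_nat, of "\<epsilon> / 2"] by (simp add: \<tau>_def[abs_def])
  have \<tau>at: "filterlim \<tau> (at 0) sequentially"
    using \<tau>0 \<tau>(1) by (auto simp: filterlim_at less_imp_neq[symmetric])
  \<comment> \<open>The displacement seen from the frame \<open>A\<close>: the matrix
    \<open>A ** (mat 1 + \<delta> k)\<close> is a frame of the flag reached at time
    \<open>\<tau> k\<close>, and the quotients of \<open>\<delta> k\<close> by
    \<open>\<tau> k\<close> tend to \<open>N ** \<zeta>\<close>.\<close>
  define \<delta> where "\<delta> k = N ** (\<gamma> (\<tau> k) - x)" for k
  have \<gamma>k: "\<gamma> (\<tau> k) \<in> strictly_lower" "flag_chart g (\<gamma> (\<tau> k)) \<in> C" for k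
    using \<epsilon>(2)[of "\<tau> k"] \<tau>[of k] by auto
  have \<delta>low: "low (\<delta> k) = \<delta> k" for k
  proof (rule low_id, unfold strictly_lower_def mem_Collect_eq \<delta>_def matrix_mult_nth, intro allI impI sum.neutral ballI)
    fix i j z :: 'n assume "i \<le> j"
    then have "i < z \<or> z \<le> j" by auto
    then show "N $ i $ z * (\<gamma> (\<tau> k) - x) $ z $ j = 0"
      using lower_matrix_inv[OF x, of i z] x \<gamma>k(1)[of k] by (auto simp: strictly_lower_def N_def)
  qed
  define B where "B k = A ** (mat 1 + \<delta> k)" for k
  have B: "B k = g ** (mat 1 + \<gamma> (\<tau> k))" for k
  proof -
    have "(mat 1 + x) ** \<delta> k = \<gamma> (\<tau> k) - x"
      unfolding \<delta>_def N_def by (rule matrix_inv_cancel_right[OF ix])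
    then have "(mat 1 + x) ** (mat 1 + \<delta> k) = mat 1 + \<gamma> (\<tau> k)"
      by (simp add: matrix_add_left)
    then show ?thesis unfolding B_def A_def by (simp flip: matrix_mul_assoc)
  qed
  have iB: "invertible (B k)" for k
    unfolding B by (intro invertible_mult ig unilower_invertible \<gamma>k)
  have fB: "fl (B k) \<in> C" and fA: "fl A \<in> C" for k
    using \<gamma>k(2)[of k] xC by (auto simp: B A_def flag_chart_def fl_def)
  have "\<exists>R\<in>SO_real. fl (R ** A) = fl (B k) \<and>
      (\<forall>R'\<in>SO_real. fl (R' ** A) = fl (B k) \<longrightarrow> R' \<bullet> mat 1 \<le> R \<bullet> mat 1)" for k
  proof -
    obtain R0 where "R0 \<in> SO_real" "fl (B k) = flag_act R0 (fl A)"
      using trans[OF fA fB[of k]] by blast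
    then show ?thesis by (intro exists_max_trace[OF iA iB]) (auto simp: flag_act_fl)
  qed
  then obtain R where R: "\<And>k. R k \<in> SO_real" and RB: "\<And>k. fl (R k ** A) = fl (B k)"
    and Rmax: "\<And>k R'. R' \<in> SO_real \<Longrightarrow> fl (R' ** A) = fl (B k) \<Longrightarrow> R' \<bullet> mat 1 \<le> R k \<bullet> mat 1"
    by metis
  have lim_quot: "(\<lambda>k. \<delta> k /\<^sub>R \<tau> k) \<longlonglongrightarrow> N ** \<zeta>"
  proof -
    have "(\<lambda>k. (\<gamma> (\<tau> k) - x) /\<^sub>R \<tau> k) \<longlonglongrightarrow> \<zeta>"
      using filterlim_compose[OF vector_derivative_tendsto[OF d\<gamma>] \<tau>at] by (simp add: \<gamma>0)
    then have "(\<lambda>k. N ** ((\<gamma> (\<tau> k) - x) /\<^sub>R \<tau> k)) \<longlonglongrightarrow> N ** \<zeta>"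
      by (intro bounded_bilinear.tendsto[OF bounded_bilinear_matrix_mult] tendsto_const)
    then show ?thesis by (simp add: \<delta>_def matrix_scaleR_right)
  qed
  have \<delta>0: "\<delta> \<longlonglongrightarrow> 0"
  proof -
    have "(\<lambda>k. \<tau> k *\<^sub>R (\<delta> k /\<^sub>R \<tau> k)) \<longlonglongrightarrow> 0 *\<^sub>R (N ** \<zeta>)"
      by (intro tendsto_scaleR \<tau>0 lim_quot)
    moreover have "\<tau> k *\<^sub>R (\<delta> k /\<^sub>R \<tau> k) = \<delta> k" for k using \<tau>(1)[of k] by simp
    ultimately show ?thesis by simp
  qed
  obtain Rl r where Rl: "Rl \<in> SO_real" and r: "strict_mono (r :: nat \<Rightarrow> nat)" and lim: "(R \<circ> r) \<longlonglongrightarrow> Rl"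
    using compact_SO_real[unfolded compact_eq_seq_compact_metric seq_compact_def] R by metis
  have \<delta>r: "(\<lambda>j. \<delta> (r j)) \<longlonglongrightarrow> 0"
    using LIMSEQ_subseq_LIMSEQ[OF \<delta>0 r] by (simp add: o_def)
  have Rr: "(\<lambda>j. R (r j)) \<longlonglongrightarrow> Rl" using lim by (simp add: o_def)
  note lin_tr = bounded_linear_transpose
  have Rtr: "(\<lambda>j. transpose (R (r j))) \<longlonglongrightarrow> transpose Rl"
    by (rule bounded_linear.tendsto[OF lin_tr Rr])
  have zero: "low (matrix_inv A ** (transpose (R k) ** B k)) = 0" for k
    using fl_eq_iff_SO[OF R iA iB] RB by blast
  have "(\<lambda>j. low (matrix_inv A ** (transpose (R (r j)) ** (A ** (mat 1 + \<delta> (r j))))))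
      \<longlonglongrightarrow> low (matrix_inv A ** (transpose Rl ** (A ** (mat 1 + 0))))"
    by (intro bounded_linear.tendsto[OF bounded_linear_low] bounded_bilinear.tendsto[OF bounded_bilinear_matrix_mult]
        tendsto_const tendsto_add Rtr \<delta>r)
  then have "low (matrix_inv A ** (transpose Rl ** A)) = 0"
    using zero LIMSEQ_unique[OF tendsto_const] by (fastforce simp: B_def)
  then have "fl (Rl ** A) = fl A" using fl_eq_iff_SO[OF Rl iA iA] by blast
  then have fix1: "flag_act (transpose Rl) (fl A) = fl A"
    by (metis SO_real_iff Rl flag_act_fl flag_act_mult flag_act_mat_1)
  \<comment> \<open>The limit \<open>Rl\<close> fixes \<open>fl A\<close>, so
    \<open>R k ** transpose Rl\<close> competes with \<open>R k\<close> for the maximal trace. In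
    the limit \<open>Rl\<close> has at least the trace of the identity and therefore equals
    it.\<close>
  have "real CARD('n) \<le> Rl \<bullet> mat 1"
  proof (rule LIMSEQ_le)
    show "(\<lambda>j. R (r j) \<bullet> mat 1) \<longlonglongrightarrow> Rl \<bullet> mat 1" by (intro tendsto_intros Rr)
    have "(\<lambda>j. (R (r j) ** transpose Rl) \<bullet> mat 1) \<longlonglongrightarrow> (Rl ** transpose Rl) \<bullet> mat 1"
      by (intro tendsto_inner bounded_bilinear.tendsto[OF bounded_bilinear_matrix_mult] tendsto_const Rr)
    moreover have "(Rl ** transpose Rl) \<bullet> mat 1 = real CARD('n)"
      unfolding SO_real_right[OF Rl] by (simp add: inner_mat_1) (simp add: mat_def)
    ultimately show "(\<lambda>j. (R (r j) ** transpose Rl) \<bullet> mat 1) \<longlonglongrightarrow> real CARD('n)" by simp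
    have "(R k ** transpose Rl) \<bullet> mat 1 \<le> R k \<bullet> mat 1" for k
    proof (rule Rmax)
      show "R k ** transpose Rl \<in> SO_real" by (intro SO_real_mult R SO_real_transpose Rl)
      show "fl (R k ** transpose Rl ** A) = fl (B k)"
        using RB[of k] fix1 by (metis flag_act_fl flag_act_mult)
    qed
    then show "\<exists>N. \<forall>n\<ge>N. (R (r n) ** transpose Rl) \<bullet> mat 1 \<le> R (r n) \<bullet> mat 1" by blast
  qed
  then have "Rl = mat 1" by (rule SO_real_trace[OF Rl])
  then have R1: "(\<lambda>j. R (r j)) \<longlonglongrightarrow> mat 1" using Rr by simp

  \<comment> \<open>\<open>Y\<close> and \<open>Q\<close> are the skew and the symmetric part of
    \<open>Z\<close>. Orthogonality of \<open>R\<close> makes \<open>Q\<close> quadratic in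
    \<open>Z\<close>, so \<open>Y\<close> is the first order term.\<close>
  define Y where "Y j = (1/2) *\<^sub>R (R (r j) - transpose (R (r j)))" for j
  define Q where "Q j = (1/2) *\<^sub>R (R (r j) + transpose (R (r j))) - mat 1" for j
  define Z where "Z j = R (r j) - mat 1" for j
  have ZYQ: "Z j = Y j + Q j" for j
    by (simp add: Z_def Y_def Q_def scaleR_diff_right scaleR_add_right flip: scaleR_add_left)
  have TYQ: "transpose (R (r j)) = mat 1 - Y j + Q j" for j
    by (simp add: Y_def Q_def scaleR_diff_right scaleR_add_right algebra_simps flip: scaleR_add_left)
  have QZ: "Q j = - (1/2) *\<^sub>R (transpose (Z j) ** Z j)" for j
  proof -
    have tZ: "transpose (Z j) = transpose (R (r j)) - mat 1"
      by (simp add: Z_def vec_eq_iff transpose_def mat_def)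
    have "transpose (Z j) ** Z j = transpose (R (r j)) ** R (r j) - transpose (R (r j)) - R (r j) + mat 1"
      unfolding tZ by (simp add: Z_def matrix_diff_left matrix_diff_right algebra_simps)
    also have "transpose (R (r j)) ** R (r j) = mat 1" using R by (simp add: SO_real_iff)
    finally have "(mat 1 + mat 1) - (R (r j) + transpose (R (r j))) = transpose (Z j) ** Z j"
      by (simp only: algebra_simps)
    then have "R (r j) + transpose (R (r j)) = 2 *\<^sub>R mat 1 - transpose (Z j) ** Z j"
      unfolding scaleR_2 by (metis diff_diff_eq2 add_diff_cancel_left')
    then show ?thesis unfolding Q_def by (simp add: scaleR_diff_right)
  qed
  have Yso: "Y j \<in> so_real" for j
  proof -
    have rR: "real_mat (R (r j))" using R by (simp add: SO_real_iff)
    have "real_mat (Y j)"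
      using rR by (simp add: Y_def real_mat_def transpose_def complex_is_Real_iff)
    moreover have "transpose (Y j) = - Y j"
      by (simp add: Y_def vec_eq_iff transpose_def scaleR_diff_right)
    ultimately show ?thesis by (simp add: so_real_def)
  qed
  \<comment> \<open>The orthogonal complement of the isotropy algebra in \<open>so_real\<close>. It
    contains every \<open>Y j\<close> by maximality of the trace, and \<open>tau A\<close> is
    injective on it, hence bounded below by some \<open>c\<close>.\<close>
  define W where "W = {Y \<in> so_real. \<forall>S\<in>so_real. tau A S = 0 \<longrightarrow> Y \<bullet> S = 0}"
  have subW: "subspace W"
    unfolding W_def using so_real_subspace
    by (auto simp: subspace_def inner_add_left)
  have YW: "Y j \<in> W" for j
  proof -
    have "Y j \<bullet> S = 0" if S: "S \<in> so_real" and t0: "tau A S = 0" for S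
    proof -
      have "R (r j) \<bullet> S = 0"
      proof (rule maximal_trace_orthogonal[OF R S])
        fix s
        have sS: "s *\<^sub>R S \<in> so_real" by (rule subspace_scale[OF so_real_subspace S])
        have "tau A (s *\<^sub>R S) = 0" using t0 linear_scale[OF linear_tau, of A s S] by simp
        then have "stab (fl A) (s *\<^sub>R S)" using tau_eq_0_iff[OF iA] by blast
        then have "flag_act (cayley (s *\<^sub>R S)) (fl A) = fl A" by (rule cayley_fixes[OF iA sS])
        then have "fl (R (r j) ** cayley (s *\<^sub>R S) ** A) = fl (B (r j))"
          using RB[of "r j"] by (metis flag_act_fl flag_act_mult)
        then show "(R (r j) ** cayley (s *\<^sub>R S)) \<bullet> mat 1 \<le> R (r j) \<bullet> mat 1"
          by (intro Rmax SO_real_mult R cayley_SO sS)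
      qed
      moreover have "transpose (R (r j)) \<bullet> S = - (R (r j) \<bullet> S)"
        using S by (simp add: inner_transpose so_real_def)
      ultimately show ?thesis by (simp add: Y_def inner_diff_left)
    qed
    then show ?thesis using Yso by (simp add: W_def)
  qed
  obtain c where c: "c > 0" "\<And>y. y \<in> W \<Longrightarrow> c * norm y \<le> norm (tau A y)"
  proof -
    have "\<exists>e>0. \<forall>y\<in>W. norm (tau A y) \<ge> e * norm y"
    proof (rule injective_imp_isometric[OF closed_subspace[OF subW] subW])
      show "bounded_linear (tau A)" using linear_tau by (simp add: linear_conv_bounded_linear)
      show "\<forall>y\<in>W. tau A y = 0 \<longrightarrow> y = 0" by (auto simp: W_def)
    qed
    then show thesis using that by auto
  qed

  \<comment> \<open>The fact \<open>zero\<close>, multiplied out by means of \<open>TYQ\<close> and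
    the definition of \<open>B\<close>, says that \<open>tau A (Y j)\<close> is the displacement up
    to this error.\<close>
  define e where "e j = tau A (Q j) + low (matrix_inv A ** (transpose (R (r j)) - mat 1) ** A ** \<delta> (r j))" for j
  have key: "tau A (Y j) = \<delta> (r j) + e j" for j
  proof -
    define T where "T = transpose (R (r j))"
    have p0: "matrix_inv A ** (T ** B (r j)) = matrix_inv A ** T ** A + matrix_inv A ** T ** A ** \<delta> (r j)"
      by (simp add: B_def matrix_add_left matrix_mul_assoc)
    have p1: "matrix_inv A ** T ** A = mat 1 - matrix_inv A ** Y j ** A + matrix_inv A ** Q j ** A"
      unfolding T_def TYQ
      by (simp add: matrix_add_left matrix_add_right matrix_diff_left matrix_diff_right matrix_inv_left[OF iA])
    have p2: "matrix_inv A ** T ** A ** \<delta> (r j) = \<delta> (r j) + matrix_inv A ** (T - mat 1) ** A ** \<delta> (r j)"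
      by (simp add: matrix_diff_left matrix_diff_right matrix_inv_left[OF iA])
    have "low ((mat 1 - matrix_inv A ** Y j ** A + matrix_inv A ** Q j ** A)
        + (\<delta> (r j) + matrix_inv A ** (T - mat 1) ** A ** \<delta> (r j))) = 0"
      using zero[of "r j"] unfolding T_def[symmetric] p0 unfolding p2 unfolding p1 .
    moreover have "low (mat 1) = (0 :: 'n cmat)" by (simp add: vec_eq_iff mat_def)
    ultimately show ?thesis
      by (simp add: low_add low_diff \<delta>low tau_def e_def T_def algebra_simps)
  qed

  obtain K where K: "\<And>(a :: 'n cmat) (b :: 'n cmat). norm (a ** b) \<le> norm a * norm b * K" "K > 0"
    using bounded_bilinear.pos_bounded[OF bounded_bilinear_matrix_mult] by metis
  obtain Kt where Kt: "\<And>a :: 'n cmat. norm (transpose a) \<le> norm a * Kt" "Kt > 0"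
    using bounded_linear.pos_bounded[OF lin_tr] by metis
  obtain L where L: "\<And>a. norm (tau A a) \<le> norm a * L" "L > 0"
    using bounded_linear.pos_bounded[of "tau A"] linear_tau[of A] by (metis linear_conv_bounded_linear)
  have bb: "bounded_bilinear (\<lambda>D d. low (matrix_inv A ** D ** A ** d))"
    unfolding bilinear_conv_bounded_bilinear[symmetric] bilinear_def
    by (auto intro!: linearI simp: matrix_add_left matrix_add_right matrix_scaleR_left
        matrix_scaleR_right low_add low_scaleR)
  then obtain L' where L': "\<And>D d. norm (low (matrix_inv A ** D ** A ** d)) \<le> norm D * norm d * L'" "L' > 0"
    using bounded_bilinear.pos_bounded[OF bb] by metis

  have Z0: "(\<lambda>j. norm (Z j)) \<longlonglongrightarrow> 0"
  proof -
    have "(\<lambda>j. R (r j) - mat 1) \<longlonglongrightarrow> mat 1 - mat 1" by (intro tendsto_diff tendsto_const R1)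
    then show ?thesis by (simp add: Z_def tendsto_norm_zero)
  qed
  have T0: "(\<lambda>j. norm (transpose (R (r j)) - mat 1)) \<longlonglongrightarrow> 0"
  proof -
    have "(\<lambda>j. transpose (R (r j)) - mat 1) \<longlonglongrightarrow> transpose (mat 1) - mat 1"
      by (intro tendsto_diff tendsto_const bounded_linear.tendsto[OF lin_tr R1])
    then show ?thesis by (simp add: tendsto_norm_zero transpose_mat)
  qed
  \<comment> \<open>A null sequence that dominates both parts of the error: eventually the part from
    \<open>Q\<close> is at most \<open>\<eta> j * norm (Y j)\<close>, the other at most
    \<open>\<eta> j * norm (\<delta> (r j))\<close>.\<close>
  define \<eta> where "\<eta> j = L * Kt * K * norm (Z j) + L' * norm (transpose (R (r j)) - mat 1)" for j
  have \<eta>0: "\<eta> \<longlonglongrightarrow> 0"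
    unfolding \<eta>_def by (rule tendsto_eq_intros Z0 T0 | simp)+
  have Qle: "norm (Q j) \<le> (Kt * K * norm (Z j)) / 2 * norm (Z j)" for j
  proof -
    have "norm (transpose (Z j) ** Z j) \<le> norm (transpose (Z j)) * norm (Z j) * K" by (rule K)
    also have "\<dots> \<le> norm (Z j) * Kt * norm (Z j) * K" using K(2) by (intro mult_right_mono Kt) auto
    finally show ?thesis by (simp add: QZ mult_ac)
  qed
  have evZ: "\<forall>\<^sub>F j in sequentially. Kt * K * norm (Z j) < 1"
  proof -
    have "(\<lambda>j. Kt * K * norm (Z j)) \<longlonglongrightarrow> 0" by (rule tendsto_eq_intros Z0 | simp)+
    then show ?thesis by (rule order_tendstoD) simp
  qed
  \<comment> \<open>Below the threshold \<open>c / 2\<close>, half of \<open>c * norm (Y j)\<close>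
    can be absorbed, so \<open>norm (Y j)\<close> is at most \<open>4 / c\<close> times the norm of
    the displacement and the error is of smaller order than the displacement.\<close>
  have ev\<eta>: "\<forall>\<^sub>F j in sequentially. \<eta> j < min 1 (c / 2)"
    using \<eta>0 by (rule order_tendstoD) (use c in auto)
  have evb: "\<forall>\<^sub>F j in sequentially. norm (e j) \<le> \<eta> j * (4 / c + 1) * norm (\<delta> (r j))"
    using evZ ev\<eta>
  proof eventually_elim
    case (elim j)
    have "Kt * K * norm (Z j) / 2 \<le> 1 / 2" using elim by simp
    then have "norm (Q j) \<le> 1 / 2 * norm (Z j)"
      by (rule order_trans[OF Qle mult_right_mono]) simp
    moreover have "norm (Z j) \<le> norm (Y j) + norm (Q j)" unfolding ZYQ by (rule norm_triangle_ineq)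
    ultimately have ZY: "norm (Z j) \<le> 2 * norm (Y j)" by linarith
    have "norm (Q j) \<le> (Kt * K * norm (Z j)) / 2 * (2 * norm (Y j))"
      by (rule order_trans[OF Qle mult_left_mono[OF ZY]]) (use K(2) Kt(2) in simp)
    then have "norm (Q j) * L \<le> (Kt * K * norm (Z j)) / 2 * (2 * norm (Y j)) * L"
      by (rule mult_right_mono) (use L(2) in simp)
    then have "norm (tau A (Q j)) \<le> L * Kt * K * norm (Z j) * norm (Y j)"
      using order_trans[OF L(1)[of "Q j"]] by (simp add: mult_ac)
    moreover have "L * Kt * K * norm (Z j) \<le> \<eta> j" using L'(2) by (simp add: \<eta>_def)
    ultimately have 1: "norm (tau A (Q j)) \<le> \<eta> j * norm (Y j)"
      by (meson mult_right_mono norm_ge_zero order_trans)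
    have "norm (low (matrix_inv A ** (transpose (R (r j)) - mat 1) ** A ** \<delta> (r j)))
        \<le> L' * norm (transpose (R (r j)) - mat 1) * norm (\<delta> (r j))"
      using L'(1)[of "transpose (R (r j)) - mat 1" "\<delta> (r j)"] by (simp add: mult_ac)
    moreover have "L' * norm (transpose (R (r j)) - mat 1) \<le> \<eta> j"
      using L(2) K(2) Kt(2) by (simp add: \<eta>_def)
    ultimately have 2: "norm (low (matrix_inv A ** (transpose (R (r j)) - mat 1) ** A ** \<delta> (r j)))
        \<le> \<eta> j * norm (\<delta> (r j))" by (meson mult_right_mono norm_ge_zero order_trans)
    have e1: "norm (e j) \<le> \<eta> j * norm (Y j) + \<eta> j * norm (\<delta> (r j))"
      unfolding e_def using norm_triangle_le[OF add_mono[OF 1 2]] by simp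
    have "c * norm (Y j) \<le> norm (\<delta> (r j)) + norm (e j)"
      using c(2)[OF YW[of j]] norm_triangle_ineq[of "\<delta> (r j)" "e j"] unfolding key by linarith
    also have "\<dots> \<le> norm (\<delta> (r j)) + (c / 2 * norm (Y j) + 1 * norm (\<delta> (r j)))"
      using e1 mult_right_mono[of "\<eta> j" "c/2" "norm (Y j)"] mult_right_mono[of "\<eta> j" 1 "norm (\<delta> (r j))"] elim
      by simp
    finally have "c * norm (Y j) \<le> 4 * norm (\<delta> (r j))" by simp
    then have "norm (Y j) \<le> 4 / c * norm (\<delta> (r j))" using c(1) by (simp add: field_simps)
    moreover have "\<eta> j \<ge> 0" using L(2) K(2) Kt(2) L'(2) by (simp add: \<eta>_def)
    ultimately have "\<eta> j * norm (Y j) \<le> \<eta> j * (4 / c * norm (\<delta> (r j)))" by (intro mult_left_mono)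
    then show ?case using e1 by (simp add: algebra_simps)
  qed
  have lim_quot_r: "(\<lambda>j. \<delta> (r j) /\<^sub>R \<tau> (r j)) \<longlonglongrightarrow> N ** \<zeta>"
    using LIMSEQ_subseq_LIMSEQ[OF lim_quot r] by (simp add: o_def)
  have "(\<lambda>j. e j /\<^sub>R \<tau> (r j)) \<longlonglongrightarrow> 0"
  proof (rule Lim_null_comparison)
    show "\<forall>\<^sub>F j in sequentially. norm (e j /\<^sub>R \<tau> (r j)) \<le> \<eta> j * (4 / c + 1) * norm (\<delta> (r j) /\<^sub>R \<tau> (r j))"
      using evb
    proof eventually_elim
      case (elim j)
      then have "inverse (\<tau> (r j)) * norm (e j) \<le> inverse (\<tau> (r j)) * (\<eta> j * (4 / c + 1) * norm (\<delta> (r j)))"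
        using \<tau>(1)[of "r j"] by (intro mult_left_mono) auto
      then show ?case using \<tau>(1)[of "r j"] by (simp add: mult_ac)
    qed
    have "(\<lambda>j. \<eta> j * (4 / c + 1) * norm (\<delta> (r j) /\<^sub>R \<tau> (r j))) \<longlonglongrightarrow> 0 * (4 / c + 1) * norm (N ** \<zeta>)"
      by (intro tendsto_mult tendsto_const tendsto_norm \<eta>0 lim_quot_r)
    then show "(\<lambda>j. \<eta> j * (4 / c + 1) * norm (\<delta> (r j) /\<^sub>R \<tau> (r j))) \<longlonglongrightarrow> 0" by simp
  qed
  from tendsto_add[OF lim_quot_r this]
  have lim': "(\<lambda>j. tau A (Y j) /\<^sub>R \<tau> (r j)) \<longlonglongrightarrow> N ** \<zeta>" by (simp add: key scaleR_add_right)
  have mem: "tau A (Y j) /\<^sub>R \<tau> (r j) \<in> tau A ` so_real" for j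
  proof -
    have "tau A (Y j) /\<^sub>R \<tau> (r j) = tau A (Y j /\<^sub>R \<tau> (r j))" by (simp add: linear_scale[OF linear_tau])
    then show ?thesis using subspace_scale[OF so_real_subspace Yso] by blast
  qed
  have cl: "closed (tau A ` so_real)"
    by (rule closed_subspace[OF linear_subspace_image[OF linear_tau so_real_subspace]])
  have "N ** \<zeta> \<in> tau A ` so_real" by (rule closed_sequentially[OF cl mem lim'])
  then show ?thesis by (simp add: N_def A_def)
qed

text \<open>Left multiplication by the inverse of \<open>mat 1 + x\<close> carries the tangent space
  in the chart onto the image of \<open>so_real\<close>, which thereby inherits the dimension and
  the stability under complex scalars.\<close>

lemma orbit_tangent:
  fixes C :: "'n::{finite,wellorder} flag set"
  assumes sub: "complex_submanifold d C" and C: "C = flag_orbit SO_real F" and p: "p \<in> C"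
  shows "\<exists>A. det A = 1 \<and> fl A = p \<and> dim (tau A ` so_real) = 2 * d \<and>
    (\<forall>\<zeta>\<in>tau A ` so_real. \<forall>c. cscale c \<zeta> \<in> tau A ` so_real)"
proof -
  have inv: "flag_act R q \<in> C" if "R \<in> SO_real" "q \<in> C" for R q
    using that SO_real_mult[OF that(1)] by (auto simp: C flag_orbit_def flag_act_mult)
  have trans: "\<exists>R\<in>SO_real. q' = flag_act R q" if "q \<in> C" "q' \<in> C" for q q'
  proof -
    obtain R where R1: "R \<in> SO_real" "q = flag_act R F"
      using \<open>q \<in> C\<close> unfolding C flag_orbit_def by blast
    obtain R' where R2: "R' \<in> SO_real" "q' = flag_act R' F"
      using \<open>q' \<in> C\<close> unfolding C flag_orbit_def by blast
    note R = R1 R2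
    have "q' = flag_act (R' ** transpose R) q"
      using R by (simp add: flag_act_mult flip: matrix_mul_assoc) (simp add: SO_real_iff)
    then show ?thesis using SO_real_mult[OF R(3) SO_real_transpose[OF R(1)]] by blast
  qed
  obtain g x where g: "g \<in> SL_complex" and x: "x \<in> strictly_lower" and gx: "flag_chart g x = p"
    and sm: "mat_submanifold_at d {y \<in> strictly_lower. flag_chart g y \<in> C} x"
    using sub p unfolding complex_submanifold_def by blast
  define M where "M = {y \<in> strictly_lower. flag_chart g y \<in> C}"
  define A where "A = g ** (mat 1 + x)"
  have ix: "invertible (mat 1 + x)" by (rule unilower_invertible[OF x])
  have xM: "x \<in> M" using x gx p by (simp add: M_def)
  note tan = mat_submanifold_tangent[OF sm[folded M_def] xM]
  define f where "f \<zeta> = matrix_inv (mat 1 + x) ** \<zeta>" for \<zeta> :: "'n cmat"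
  have lin: "linear f"
    unfolding f_def using bounded_linear_mult_left bounded_linear.linear by blast
  have img: "f ` tangent M x = tau A ` so_real"
  proof (intro set_eqI iffI)
    fix z assume "z \<in> f ` tangent M x"
    then show "z \<in> tau A ` so_real"
      using orbit_tangent_sub[OF trans g x] gx p by (auto simp: f_def A_def M_def)
  next
    fix z assume "z \<in> tau A ` so_real"
    then obtain X where X: "X \<in> so_real" "z = tau A X" by blast
    have "(mat 1 + x) ** z \<in> tangent M x"
      using orbit_tangent_sup[OF inv g x _ X(1)] gx p by (simp add: X A_def M_def)
    moreover have "z = f ((mat 1 + x) ** z)"
      by (simp add: f_def matrix_inv_cancel_left[OF ix])
    ultimately show "z \<in> f ` tangent M x" by blast
  qed
  have "inj f"
  proof (rule injI)
    fix a b assume "f a = f b"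
    then have "(mat 1 + x) ** f a = (mat 1 + x) ** f b" by simp
    then show "a = b" by (simp add: f_def matrix_inv_cancel_right[OF ix])
  qed
  then have "dim (tau A ` so_real) = 2 * d"
    using dim_image_eq[OF lin, of "tangent M x"] tan(2) by (simp add: img[symmetric] inj_on_subset)
  moreover have "cscale c \<zeta> \<in> tau A ` so_real" if \<zeta>: "\<zeta> \<in> tau A ` so_real" for c \<zeta>
  proof -
    obtain z where z: "z \<in> tangent M x" "\<zeta> = f z" using \<zeta> unfolding img[symmetric] by blast
    have "cscale c \<zeta> = f (cscale c z)" by (simp add: z f_def cscale_mult_right)
    then show ?thesis using tan(3)[OF z(1)] unfolding img[symmetric] by blast
  qed
  moreover have "det A = 1" using g det_unilower[OF x] by (simp add: A_def det_mul SL_complex_def)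
  moreover have "fl A = p" using gx by (simp add: A_def flag_chart_def fl_def)
  ultimately show ?thesis by blast
qed

section \<open>Dimensions and transversality\<close>

text \<open>In a complex tangent space, \<open>\<i>\<close> times the velocity of \<open>X\<close>
  is the velocity of some \<open>Y\<close> in \<open>so_real\<close>, so
  \<open>cscale \<i> X - Y\<close> stabilizes the flag. This is the hypothesis of
  \<open>iso_frame_exists\<close> for a unitary frame.\<close>

lemma orbit_iso_frame:
  fixes C :: "'n::{finite,wellorder} flag set"
  assumes sub: "complex_submanifold d C" and C: "C = flag_orbit SO_real F" and p: "p \<in> C"
  shows "\<exists>B. iso_frame B \<and> fl B = p"
proof -
  obtain A where A: "det A = 1" "fl A = p"
    and cl: "\<And>\<zeta> c. \<zeta> \<in> tau A ` so_real \<Longrightarrow> cscale c \<zeta> \<in> tau A ` so_real"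
    using orbit_tangent[OF assms] by blast
  have iA: "invertible A" using A by (simp add: invertible_det_nz)
  obtain Q where Q: "unitary Q" "fl Q = fl A" using gram_schmidt[OF iA] by blast
  have "\<exists>Y\<in>so_real. stab (fl Q) (cscale \<i> X - Y)" if "X \<in> so_real" for X
  proof -
    have "cscale \<i> (tau A X) \<in> tau A ` so_real" using that by (intro cl) auto
    then obtain Y where Y: "Y \<in> so_real" "cscale \<i> (tau A X) = tau A Y" by blast
    have "tau A (cscale \<i> X - Y) = 0"
      using Y(2) by (simp add: linear_diff[OF linear_tau] tau_cscale)
    then show ?thesis using Y(1) tau_eq_0_iff[OF iA] by (auto simp: Q(2))
  qed
  from iso_frame_exists[OF Q(1) this] show ?thesis using Q(2) A(2) by auto
qed

text \<open>Chart curves stay in the linear space \<open>strictly_lower\<close>, hence so do their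
  velocities. The bound gives meaning to the \<open>GREATEST\<close> in
  \<open>complex_dim\<close>.\<close>

lemma complex_submanifold_dim_le:
  assumes "complex_submanifold d (M :: 'n::{finite,wellorder} flag set)" "M \<noteq> {}"
  shows "2 * d \<le> dim (strictly_lower :: 'n cmat set)"
proof -
  obtain p where p: "p \<in> M" using assms(2) by blast
  obtain g x where x: "x \<in> strictly_lower" "flag_chart g x = p"
    and sm: "mat_submanifold_at d {y \<in> strictly_lower. flag_chart g y \<in> M} x"
    using assms(1) p unfolding complex_submanifold_def by blast
  define N where "N = {y \<in> strictly_lower. flag_chart g y \<in> M}"
  have xN: "x \<in> N" using x p by (simp add: N_def)
  have sub: "subspace (strictly_lower :: 'n cmat set)"
    by (auto simp: strictly_lower_def subspace_def)
  have "tangent N x \<subseteq> strictly_lower"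
  proof
    fix \<eta> assume "\<eta> \<in> tangent N x"
    then obtain \<gamma> where \<gamma>: "\<gamma> (0::real) = x" "\<forall>\<^sub>F t in at 0. \<gamma> t \<in> N" "(\<gamma> has_vector_derivative \<eta>) (at 0)"
      unfolding tangent_def by blast
    have "\<forall>\<^sub>F t in at 0. \<gamma> t \<in> strictly_lower"
      using \<gamma>(2) by eventually_elim (simp add: N_def)
    then show "\<eta> \<in> strictly_lower"
      by (intro closed_vector_derivative_in_subspace[OF sub \<gamma>(3)]) (use \<gamma>(1) x in auto)
  qed
  then have "dim (tangent N x) \<le> dim (strictly_lower :: 'n cmat set)" by (rule dim_subset)
  then show ?thesis using mat_submanifold_tangent(2)[OF sm[folded N_def] xN] by simp
qed

lemma complex_dim_ge:
  assumes "complex_submanifold d (M :: 'n::{finite,wellorder} flag set)" "M \<noteq> {}" "M \<subseteq> X"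
  shows "d \<le> complex_dim X"
  unfolding complex_dim_def
proof (rule Greatest_le_nat)
  show "\<exists>M. M \<noteq> {} \<and> M \<subseteq> X \<and> complex_submanifold d M" using assms by blast
  fix e assume "\<exists>M. M \<noteq> {} \<and> M \<subseteq> X \<and> complex_submanifold e M"
  then have "2 * e \<le> dim (strictly_lower :: 'n cmat set)" using complex_submanifold_dim_le by blast
  then show "e \<le> dim (strictly_lower :: 'n cmat set)" by simp
qed

text \<open>\<open>M\<close> witnesses that the set of dimensions is nonempty, so that the bounded
  \<open>GREATEST\<close> is attained.\<close>

lemma complex_dim_flags_le:
  assumes "complex_submanifold d (M :: 'n::{finite,wellorder} flag set)" "M \<noteq> {}"
  shows "2 * complex_dim (flags :: 'n flag set) \<le> dim (strictly_lower :: 'n cmat set)"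
proof -
  have "\<exists>M. M \<noteq> {} \<and> M \<subseteq> flags \<and> complex_submanifold (complex_dim (flags :: 'n flag set)) (M :: 'n flag set)"
    unfolding complex_dim_def
  proof (rule GreatestI_nat)
    have "M \<subseteq> flags" using assms(1) by (simp add: complex_submanifold_def)
    then show "\<exists>M. M \<noteq> {} \<and> M \<subseteq> flags \<and> complex_submanifold d (M :: 'n flag set)"
      using assms by (intro exI[of _ M]) simp
    fix e assume "\<exists>M. M \<noteq> {} \<and> M \<subseteq> flags \<and> complex_submanifold e (M :: 'n flag set)"
    then have "2 * e \<le> dim (strictly_lower :: 'n cmat set)" using complex_submanifold_dim_le by blast
    then show "e \<le> dim (strictly_lower :: 'n cmat set)" by simp
  qed
  then show ?thesis using complex_submanifold_dim_le by blast
qed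

text \<open>Their number is the length of \<open>w\<close>, the complex dimension of its Schubert
  cell. Read as matrix positions, they are the strictly lower ones that conjugation by the
  permutation matrix of \<open>w\<close> moves above the diagonal.\<close>

definition inversions :: "(nat \<Rightarrow> nat) \<Rightarrow> ('n::{finite,wellorder} \<times> 'n) set" where
  "inversions w = {(x, y). y < x \<and> wperm w x < wperm w y}"

lemma perm_matrix_exists:
  assumes w: "w permutes {1..CARD('n)}"
  shows "\<exists>g c. det (g :: 'n::{finite,wellorder} cmat) = 1 \<and> (\<forall>x. c x \<noteq> 0) \<and>
    (\<forall>x y. g $ x $ y = (if x = wperm w y then c x else 0)) \<and> fl g = coordinate_flag w"
proof -
  have bij: "bij (wperm w :: 'n \<Rightarrow> 'n)" by (rule wperm_bij[OF w])
  define a :: "'n cmat" where "a = (\<chi> x y. if x = wperm w y then 1 else 0)"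
  have anth: "a $ x $ y = (if x = wperm w y then 1 else 0)" for x y by (simp add: a_def)
  have "transpose a ** a = mat 1"
  proof -
    have "(transpose a ** a) $ x $ y = (if x = y then 1 else 0)" for x y
    proof -
      have "(transpose a ** a) $ x $ y = (\<Sum>k\<in>UNIV. (if k = wperm w x then if wperm w x = wperm w y then 1 else 0 else 0))"
        unfolding matrix_mult_nth by (intro sum.cong) (auto simp: transpose_def anth)
      then show ?thesis using bij by (auto simp: bij_def inj_eq)
    qed
    then show ?thesis by (simp add: vec_eq_iff mat_def)
  qed
  then have "invertible a" unfolding invertible_left_inverse by blast
  then have da: "det a \<noteq> 0" by (simp add: invertible_det_nz)
  \<comment> \<open>The permutation matrix \<open>a\<close> may have determinant -1; rescaling one
    row repairs this, at the price of the factors \<open>c\<close>.\<close>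
  define x0 :: 'n where "x0 = en 0"
  define c :: "'n \<Rightarrow> complex" where "c x = (if x = x0 then 1 / det a else 1)" for x
  have c0: "c x \<noteq> 0" for x using da by (simp add: c_def)
  define g :: "'n cmat" where "g = (\<chi> i. c i *s a $ i)"
  have gnth: "g $ x $ y = (if x = wperm w y then c x else 0)" for x y by (simp add: g_def anth)
  have "det g = prod c UNIV * det (\<chi> i. a $ i)" unfolding g_def by (rule det_rows_mul)
  also have "prod c UNIV = 1 / det a" by (simp add: c_def)
  finally have dg: "det g = 1" using da by simp
  have ig: "invertible g" using dg by (simp add: invertible_det_nz)
  have gv: "(g *v v) $ wperm w y = c (wperm w y) * v $ y" for v y
  proof -
    have "(g *v v) $ wperm w y = (\<Sum>k\<in>UNIV. if k = y then c (wperm w y) * v $ y else 0)"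
      unfolding matrix_vector_nth using bij by (intro sum.cong) (auto simp: gnth bij_def inj_eq)
    then show ?thesis by simp
  qed
  have "fl g i = coordinate_flag w i" for i
  proof (intro set_eqI iffI)
    fix v :: "'n cvec" assume "v \<in> fl g i"
    then obtain u where u: "u \<in> std_space i" "v = g *v u" by (auto simp: fl_nth)
    show "v \<in> coordinate_flag w i" unfolding coordinate_flag_wperm mem_Collect_eq
    proof (intro allI impI)
      fix x :: 'n assume x: "x \<notin> wperm w ` {y. rk y < i}"
      obtain y where y: "x = wperm w y" using bij by (metis bij_pointE)
      then have "u $ y = 0" using x u(1) by (auto simp: std_space_def not_less[symmetric])
      then show "v $ x = 0" by (simp add: u(2) y gv)
    qed
  next
    fix v :: "'n cvec" assume v: "v \<in> coordinate_flag w i"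
    define u where "u = matrix_inv g *v v"
    have gu: "g *v u = v" by (simp add: u_def matrix_vector_mul_assoc matrix_inv_right[OF ig])
    have "u \<in> std_space i" unfolding std_space_def mem_Collect_eq
    proof (intro allI impI)
      fix y :: 'n assume "i \<le> rk y"
      then have "wperm w y \<notin> wperm w ` {y. rk y < i}" using bij by (auto simp: bij_def inj_eq)
      then have "(g *v u) $ wperm w y = 0" using v unfolding coordinate_flag_wperm gu by blast
      then show "u $ y = 0" using c0 by (simp add: gv)
    qed
    then show "v \<in> fl g i" using gu by (auto simp: fl_nth)
  qed
  then show ?thesis using dg c0 gnth by (intro exI[of _ g] exI[of _ c]) auto
qed

lemma topspace_flag_topology: "topspace flag_topology = (flags :: 'n::{finite,wellorder} flag set)"
proof -
  have "{g \<in> SL_complex. flag_act g (coordinate_flag id) \<in> (flags :: 'n flag set)} = SL_complex"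
    using fl_in_flags SL_complex_invertible by (auto simp: fl_def)
  then have "openin flag_topology (flags :: 'n flag set)"
    by (simp add: openin_flag_topology)
  then show ?thesis
    by (metis openin_flag_topology openin_subset openin_topspace subset_antisym)
qed

lemma flag_act_in_flags:
  assumes "invertible b" "invertible g"
  shows "flag_act b (fl g) \<in> flags"
  unfolding flag_act_fl by (intro fl_in_flags invertible_mult assms)

lemma Borel_iff: "b \<in> Borel_subgroup \<longleftrightarrow> det b = 1 \<and> upper b"
  by (auto simp: Borel_subgroup_def SL_complex_def upper_def)

lemma Borel_invertible: "b \<in> Borel_subgroup \<Longrightarrow> invertible b"
  by (simp add: Borel_iff invertible_det_nz)

lemma schubert_cell_subset:
  assumes w: "w permutes {1..CARD('n)}"
  shows "flag_orbit Borel_subgroup (coordinate_flag w) \<subseteq> (schubert_variety w :: 'n::{finite,wellorder} flag set)"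
  unfolding schubert_variety_def
proof (rule closure_of_subset)
  obtain g :: "'n cmat" where g: "det g = 1" "fl g = coordinate_flag w"
    using perm_matrix_exists[OF w] by blast
  then have "invertible g" by (simp add: invertible_det_nz)
  then show "flag_orbit Borel_subgroup (coordinate_flag w) \<subseteq> topspace (flag_topology :: 'n flag topology)"
    unfolding topspace_flag_topology flag_orbit_def g(2)[symmetric]
    using flag_act_in_flags Borel_invertible by blast
qed

text \<open>In the chart at the coordinate flag, matrices \<open>y\<close> supported on inversions
  form a coordinate plane inside the cell, because \<open>g ** (mat 1 + y) ** matrix_inv g\<close>
  is upper triangular of determinant 1.\<close>

lemma schubert_dim_ge:
  assumes w: "w permutes {1..CARD('n)}"
  shows "card (inversions w :: ('n \<times> 'n) set) \<le> complex_dim (schubert_variety w :: 'n::{finite,wellorder} flag set)"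
proof -
  have bij: "bij (wperm w :: 'n \<Rightarrow> 'n)" by (rule wperm_bij[OF w])
  obtain g :: "'n cmat" and c where dg: "det g = 1" and c: "\<And>x. c x \<noteq> 0"
    and gnth: "\<And>x y. g $ x $ y = (if x = wperm w y then c x else 0)" and fg: "fl g = coordinate_flag w"
    using perm_matrix_exists[OF w] by blast
  have ig: "invertible g" using dg by (simp add: invertible_det_nz)
  define K where "K = {y :: 'n cmat. \<forall>i j. (i, j) \<notin> inversions w \<longrightarrow> y $ i $ j = 0}"
  have Klow: "K \<subseteq> strictly_lower"
    unfolding K_def strictly_lower_def inversions_def by (auto dest: leD)
  define M where "M = flag_chart g ` K"
  have chart: "flag_chart g y = fl (g ** (mat 1 + y))" for y by (simp add: flag_chart_def fl_def)
  have iy: "invertible (g ** (mat 1 + y))" if "y \<in> strictly_lower" for y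
    using that ig by (simp add: invertible_mult unilower_invertible)
  have inj: "y = y'" if "y \<in> strictly_lower" "y' \<in> strictly_lower" "flag_chart g y = flag_chart g y'" for y y'
  proof (rule unilower_unique[OF that(1,2)])
    have "upper (matrix_inv (g ** (mat 1 + y)) ** (g ** (mat 1 + y')))"
      using fl_eq_iff[OF iy[OF that(1)] iy[OF that(2)]] that(3) by (simp add: chart)
    moreover have "matrix_inv (g ** (mat 1 + y)) ** (g ** (mat 1 + y')) = matrix_inv (mat 1 + y) ** (mat 1 + y')"
      by (simp add: matrix_inv_mult[OF ig unilower_invertible[OF that(1)]] matrix_inv_cancel_left[OF ig]
          flip: matrix_mul_assoc)
    ultimately show "upper (matrix_inv (mat 1 + y) ** (mat 1 + y'))" by simp
  qed
  have pre: "{y \<in> strictly_lower. flag_chart g y \<in> M} = K"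
    using inj Klow unfolding M_def by blast
  have "complex_submanifold (card (inversions w :: ('n \<times> 'n) set)) M"
    unfolding complex_submanifold_def
  proof (intro conjI ballI)
    show "M \<subseteq> flags" using Klow fl_in_flags[OF iy] by (auto simp: M_def chart)
    fix p assume "p \<in> M"
    then obtain y where y: "y \<in> K" "p = flag_chart g y" by (auto simp: M_def)
    have "holomorphic_mat (\<lambda>y :: 'n cmat. y) UNIV"
      unfolding holomorphic_mat_def by (auto intro!: exI[of _ "\<lambda>h. h"])
    moreover have "homeomorphism UNIV UNIV (\<lambda>y :: 'n cmat. y) (\<lambda>y. y)"
      by (auto simp: homeomorphism_def)
    ultimately have "mat_submanifold_at (card (inversions w :: ('n \<times> 'n) set)) K y"
      unfolding mat_submanifold_at_def
      by (intro exI[of _ "UNIV :: 'n cmat set"] exI[of _ "\<lambda>y :: 'n cmat. y"] exI[of _ "inversions w"])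
        (auto simp: K_def)
    then show "\<exists>g\<in>SL_complex. \<exists>x\<in>strictly_lower. flag_chart g x = p \<and>
        mat_submanifold_at (card (inversions w :: ('n \<times> 'n) set)) {y \<in> strictly_lower. flag_chart g y \<in> M} x"
      using y Klow dg pre by (intro bexI[of _ g] bexI[of _ y]) (auto simp: SL_complex_def)
  qed
  moreover have "M \<noteq> {}" by (auto simp: M_def K_def intro!: exI[of _ 0])
  moreover have "M \<subseteq> flag_orbit Borel_subgroup (coordinate_flag w)"
  proof
    fix p assume "p \<in> M"
    then obtain y where y: "y \<in> K" "p = flag_chart g y" by (auto simp: M_def)
    define N where "N = g ** (mat 1 + y) ** matrix_inv g"
    have Ng: "N ** g = g ** (mat 1 + y)"
      by (simp add: N_def matrix_inv_left[OF ig] flip: matrix_mul_assoc)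
    have "det g * det (matrix_inv g) = 1"
      using arg_cong[OF matrix_inv_right[OF ig], of det] by (simp add: det_mul)
    then have dN: "det N = 1" using det_unilower[of y] y Klow dg by (auto simp: N_def det_mul)
    have "upper N" unfolding upper_def
    proof (intro allI impI)
      fix i j :: 'n assume ji: "j < i"
      obtain a b where ab: "i = wperm w a" "j = wperm w b" using bij by (metis bij_pointE)
      have "(N ** g) $ i $ b = N $ i $ j * c j"
        unfolding matrix_mult_nth
        by (subst mult_sum_nonzero_term[of j]) (auto simp: gnth ab(2))
      moreover have "(g ** (mat 1 + y)) $ i $ b = c i * (mat 1 + y) $ a $ b"
        unfolding matrix_mult_nth using bij
        by (subst mult_sum_nonzero_term[of a]) (auto simp: gnth ab(1) bij_def inj_eq)
      moreover have "(mat 1 + y) $ a $ b = 0"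
      proof -
        have "a \<noteq> b" "(a, b) \<notin> inversions w" using ab ji by (auto simp: inversions_def)
        then show ?thesis using y(1) by (simp add: K_def mat_def)
      qed
      ultimately show "N $ i $ j = 0" using Ng c[of j] by simp
    qed
    then have "N \<in> Borel_subgroup" using dN by (simp add: Borel_iff)
    moreover have "p = flag_act N (coordinate_flag w)"
      by (simp add: y(2) chart flag_act_fl Ng flip: fg)
    ultimately show "p \<in> flag_orbit Borel_subgroup (coordinate_flag w)" by (auto simp: flag_orbit_def)
  qed
  ultimately show ?thesis
    using complex_dim_ge schubert_cell_subset[OF w] by blast
qed

text \<open>With \<open>A = b ** g ** u\<close> and triangular outer factors, conjugation by
  \<open>b\<close> keeps \<open>X\<close> triangular, conjugation by \<open>g\<close> leaves only
  inversions below the diagonal, and \<open>u\<close> contributes a linear map.\<close>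

lemma dim_tau_upper_le:
  fixes A :: "'n::{finite,wellorder} cmat"
  assumes w: "w permutes {1..CARD('n)}" and iA: "invertible A"
    and cell: "fl A \<in> flag_orbit Borel_subgroup (coordinate_flag w)"
  shows "dim (tau A ` {X. upper X}) \<le> 2 * card (inversions w :: ('n \<times> 'n) set)"
proof -
  have bij: "bij (wperm w :: 'n \<Rightarrow> 'n)" by (rule wperm_bij[OF w])
  obtain g :: "'n cmat" and c where dg: "det g = 1" and c: "\<And>x. c x \<noteq> 0"
    and gnth: "\<And>x y. g $ x $ y = (if x = wperm w y then c x else 0)" and fg: "fl g = coordinate_flag w"
    using perm_matrix_exists[OF w] by blast
  have ig: "invertible g" using dg by (simp add: invertible_det_nz)
  define K where "K = {y :: 'n cmat. \<forall>i j. (i, j) \<notin> inversions w \<longrightarrow> y $ i $ j = 0}"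
  obtain b where b: "b \<in> Borel_subgroup" "fl A = flag_act b (fl g)"
    using cell by (auto simp: flag_orbit_def fg)
  have ib: "invertible b" and ub: "upper b" using b(1) by (auto simp: Borel_invertible Borel_iff)
  define u where "u = matrix_inv (b ** g) ** A"
  have ibg: "invertible (b ** g)" by (rule invertible_mult[OF ib ig])
  have uu: "upper u" using fl_eq_iff[OF ibg iA] b(2) by (simp add: u_def flag_act_fl)
  have iu: "invertible u" unfolding u_def by (intro invertible_mult invertible_matrix_inv ibg iA)
  have A: "A = b ** g ** u" unfolding u_def by (simp add: matrix_inv_cancel_right[OF ibg])
  have sub: "tau A ` {X. upper X} \<subseteq> (\<lambda>k. low (matrix_inv u ** k ** u)) ` K"
  proof clarify
    fix X :: "'n cmat" assume X: "upper X"
    define X' where "X' = matrix_inv b ** X ** b"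
    have uX': "upper X'" unfolding X'_def by (intro upper_mult upper_matrix_inv ub ib X)
    define Z where "Z = matrix_inv g ** X' ** g"
    have gZ: "g ** Z = X' ** g" by (simp add: Z_def matrix_inv_cancel_right[OF ig] flip: matrix_mul_assoc)
    have "low Z \<in> K" unfolding K_def mem_Collect_eq
    proof (intro allI impI)
      fix a d :: 'n assume ad: "(a, d) \<notin> inversions w"
      show "low Z $ a $ d = 0"
      proof (cases "d < a")
        case True
        then have "\<not> wperm w a < wperm w d" using ad by (simp add: inversions_def)
        moreover have "wperm w a \<noteq> wperm w d" using True bij by (auto simp: bij_def inj_eq)
        ultimately have "X' $ wperm w a $ wperm w d = 0" using uX' by (auto simp: upper_def)
        moreover have "(g ** Z) $ wperm w a $ d = c (wperm w a) * Z $ a $ d"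
          unfolding matrix_mult_nth using bij
          by (subst mult_sum_nonzero_term[of a]) (auto simp: gnth bij_def inj_eq)
        moreover have "(X' ** g) $ wperm w a $ d = X' $ wperm w a $ wperm w d * c (wperm w d)"
          unfolding matrix_mult_nth by (subst mult_sum_nonzero_term[of "wperm w d"]) (auto simp: gnth)
        ultimately show ?thesis using c[of "wperm w a"] by (simp add: gZ)
      qed simp
    qed
    moreover have "tau A X = low (matrix_inv u ** low Z ** u)"
    proof -
      have "matrix_inv A ** X ** A = matrix_inv u ** Z ** u"
        by (simp add: A matrix_inv_mult ibg iu ib ig Z_def X'_def matrix_mul_assoc)
      moreover have "upper (matrix_inv u ** (Z - low Z) ** u)"
        by (intro upper_mult upper_matrix_inv uu iu) (simp add: upper_def)
      then have "low (matrix_inv u ** Z ** u) = low (matrix_inv u ** low Z ** u)"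
        by (simp add: upper_iff_low matrix_diff_left matrix_diff_right low_diff)
      ultimately show ?thesis by (simp add: tau_def)
    qed
    ultimately show "tau A X \<in> (\<lambda>k. low (matrix_inv u ** k ** u)) ` K" by blast
  qed
  have "linear (\<lambda>k. low (matrix_inv u ** k ** u))"
    using linear_tau[of u] by (simp add: tau_def[abs_def])
  then have "dim ((\<lambda>k. low (matrix_inv u ** k ** u)) ` K) \<le> dim K" by (rule dim_image_le)
  moreover have "dim K = 2 * card (inversions w :: ('n \<times> 'n) set)" unfolding K_def by (rule dim_support)
  ultimately show ?thesis using dim_subset[OF sub] by simp
qed

text \<open>\<open>T\<close> and \<open>U\<close> are the tangent spaces of base cycle and cell.
  Together they span everything, and the dimension hypothesis leaves no room for an intersection;
  the common velocity of \<open>X\<close> and \<open>Y\<close> lies in both and therefore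
  vanishes.\<close>

lemma transversal:
  fixes C :: "'n::{finite,wellorder} flag set"
  assumes sub: "complex_submanifold d C" and C: "C = flag_orbit SO_real F" and p: "p \<in> C"
    and w: "w permutes {1..CARD('n)}"
    and dim: "complex_dim (schubert_variety w :: 'n flag set) + complex_dim C = complex_dim (flags :: 'n flag set)"
    and cell: "p \<in> flag_orbit Borel_subgroup (coordinate_flag w)"
    and X: "upper X" and Y: "transpose Y = - Y" and st: "stab p (X - Y)"
  shows "stab p X"
proof -
  obtain A where A: "det A = 1" "fl A = p" "dim (tau A ` so_real) = 2 * d"
    and cl: "\<And>\<zeta> c. \<zeta> \<in> tau A ` so_real \<Longrightarrow> cscale c \<zeta> \<in> tau A ` so_real"
    using orbit_tangent[OF sub C p] by blast
  have iA: "invertible A" using A by (simp add: invertible_det_nz)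
  define T where "T = tau A ` so_real"
  define U where "U = tau A ` {X. upper X}"
  have sT: "subspace T" unfolding T_def by (rule linear_subspace_image[OF linear_tau so_real_subspace])
  have sU: "subspace U" unfolding U_def
    by (rule linear_subspace_image[OF linear_tau]) (auto simp: subspace_def upper_def)
  \<comment> \<open>\<open>T\<close> comes from real skew matrices but is a complex space; splitting
    into real and imaginary parts shows that it also contains the velocities of complex skew
    matrices.\<close>
  have skew: "tau A S \<in> T" if S: "transpose S = - S" for S :: "'n cmat"
  proof -
    define S1 :: "'n cmat" where "S1 = (\<chi> i j. of_real (Re (S $ i $ j)))"
    define S2 :: "'n cmat" where "S2 = (\<chi> i j. of_real (Im (S $ i $ j)))"
    have S': "S $ j $ i = - S $ i $ j" for i j using arg_cong[OF S, of "\<lambda>M. M $ i $ j"] by (simp add: transpose_def)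
    have "S1 \<in> so_real" "S2 \<in> so_real"
      unfolding so_real_def mem_Collect_eq real_mat_def vec_eq_iff transpose_def S1_def S2_def
      by (auto) (subst S', simp)+
    moreover have "S = S1 + cscale \<i> S2"
      by (simp add: vec_eq_iff S1_def S2_def complex_eq_iff)
    then have "tau A S = tau A S1 + cscale \<i> (tau A S2)"
      by (simp add: linear_add[OF linear_tau] tau_cscale)
    ultimately show ?thesis using cl[of "tau A S2" \<i>] subspace_add[OF sT] by (auto simp: T_def)
  qed
  have "strictly_lower \<subseteq> {x + y |x y. x \<in> T \<and> y \<in> U}"
  proof
    fix Z :: "'n cmat" assume Z: "Z \<in> strictly_lower"
    define G where "G = A ** Z ** matrix_inv A"
    have "matrix_inv A ** G ** A = matrix_inv A ** (A ** (Z ** (matrix_inv A ** A)))"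
      by (simp add: G_def matrix_mul_assoc)
    then have tG: "tau A G = Z"
      by (simp add: tau_def matrix_inv_left[OF iA] matrix_inv_cancel_left[OF iA] low_id[OF Z])
    \<comment> \<open>The skew matrix with the same strictly lower part as \<open>G\<close>, so that
      the rest is upper triangular: so(n, C) and the triangular matrices span gl(n).\<close>
    define S where "S = low G - transpose (low G)"
    have "transpose S = - S" by (simp add: S_def vec_eq_iff transpose_def)
    moreover have "upper (G - S)" by (auto simp: S_def upper_def transpose_def)
    moreover have "Z = tau A S + tau A (G - S)" using tG by (simp add: linear_diff[OF linear_tau])
    ultimately show "Z \<in> {x + y |x y. x \<in> T \<and> y \<in> U}" using skew by (auto simp: U_def)
  qed
  then have "dim (strictly_lower :: 'n cmat set) \<le> dim {x + y |x y. x \<in> T \<and> y \<in> U}" by (rule dim_subset)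
  moreover have "dim {x + y |x y. x \<in> T \<and> y \<in> U} + dim (T \<inter> U) = dim T + dim U"
    by (rule dim_sums_Int[OF sT sU])
  moreover have "dim T = 2 * d" using A by (simp add: T_def)
  moreover have "dim U \<le> 2 * card (inversions w :: ('n \<times> 'n) set)"
    unfolding U_def using dim_tau_upper_le[OF w iA] cell A by simp
  moreover have "d \<le> complex_dim C" using complex_dim_ge[OF sub] p by blast
  moreover have "2 * complex_dim (flags :: 'n flag set) \<le> dim (strictly_lower :: 'n cmat set)"
    using complex_dim_flags_le[OF sub] p by blast
  \<comment> \<open>All estimates point the same way: lower bounds for the two dimensions that are
    added, an upper bound for that of the flag manifold.\<close>
  ultimately have "dim (T \<inter> U) = 0" using schubert_dim_ge[OF w] dim by linarith
  then have TU: "T \<inter> U \<subseteq> {0}" by (simp add: dim_eq_0)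
  have "tau A X = tau A Y"
    using st tau_eq_0_iff[OF iA, of "X - Y"] by (simp add: A linear_diff[OF linear_tau])
  moreover have "tau A X \<in> U" using X by (simp add: U_def)
  ultimately have "tau A X \<in> T \<inter> U" using skew[OF Y] by simp
  then have "tau A X = 0" using TU by blast
  then show ?thesis using tau_eq_0_iff[OF iA] A by simp
qed

section \<open>Transversal points lie in coordinate planes\<close>

text \<open>In a normal matrix, row \<open>i\<close> and column \<open>i\<close> have equal norm;
  once the earlier rows are diagonal, the column reduces to its diagonal entry, and so must the
  row.\<close>

lemma upper_normal_diagonal:
  fixes R :: "'n::{finite,wellorder} cmat"
  assumes up: "upper R" and normal: "R ** ct R = ct R ** R"
  shows "i \<noteq> j \<Longrightarrow> R $ i $ j = 0"
proof -
  have "\<forall>j>i. R $ i $ j = 0" for i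
  proof (induction i rule: less_induct)
    case (less i)
    have sq: "R $ a $ b * cnj (R $ a $ b) = of_real ((cmod (R $ a $ b))\<^sup>2)" for a b
      by (simp only: complex_norm_square)
    have "(R ** ct R) $ i $ i = of_real (\<Sum>k\<in>UNIV. (cmod (R $ i $ k))\<^sup>2)"
      by (simp add: matrix_mult_nth sq)
    moreover have "(ct R ** R) $ i $ i = of_real (\<Sum>k\<in>UNIV. (cmod (R $ k $ i))\<^sup>2)"
      by (simp add: matrix_mult_nth sq mult.commute)
    ultimately have "(\<Sum>k\<in>UNIV. (cmod (R $ i $ k))\<^sup>2) = (\<Sum>k\<in>UNIV. (cmod (R $ k $ i))\<^sup>2)"
      using normal by (metis of_real_eq_iff)
    also have "\<dots> = (\<Sum>k\<in>{i}. (cmod (R $ k $ i))\<^sup>2)"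
    proof (intro sum.mono_neutral_right ballI)
      fix k assume "k \<in> UNIV - {i}"
      then have "k < i \<or> i < k" by auto
      then show "(cmod (R $ k $ i))\<^sup>2 = 0" using less.IH up by (auto simp: upper_def)
    qed auto
    also have "(\<Sum>k\<in>UNIV. (cmod (R $ i $ k))\<^sup>2) = (cmod (R $ i $ i))\<^sup>2 + (\<Sum>k\<in>UNIV - {i}. (cmod (R $ i $ k))\<^sup>2)"
      by (rule sum.remove) auto
    finally have "(\<Sum>k\<in>UNIV - {i}. (cmod (R $ i $ k))\<^sup>2) = 0" by simp
    then have "\<forall>k\<in>UNIV - {i}. (cmod (R $ i $ k))\<^sup>2 = 0" by (subst (asm) sum_nonneg_eq_0_iff) auto
    then show ?case by auto
  qed
  then show "i \<noteq> j \<Longrightarrow> R $ i $ j = 0" using up unfolding upper_def by (metis linorder_neqE)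
qed

lemma rho_less_iff: "rho x < rho y \<longleftrightarrow> y < (x :: 'n::{finite,wellorder})"
proof -
  have "rho x < rho y \<longleftrightarrow> CARD('n) - 1 - rk x < CARD('n) - 1 - rk y"
    by (simp only: rho_rk flip: rk_less_iff)
  also have "\<dots> \<longleftrightarrow> rk y < rk x" using rk_less[of x] rk_less[of y] by linarith
  finally show ?thesis by (simp add: rk_less_iff)
qed

lemma iso_frame_unitary: "iso_frame A \<Longrightarrow> unitary A"
  by (simp add: iso_frame_def)

lemma iso_frame_cnj: "iso_frame A \<Longrightarrow> A $ x $ rho y = cnj (A $ x $ y)"
  by (simp add: iso_frame_def)

text \<open>The infinitesimal form of the direct sum: a velocity produced both by a triangular and
  by a complex skew matrix is zero.\<close>

definition transversal_flag :: "'n::{finite,wellorder} flag \<Rightarrow> bool" where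
  "transversal_flag F \<longleftrightarrow> (\<forall>X Y. upper X \<longrightarrow> transpose Y = - Y \<longrightarrow> stab F (X - Y) \<longrightarrow> stab F X)"

lemma transversal_flagD:
  "transversal_flag F \<Longrightarrow> upper X \<Longrightarrow> transpose Y = - Y \<Longrightarrow> stab F (X - Y) \<Longrightarrow> stab F X"
  unfolding transversal_flag_def by blast

text \<open>The orthogonal projection onto the real plane spanned by a column and its conjugate is
  real symmetric. Splitting it into a skew and a triangular part, transversality forces both parts to
  stabilize the flag, so the triangular part is normal and hence diagonal.\<close>

lemma transversal_projection_diagonal:
  fixes A :: "'n::{finite,wellorder} cmat"
  assumes A: "iso_frame A"
    and tr: "transversal_flag (fl A)"
    and y: "y \<noteq> rho y" and pq: "p \<noteq> q"
  shows "A $ p $ y * cnj (A $ q $ y) + cnj (A $ p $ y) * A $ q $ y = 0"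
proof -
  note un = iso_frame_unitary[OF A]
  note iA = unitary_invertible[OF un]
  define D :: "'n cmat" where "D = (\<chi> a b. if a = b \<and> (a = y \<or> a = rho y) then 1 else 0)"
  define G where "G = A ** D ** ct A"
  have AD: "(A ** D) $ a $ b = (if b = y \<or> b = rho y then A $ a $ b else 0)" for a b
    unfolding matrix_mult_nth by (subst mult_sum_nonzero_term[of b]) (auto simp: D_def)
  have G: "G $ a $ b = A $ a $ y * cnj (A $ b $ y) + cnj (A $ a $ y) * A $ b $ y" for a b
  proof -
    have "G $ a $ b = (\<Sum>k\<in>UNIV. (A ** D) $ a $ k * cnj (A $ b $ k))"
      by (simp add: G_def matrix_mult_nth[of "A ** D"])
    also have "\<dots> = (\<Sum>k\<in>{y, rho y}. (A ** D) $ a $ k * cnj (A $ b $ k))"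
      by (intro sum.mono_neutral_right) (auto simp: AD)
    also have "\<dots> = A $ a $ y * cnj (A $ b $ y) + cnj (A $ a $ y) * A $ b $ y"
      using y by (simp add: AD iso_frame_cnj[OF A])
    finally show ?thesis .
  qed
  have Gsym: "G $ a $ b = G $ b $ a" for a b by (simp add: G mult.commute)
  have Greal: "cnj (G $ a $ b) = G $ a $ b" for a b by (simp add: G mult.commute)
  define S where "S = low G - transpose (low G)"
  have S: "S \<in> so_real"
    by (auto simp: S_def so_real_def real_mat_def transpose_def vec_eq_iff Greal Reals_cnj_iff)
  define R where "R = G - S"
  have uR: "upper R" by (auto simp: R_def S_def upper_def transpose_def)
  have GA: "matrix_inv A ** G ** A = D"
    by (simp add: G_def unitary_inv[OF un] matrix_mul_assoc un[unfolded unitary_def])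
      (simp add: un[unfolded unitary_def] flip: matrix_mul_assoc)
  have "upper D" by (auto simp: upper_def D_def)
  then have "stab (fl A) (R - (- S))" by (simp add: stab_fl[OF iA] R_def GA)
  then have stR: "stab (fl A) R"
    using so_real_uminus[OF S] by (intro transversal_flagD[OF tr uR, of "- S"]) (auto simp: so_real_def)
  define R' where "R' = ct A ** R ** A"
  define S' where "S' = ct A ** S ** A"
  have uR': "upper R'" using stR by (simp add: stab_fl[OF iA] unitary_inv[OF un] R'_def)
  have RS: "R' = D - S'"
    using GA by (simp add: R'_def S'_def R_def matrix_diff_left matrix_diff_right unitary_inv[OF un])
  \<comment> \<open>\<open>S'\<close> equals \<open>D - R'\<close>, hence is upper triangular;
    coming from a real skew matrix it is also skew hermitian, so it is diagonal.\<close>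
  have S'0: "S' $ a $ b = 0" if ab: "a \<noteq> b" for a b
  proof -
    have l: "S' $ c $ d = 0" if "d < c" for c d
      using uR' that \<open>upper D\<close> unfolding upper_def RS by simp
    show ?thesis
    proof (cases "b < a")
      case False
      then have "a < b" using ab by auto
      then show ?thesis using l[of a b] sandwich_skew[OF S, of A a b] by (simp add: S'_def)
    qed (rule l)
  qed
  have R'0: "R' $ a $ b = 0" if "a \<noteq> b" for a b
    using that S'0[OF that] by (simp add: RS D_def)
  have R'n: "R' ** ct R' = ct R' ** R'"
    unfolding vec_eq_iff
  proof (intro allI)
    fix a b
    have "(R' ** ct R') $ a $ b = R' $ a $ a * ct R' $ a $ b"
      unfolding matrix_mult_nth by (rule mult_sum_nonzero_term) (simp add: R'0)
    moreover have "(ct R' ** R') $ a $ b = ct R' $ a $ a * R' $ a $ b"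
      unfolding matrix_mult_nth by (rule mult_sum_nonzero_term) (simp add: R'0)
    ultimately show "(R' ** ct R') $ a $ b = (ct R' ** R') $ a $ b"
      by (cases "a = b") (simp_all add: R'0 mult.commute)
  qed
  have RA: "R = A ** R' ** ct A"
  proof -
    have "A ** R' ** ct A = (A ** ct A) ** R ** (A ** ct A)" by (simp add: R'_def matrix_mul_assoc)
    then show ?thesis by (simp add: unitary_right[OF un])
  qed
  have ctR: "ct R = A ** ct R' ** ct A"
    unfolding RA by (simp add: ct_mult matrix_mul_assoc) (simp add: vec_eq_iff matrix_mult_nth)
  have c1: "A ** M ** ct A ** (A ** M' ** ct A) = A ** (M ** M') ** ct A" for M M' :: "'n cmat"
  proof -
    have "A ** M ** ct A ** (A ** M' ** ct A) = A ** M ** (ct A ** A) ** M' ** ct A"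
      by (simp add: matrix_mul_assoc)
    then show ?thesis by (simp add: un[unfolded unitary_def] matrix_mul_assoc)
  qed
  have "R ** ct R = A ** (R' ** ct R') ** ct A" unfolding ctR by (subst RA) (rule c1)
  also have "\<dots> = ct R ** R" unfolding R'n ctR by (subst RA) (rule c1[symmetric])
  finally have nR: "R ** ct R = ct R ** R" .
  \<comment> \<open>Above the diagonal \<open>R\<close> is twice the symmetric matrix
    \<open>G\<close>.\<close>
  have off: "G $ a $ b = 0" if "a < b" for a b
  proof -
    have "R $ a $ b = 0" using that by (intro upper_normal_diagonal[OF uR nR]) auto
    moreover have "R $ a $ b = G $ a $ b + G $ b $ a"
      using that by (auto simp: R_def S_def transpose_def)
    ultimately show ?thesis using Gsym[of a b] by simp
  qed
  have "G $ p $ q = 0" using off[of p q] off[of q p] pq Gsym[of p q] by (metis linorder_neqE)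
  then show ?thesis by (simp add: G)
qed

text \<open>The hypotheses are orthogonality relations in the real plane of complex numbers, which
  has room for only two nonzero pairwise orthogonal vectors.\<close>

lemma three_pairwise_orthogonal:
  assumes "Re (a * cnj b) = 0" "Re (a * cnj c) = 0" "Re (b * cnj c) = 0" "a \<noteq> 0" "b \<noteq> 0"
  shows "c = 0"
proof -
  have "(Im b * Re c - Re b * Im c) * (Re a * Re a + Im a * Im a) = 0"
    using assms(1,2) by simp algebra
  moreover have "Re a * Re a + Im a * Im a \<noteq> 0"
    using assms(4) by (simp add: complex_eq_iff sum_squares_eq_zero_iff)
  ultimately have "Im b * Re c - Re b * Im c = 0" by (metis mult_eq_0_iff)
  then have "b * cnj c = 0" using assms(3) by (simp add: complex_eq_iff)
  then show ?thesis using assms(5) by simp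
qed

lemma sum_two_terms:
  assumes "p \<noteq> q" "\<And>x. x \<noteq> p \<Longrightarrow> x \<noteq> q \<Longrightarrow> f x = (0::complex)"
  shows "(\<Sum>x\<in>(UNIV :: 'n::finite set). f x) = f p + f q"
proof -
  have "(\<Sum>x\<in>UNIV. f x) = (\<Sum>x\<in>{p, q}. f x)" using assms(2) by (intro sum.mono_neutral_right) auto
  then show ?thesis using assms(1) by simp
qed

lemma sign_ratio:
  assumes "a * a + b * b = (0::complex)" "a \<noteq> 0"
  shows "\<exists>s\<in>{\<i>, - \<i>}. b = s * a"
proof -
  have "(b / a)\<^sup>2 = -1"
    using assms by (simp add: power2_eq_square field_simps eq_neg_iff_add_eq_0)
  then have "(b / a)\<^sup>2 = \<i>\<^sup>2" by simp
  then have "b / a \<in> {\<i>, - \<i>}" by (simp only: power2_eq_iff) auto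
  then show ?thesis using assms(2) by (intro bexI[of _ "b / a"]) auto
qed

text \<open>The pair \<open>(c, d)\<close> is annihilated by \<open>(1, s)\<close> and by its
  conjugate, which are independent because \<open>s\<close> is not real.\<close>

lemma sign_pair_kernel:
  assumes "cnj a * c + cnj (s * a) * d = 0" "a * c + s * a * d = 0" "s \<in> {\<i>, - \<i>}" "a \<noteq> 0"
  shows "c = 0" "d = 0"
proof -
  have "a * (c + s * d) = 0" using assms(2) by (simp add: algebra_simps)
  then have f1: "c + s * d = 0" using assms(4) by simp
  have "cnj a * (c + cnj s * d) = 0" using assms(1) by (simp add: algebra_simps)
  then have f2: "c + cnj s * d = 0" using assms(4) by simp
  have "cnj s = - s" using assms(3) by auto
  then have "s * d = - (s * d)" using f1 f2 by (metis add_left_cancel mult_minus_left)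
  then show d: "d = 0" using assms(3) by auto
  show "c = 0" using f1 d by simp
qed

text \<open>The vanishing off-diagonal entries of the projection make the entries of column
  \<open>y\<close> pairwise orthogonal in the real plane of complex numbers, so at most two are
  nonzero. Isotropy of the column then makes them exactly two, with ratio \<open>\<i>\<close> or
  \<open>- \<i>\<close>.\<close>

lemma transversal_column:
  fixes A :: "'n::{finite,wellorder} cmat"
  assumes A: "iso_frame A"
    and tr: "transversal_flag (fl A)"
    and y: "y \<noteq> rho y"
  shows "\<exists>p q s. q < p \<and> s \<in> {\<i>, - \<i>} \<and> A $ p $ y \<noteq> 0 \<and> A $ q $ y = s * A $ p $ y \<and>
    (\<forall>x. x \<noteq> p \<longrightarrow> x \<noteq> q \<longrightarrow> A $ x $ y = 0) \<and>
    (\<forall>z. z \<noteq> y \<longrightarrow> z \<noteq> rho y \<longrightarrow> A $ p $ z = 0 \<and> A $ q $ z = 0)"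
proof -
  note un = iso_frame_unitary[OF A]
  have orth: "Re (A $ p $ y * cnj (A $ q $ y)) = 0" if "p \<noteq> q" for p q
  proof -
    have "Re (A $ p $ y * cnj (A $ q $ y) + cnj (A $ p $ y) * A $ q $ y) = 0"
      by (simp only: transversal_projection_diagonal[OF A tr y that] zero_complex.sel)
    then show ?thesis by simp
  qed
  have one: "(\<Sum>z\<in>UNIV. cnj (A $ z $ y) * A $ z $ y) = 1" using un by (simp add: unitary_columns)
  have iso: "(\<Sum>z\<in>UNIV. A $ z $ y * A $ z $ y) = 0"
  proof -
    have "(\<Sum>z\<in>UNIV. cnj (A $ z $ rho y) * A $ z $ y) = 0" using un y by (simp add: unitary_columns)
    then show ?thesis by (simp add: iso_frame_cnj[OF A])
  qed
  obtain a where a: "A $ a $ y \<noteq> 0" using one by force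
  have "\<exists>b. b \<noteq> a \<and> A $ b $ y \<noteq> 0"
  proof (rule ccontr)
    assume "\<nexists>b. b \<noteq> a \<and> A $ b $ y \<noteq> 0"
    then have "(\<Sum>z\<in>UNIV. A $ z $ y * A $ z $ y) = A $ a $ y * A $ a $ y"
      by (intro mult_sum_nonzero_term) auto
    then show False using a iso by simp
  qed
  then obtain b where b: "b \<noteq> a" "A $ b $ y \<noteq> 0" by blast
  have oth: "A $ x $ y = 0" if "x \<noteq> a" "x \<noteq> b" for x
    by (rule three_pairwise_orthogonal[of "A $ a $ y" "A $ b $ y"]) (use orth a b that in auto)
  define p where "p = max a b"
  define q where "q = min a b"
  have qp: "q < p" using b(1) by (auto simp: p_def q_def min_def max_def)
  have nz: "A $ p $ y \<noteq> 0" "A $ q $ y \<noteq> 0" using a b by (auto simp: p_def q_def min_def max_def)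
  have oth': "A $ x $ y = 0" if "x \<noteq> p" "x \<noteq> q" for x
    using that oth[of x] by (auto simp: p_def q_def min_def max_def split: if_splits)
  have "A $ p $ y * A $ p $ y + A $ q $ y * A $ q $ y = 0"
    using sum_two_terms[of p q "\<lambda>z. A $ z $ y * A $ z $ y"] iso oth' qp by auto
  then obtain s where s: "s \<in> {\<i>, - \<i>}" "A $ q $ y = s * A $ p $ y"
    using sign_ratio nz(1) by blast
  \<comment> \<open>Any other column is orthogonal to column \<open>y\<close> and to its conjugate,
    which together span the coordinate plane of \<open>p\<close> and \<open>q\<close>.\<close>
  have dis: "A $ p $ z = 0 \<and> A $ q $ z = 0" if z: "z \<noteq> y" "z \<noteq> rho y" for z
  proof -
    have "(\<Sum>x\<in>UNIV. cnj (A $ x $ y) * A $ x $ z) = 0" "(\<Sum>x\<in>UNIV. cnj (A $ x $ rho y) * A $ x $ z) = 0"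
      using un z by (simp_all add: unitary_columns)
    then have "cnj (A $ p $ y) * A $ p $ z + cnj (s * A $ p $ y) * A $ q $ z = 0"
      "A $ p $ y * A $ p $ z + s * A $ p $ y * A $ q $ z = 0"
      using sum_two_terms[of p q "\<lambda>x. cnj (A $ x $ y) * A $ x $ z"] sum_two_terms[of p q "\<lambda>x. A $ x $ y * A $ x $ z"]
        oth' qp by (auto simp: iso_frame_cnj[OF A] s(2))
    from sign_pair_kernel[OF this s(1) nz(1)] show ?thesis by blast
  qed
  show ?thesis
    using qp s nz oth' dis by (intro exI[of _ p] exI[of _ q] exI[of _ s]) auto
qed

text \<open>The inverse of \<open>b\<close> is triangular with nonzero diagonal, so it preserves the
  last nonzero coordinate of \<open>v\<close>; in a coordinate subspace that coordinate is one of
  the spanning indices.\<close>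

lemma lead_in_cell:
  assumes w: "w permutes {1..CARD('n)}" and b: "b \<in> Borel_subgroup"
    and v: "v \<in> flag_act b (coordinate_flag w) i" "v $ x \<noteq> 0" "\<And>z. x < z \<Longrightarrow> v $ z = 0"
  shows "x \<in> wperm w ` {z :: 'n::{finite,wellorder}. rk z < i}"
proof -
  have ib: "invertible b" and ub: "upper b" using b by (auto simp: Borel_invertible Borel_iff)
  obtain u where u: "u \<in> coordinate_flag w i" "v = b *v u" using v(1) by (auto simp: flag_act_def)
  have u': "u = matrix_inv b *v v" by (simp add: u matrix_vector_mul_assoc matrix_inv_left[OF ib])
  have ui: "upper (matrix_inv b)" by (rule upper_matrix_inv[OF ub ib])
  have "det (matrix_inv b) \<noteq> 0" using invertible_matrix_inv[OF ib] by (simp add: invertible_det_nz)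
  moreover have "det (matrix_inv b) = (\<Prod>i\<in>UNIV. matrix_inv b $ i $ i)"
    using ui by (intro det_upperdiagonal) (auto simp: upper_def)
  ultimately have "matrix_inv b $ x $ x \<noteq> 0" by auto
  moreover have "u $ x = matrix_inv b $ x $ x * v $ x"
    unfolding u' matrix_vector_nth
  proof (rule mult_sum_nonzero_term)
    fix c assume "c \<noteq> x"
    then have "c < x \<or> x < c" by auto
    then show "matrix_inv b $ x $ c * v $ c = 0" using ui v(3) by (auto simp: upper_def)
  qed
  ultimately have "u $ x \<noteq> 0" using v(2) by simp
  then show ?thesis using u(1) unfolding coordinate_flag_wperm by blast
qed

text \<open>For \<open>y\<close> in position \<open>i \<le> m\<close>, \<open>wperm w y\<close> is the index \<open>k\<^sub>i\<close> and \<open>wperm w (rho y)\<close> the index \<open>l\<^sub>i\<close>.\<close>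

definition paired :: "(nat \<Rightarrow> nat) \<Rightarrow> 'n::{finite,wellorder} cmat \<Rightarrow> bool" where
  "paired w A \<longleftrightarrow> (\<forall>y. y < rho y \<longrightarrow> wperm w (rho y) < wperm w y \<and> A $ wperm w y $ y \<noteq> 0 \<and>
     (\<exists>s\<in>{\<i>, - \<i>}. A $ wperm w (rho y) $ y = s * A $ wperm w y $ y) \<and>
     (\<forall>x. x \<noteq> wperm w y \<longrightarrow> x \<noteq> wperm w (rho y) \<longrightarrow> A $ x $ y = 0))"

lemma transversal_paired:
  fixes A :: "'n::{finite,wellorder} cmat"
  assumes A: "iso_frame A"
    and tr: "transversal_flag (fl A)"
    and w: "w permutes {1..CARD('n)}"
    and cell: "fl A \<in> flag_orbit Borel_subgroup (coordinate_flag w)"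
  shows "paired w A"
proof -
  note un = iso_frame_unitary[OF A]
  have bij: "bij (wperm w :: 'n \<Rightarrow> 'n)" by (rule wperm_bij[OF w])
  obtain b where b: "b \<in> Borel_subgroup" "fl A = flag_act b (coordinate_flag w)"
    using cell by (auto simp: flag_orbit_def)
  have ub: "upper b" using b by (simp add: Borel_iff)
  have "\<forall>y. \<exists>p q s. y \<noteq> rho y \<longrightarrow> q < p \<and> s \<in> {\<i>, - \<i>} \<and> A $ p $ y \<noteq> 0 \<and> A $ q $ y = s * A $ p $ y \<and>
    (\<forall>x. x \<noteq> p \<longrightarrow> x \<noteq> q \<longrightarrow> A $ x $ y = 0) \<and>
    (\<forall>z. z \<noteq> y \<longrightarrow> z \<noteq> rho y \<longrightarrow> A $ p $ z = 0 \<and> A $ q $ z = 0)"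
    using transversal_column[OF A tr] by blast
  then obtain P Q s where PQ: "\<And>y. y \<noteq> rho y \<Longrightarrow> Q y < P y \<and> s y \<in> {\<i>, - \<i>} \<and> A $ P y $ y \<noteq> 0 \<and> A $ Q y $ y = s y * A $ P y $ y \<and>
    (\<forall>x. x \<noteq> P y \<longrightarrow> x \<noteq> Q y \<longrightarrow> A $ x $ y = 0) \<and>
    (\<forall>z. z \<noteq> y \<longrightarrow> z \<noteq> rho y \<longrightarrow> A $ P y $ z = 0 \<and> A $ Q y $ z = 0)"
    by metis
  have half: "z < rho z" if "z < y" "y < rho y" for y z :: 'n
    using that rho_less_iff[of y z] by (meson order.strict_trans)
  have Qnz: "A $ Q y $ y \<noteq> 0" if "y \<noteq> rho y" for y using PQ[OF that] by auto
  \<comment> \<open>The last nonzero entry of column \<open>y\<close> sits at \<open>P y\<close>,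
    which is therefore a value of \<open>wperm w\<close> at a position up to \<open>y\<close>. The
    earlier values are excluded, since row \<open>P z\<close> vanishes in column \<open>y\<close>
    for \<open>z < y\<close>.\<close>
  have P: "P y = wperm w y" if "y < rho y" for y
    using that
  proof (induction y rule: less_induct)
    case (less y)
    have ny: "y \<noteq> rho y" using less.prems by auto
    have "P y \<in> wperm w ` {z. rk z < Suc (rk y)}"
    proof (rule lead_in_cell[OF w b(1)])
      show "A *v axis y 1 \<in> flag_act b (coordinate_flag w) (Suc (rk y))"
        using axis_std_space[of y] by (auto simp: fl_nth simp flip: b(2))
      show "(A *v axis y 1) $ P y \<noteq> 0" using PQ[OF ny] by simp
      fix z assume "P y < z"
      then show "(A *v axis y 1) $ z = 0" using PQ[OF ny] by auto
    qed
    then obtain z where z: "rk z \<le> rk y" "P y = wperm w z" by (auto simp: less_Suc_eq_le)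
    show ?case
    proof (cases "z = y")
      case False
      then have zy: "z < y" using z(1) rk_le_iff[of z y] by auto
      then have hz: "z < rho z" using half less.prems by blast
      then have "P y = P z" using less.IH[OF zy hz] z by simp
      moreover have "A $ P z $ y = 0"
      proof -
        have "y \<noteq> rho z" using zy less.prems rho_less_iff[of y z] by auto
        then show ?thesis using PQ[of z] hz zy by auto
      qed
      ultimately show ?thesis using PQ[OF ny] by auto
    qed (use z in simp)
  qed
  have Q: "Q y = wperm w (rho y)" if "y < rho y" for y
    using that
  proof (induction y rule: less_induct)
    case (less y)
    have ny: "y \<noteq> rho y" using less.prems by auto
    obtain z where z: "Q y = wperm w z" using bij by (metis bij_pointE)
    \<comment> \<open>If \<open>Q y\<close> came before position \<open>rho y\<close>, the vector
      \<open>v\<close> would lie in the member of the flag that is orthogonal to column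
      \<open>y\<close> under the bilinear form. But \<open>v\<close> has no entries beyond
      \<open>Q y\<close>, so only the nonzero term at \<open>Q y\<close> survives.\<close>
    have "\<not> z < rho y"
    proof
      assume "z < rho y"
      define v where "v = b *v axis (Q y) 1"
      have "axis (Q y) 1 \<in> coordinate_flag w (rk (rho y))"
        using \<open>z < rho y\<close> by (auto simp: coordinate_flag_wperm z axis_def rk_less_iff)
      then have "v \<in> fl A (rk (rho y))" unfolding b(2) v_def flag_act_def by blast
      then have "matrix_inv A *v v \<in> std_space (rk (rho y))"
        by (simp add: mem_fl_iff[OF unitary_invertible[OF un]])
      then have "(ct A *v v) $ rho y = 0" by (auto simp: std_space_def unitary_inv[OF un])
      then have "(\<Sum>x\<in>UNIV. A $ x $ y * v $ x) = 0"
        by (simp add: matrix_vector_nth iso_frame_cnj[OF A])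
      moreover have "(\<Sum>x\<in>UNIV. A $ x $ y * v $ x) = A $ Q y $ y * v $ Q y"
      proof (rule mult_sum_nonzero_term)
        fix x assume x: "x \<noteq> Q y"
        show "A $ x $ y * v $ x = 0"
        proof (cases "x = P y")
          case True
          then have "v $ x = 0" using PQ[OF ny] ub by (auto simp: v_def upper_def)
          then show ?thesis by simp
        qed (use x PQ[OF ny] in auto)
      qed
      moreover have "v $ Q y \<noteq> 0"
      proof -
        have "det b = (\<Prod>i\<in>UNIV. b $ i $ i)" using ub by (intro det_upperdiagonal) (auto simp: upper_def)
        then have "(\<Prod>i\<in>UNIV. b $ i $ i) \<noteq> 0" using b(1) by (simp add: Borel_iff)
        then show ?thesis by (simp add: v_def)
      qed
      ultimately show False using Qnz[OF ny] by simp
    qed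
    show ?case
    proof (cases "z = rho y")
      case False
      then have "rho y < z" using \<open>\<not> z < rho y\<close> by auto
      then have zy: "rho z < y" using rho_less_iff[of z "rho y"] rho_less_iff[of "rho y" z] by (metis rho_less_iff rho_rho)
      then have hz: "rho z < rho (rho z)" using half less.prems by blast
      have "Q (rho z) = wperm w z" using less.IH[OF zy hz] by simp
      then have e: "Q y = Q (rho z)" using z by simp
      have "y \<noteq> rho (rho z)" using zy less.prems rho_less_iff[of y "rho z"] by auto
      then have "A $ Q (rho z) $ y = 0" using PQ[of "rho z"] hz zy by auto
      then show ?thesis using Qnz[OF ny] e by simp
    qed (use z in simp)
  qed
  show ?thesis unfolding paired_def
  proof (intro allI impI)
    fix y :: 'n assume y: "y < rho y"
    then have "y \<noteq> rho y" by auto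
    from PQ[OF this] show "wperm w (rho y) < wperm w y \<and> A $ wperm w y $ y \<noteq> 0 \<and>
     (\<exists>s\<in>{\<i>, - \<i>}. A $ wperm w (rho y) $ y = s * A $ wperm w y $ y) \<and>
     (\<forall>x. x \<noteq> wperm w y \<longrightarrow> x \<noteq> wperm w (rho y) \<longrightarrow> A $ x $ y = 0)"
      unfolding P[OF y] Q[OF y] by blast
  qed
qed

text \<open>If \<open>x\<close> lay strictly between \<open>l = wperm w (rho y)\<close> and \<open>k = wperm w y\<close>, the rotation generator
  in the plane of \<open>x\<close> and \<open>k\<close> would agree at the flag with a triangular matrix moving the flag.\<close>

lemma transversal_adjacent:
  fixes A :: "'n::{finite,wellorder} cmat" and y z :: 'n
  assumes A: "invertible A" and pr: "paired w A"
    and tr: "transversal_flag (fl A)"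
    and w: "w permutes {1..CARD('n)}"
    and y: "y < rho y" and z: "y < z" "z < rho y"
    and l: "wperm w (rho y) < wperm w z" and k: "wperm w z < wperm w y"
  shows False
proof -
  have bij: "bij (wperm w :: 'n \<Rightarrow> 'n)" by (rule wperm_bij[OF w])
  define x where "x = wperm w z"
  define k where "k = wperm w y"
  define l where "l = wperm w (rho y)"
  have lx: "l < x" "x < k" using l k by (auto simp: x_def k_def l_def)
  obtain s where s: "s \<in> {\<i>, - \<i>}" "A $ l $ y = s * A $ k $ y" and nz: "A $ k $ y \<noteq> 0"
    and oth: "\<And>x. x \<noteq> k \<Longrightarrow> x \<noteq> l \<Longrightarrow> A $ x $ y = 0"
    using pr y unfolding paired_def k_def l_def by blast
  \<comment> \<open>The position \<open>z\<close> of \<open>x\<close> lies strictly between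
    \<open>y\<close> and \<open>rho y\<close>, so none of the pairs up to stage \<open>y\<close>
    uses the index \<open>x\<close>.\<close>
  have Ax: "A $ x $ y' = 0" if y': "y' \<le> y" for y'
  proof -
    have h: "y' < rho y'" using y' y rho_less_iff[of y y'] by (metis dual_order.strict_trans order_le_less)
    have "y' < z" "z < rho y'" using y' z rho_less_iff[of y y'] by (auto simp: order_le_less)
    then have "x \<noteq> wperm w y'" "x \<noteq> wperm w (rho y')" using bij by (auto simp: x_def bij_def inj_eq)
    then show ?thesis using pr h unfolding paired_def by blast
  qed
  have flx: "v $ x = 0" if v: "v \<in> fl A i" and i: "i \<le> Suc (rk y)" for v i
  proof -
    obtain u where u: "u \<in> std_space i" "v = A *v u" using v by (auto simp: fl_nth)
    have "A $ x $ y' * u $ y' = 0" for y'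
    proof (cases "y' \<le> y")
      case False
      then have "i \<le> rk y'" using i rk_less_iff[of y y'] by auto
      then show ?thesis using u by (auto simp: std_space_def)
    qed (simp add: Ax)
    then show ?thesis unfolding u(2) matrix_vector_nth by (intro sum.neutral) blast
  qed
  have fy: "A *v axis y 1 \<in> fl A (Suc (rk y))" using axis_std_space[of y] by (auto simp: fl_nth)
  \<comment> \<open>As \<open>s\<close> is the ratio of the two entries of column \<open>y\<close>,
    the difference \<open>X - Y\<close> sends \<open>v\<close> to a multiple of that column with
    coefficient proportional to \<open>v $ x\<close>; a member of the flag either contains the
    column or has \<open>v $ x = 0\<close> throughout. The order \<open>l < x < k\<close> makes
    \<open>X\<close> triangular.\<close>
  define X :: "'n cmat" where "X = unit_mat x k + cscale s (unit_mat l x)"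
  define Y :: "'n cmat" where "Y = unit_mat x k - unit_mat k x"
  have "upper X" using lx by (auto simp: X_def upper_def unit_mat_nth)
  moreover have "transpose Y = - Y" by (auto simp: Y_def vec_eq_iff transpose_def unit_mat_nth)
  moreover have "stab (fl A) (X - Y)"
    unfolding stab_def
  proof (intro allI ballI)
    fix i v assume v: "v \<in> fl A i"
    have "(X - Y) *v v = v $ x *s ((1 / A $ k $ y) *s (A *v axis y 1))"
      unfolding vec_eq_iff
    proof
      fix a
      have "((X - Y) *v v) $ a = (X - Y) $ a $ x * v $ x"
        unfolding matrix_vector_nth by (rule mult_sum_nonzero_term) (auto simp: X_def Y_def unit_mat_nth)
      also have "(X - Y) $ a $ x = A $ a $ y / A $ k $ y"
        using lx nz s oth[of a] by (auto simp: X_def Y_def unit_mat_nth)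
      finally show "((X - Y) *v v) $ a = (v $ x *s ((1 / A $ k $ y) *s (A *v axis y 1))) $ a"
        by (simp add: field_simps)
    qed
    moreover have "v $ x *s ((1 / A $ k $ y) *s (A *v axis y 1)) \<in> fl A i"
    proof (cases "i \<le> Suc (rk y)")
      case True
      then show ?thesis using flx[OF v] by (simp add: vec.subspace_0)
    next
      case False
      then have "std_space (Suc (rk y)) \<subseteq> (std_space i :: 'n cvec set)" by (auto simp: std_space_def)
      then have "A *v axis y 1 \<in> fl A i" using fy by (auto simp: fl_nth)
      then show ?thesis by (simp add: vec.subspace_scale)
    qed
    ultimately show "(X - Y) *v v \<in> fl A i" by simp
  qed
  ultimately have "stab (fl A) X" by (rule transversal_flagD[OF tr])
  then have "X *v (A *v axis y 1) \<in> fl A (Suc (rk y))" using fy by (simp add: stab_def)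
  then have "(X *v (A *v axis y 1)) $ x = 0" using flx by blast
  moreover have "(X *v (A *v axis y 1)) $ x = A $ k $ y"
    unfolding matrix_vector_nth[of X] using lx
    by (subst mult_sum_nonzero_term[of k]) (auto simp: X_def unit_mat_nth)
  ultimately show False using nz by simp
qed

section \<open>Intersections of Schubert varieties with the base cycle\<close>

lemma real_unitary: "real_mat A \<Longrightarrow> ct A = transpose A"
  by (simp add: vec_eq_iff transpose_def real_mat_def Reals_cnj_iff)

lemma SL_real_iff: "g \<in> SL_real \<longleftrightarrow> det g = 1 \<and> real_mat g"
  by (auto simp: SL_real_def SL_complex_def real_mat_def)

lemma det_matrix_inv: "invertible (A :: 'n::finite cmat) \<Longrightarrow> det A * det (matrix_inv A) = 1"
  using arg_cong[OF matrix_inv_right, of A det] by (simp add: det_mul)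

lemma det_real_orthogonal:
  assumes "transpose A ** A = mat 1"
  shows "det (A :: 'n::finite cmat) = 1 \<or> det A = -1"
proof -
  have "det A * det A = 1" using arg_cong[OF assms, of det] by (simp add: det_mul)
  then show ?thesis by (metis power2_eq_1_iff power2_eq_square)
qed

text \<open>Gram-Schmidt applied to the inverse of \<open>h\<close> gives a real orthogonal matrix
  with the same flag. After a sign change of its first column, which corrects the determinant, its
  transpose is the compact factor.\<close>

lemma iwasawa_decomposition:
  fixes h :: "'n::{finite,wellorder} cmat"
  assumes h: "h \<in> SL_real"
  shows "\<exists>b k. b \<in> Borel_subgroup \<and> k \<in> SO_real \<and> h = b ** k"
proof -
  have dh: "det h = 1" and rh: "real_mat h" using h by (auto simp: SL_real_iff)
  have ih: "invertible h" using dh by (simp add: invertible_det_nz)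
  obtain Q where Q: "unitary Q" "fl Q = fl (matrix_inv h)" "real_mat Q"
    using gram_schmidt[OF invertible_matrix_inv[OF ih]] real_mat_inv[OF ih rh] by blast
  have tQ: "transpose Q ** Q = mat 1"
    using Q(1) by (simp add: unitary_def real_unitary[OF Q(3)])
  define d where "d = det Q"
  have d: "d = 1 \<or> d = -1" unfolding d_def by (rule det_real_orthogonal[OF tQ])
  define E :: "'n cmat" where "E = (\<chi> i j. if i = j then (if i = en 0 then d else 1) else 0)"
  have "det E = (\<Prod>i\<in>UNIV. E $ i $ i)" by (rule det_upperdiagonal) (auto simp: E_def)
  also have "\<dots> = d" by (simp add: E_def)
  finally have dE: "det E = d" .
  have EE: "transpose E ** E = mat 1" unfolding vec_eq_iff
  proof (intro allI)
    fix a b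
    have "(transpose E ** E) $ a $ b = transpose E $ a $ b * E $ b $ b"
      unfolding matrix_mult_nth by (rule mult_sum_nonzero_term) (simp add: E_def)
    then show "(transpose E ** E) $ a $ b = mat 1 $ a $ b"
      using d by (auto simp: E_def transpose_def mat_def)
  qed
  define k where "k = transpose (Q ** E)"
  have QE: "Q ** E \<in> SO_real" unfolding SO_real_iff
  proof (intro conjI)
    show "det (Q ** E) = 1" using d by (auto simp: det_mul dE simp flip: d_def)
    show "real_mat (Q ** E)" using d by (intro real_mat_mult Q) (auto simp: real_mat_def E_def)
    have "transpose (Q ** E) ** (Q ** E) = transpose E ** (transpose Q ** Q) ** E"
      by (simp add: matrix_transpose_mul matrix_mul_assoc)
    then show "transpose (Q ** E) ** (Q ** E) = mat 1" by (simp add: tQ EE)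
  qed
  then have k: "k \<in> SO_real" unfolding k_def by (rule SO_real_transpose)
  have iE: "invertible E" using d dE by (auto simp: invertible_det_nz)
  have fQE: "fl (Q ** E) = fl (matrix_inv h)"
    using fl_mult_upper[OF unitary_invertible[OF Q(1)] iE] Q(2) by (auto simp: upper_def E_def)
  define b where "b = h ** transpose k"
  have "upper (matrix_inv (matrix_inv h) ** (Q ** E))"
    using fl_eq_iff[OF invertible_matrix_inv[OF ih] SO_real_invertible[OF QE]] fQE by simp
  moreover have "matrix_inv (matrix_inv h) = h" by (rule matrix_inv_unique[OF matrix_inv_left[OF ih]])
  ultimately have "upper b" by (simp add: b_def k_def)
  moreover have "det b = 1" using k dh by (simp add: b_def det_mul SO_real_iff)
  moreover have "h = b ** k" using k by (simp add: b_def SO_real_iff flip: matrix_mul_assoc)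
  ultimately show ?thesis using k by (auto simp: Borel_iff)
qed

lemma SL_real_orbit:
  assumes "q \<in> flag_orbit SL_real F" "p \<in> flag_orbit SL_real F"
  shows "\<exists>h\<in>SL_real. q = flag_act h p"
proof -
  obtain g where g: "g \<in> SL_real" "q = flag_act g F" using assms(1) by (auto simp: flag_orbit_def)
  obtain g' where g': "g' \<in> SL_real" "p = flag_act g' F" using assms(2) by (auto simp: flag_orbit_def)
  have ig': "invertible g'" using g' by (simp add: SL_real_iff invertible_det_nz)
  have "q = flag_act (g ** matrix_inv g') p"
    by (simp add: g g' flag_act_mult matrix_inv_left[OF ig'] flip: matrix_mul_assoc)
  moreover have "g ** matrix_inv g' \<in> SL_real"
    using g g' det_matrix_inv[OF ig'] by (simp add: SL_real_iff det_mul real_mat_mult real_mat_inv[OF ig'])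
  ultimately show ?thesis by blast
qed

lemma cell_meets_orbit:
  fixes D C :: "'n::{finite,wellorder} flag set"
  assumes D: "flag_domain D" and F: "F \<in> D" and C: "C = flag_orbit SO_real F"
    and p: "p \<in> schubert_variety w" "p \<in> D"
  shows "\<exists>c\<in>C. c \<in> flag_orbit Borel_subgroup (coordinate_flag w)"
proof -
  obtain F0 where D0: "D = flag_orbit SL_real F0" and op: "openin flag_topology D"
    using D unfolding flag_domain_def by blast
  obtain q where q: "q \<in> flag_orbit Borel_subgroup (coordinate_flag w)" "q \<in> D"
    using p op unfolding schubert_variety_def in_closure_of by blast
  obtain h where h: "h \<in> SL_real" "q = flag_act h F"
    using SL_real_orbit q(2) F unfolding D0 by blast
  obtain b k where bk: "b \<in> Borel_subgroup" "k \<in> SO_real" "h = b ** k"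
    using iwasawa_decomposition[OF h(1)] by blast
  have ib: "invertible b" by (rule Borel_invertible[OF bk(1)])
  obtain b' where b': "b' \<in> Borel_subgroup" "q = flag_act b' (coordinate_flag w)"
    using q(1) by (auto simp: flag_orbit_def)
  have "flag_act k F = flag_act (matrix_inv b) q"
    by (simp add: h bk flag_act_mult matrix_inv_cancel_left[OF ib])
  also have "\<dots> = flag_act (matrix_inv b ** b') (coordinate_flag w)" by (simp add: b' flag_act_mult)
  finally have "flag_act k F = flag_act (matrix_inv b ** b') (coordinate_flag w)" .
  moreover have "matrix_inv b ** b' \<in> Borel_subgroup"
    using bk(1) b'(1) det_matrix_inv[OF ib] ib by (auto simp: Borel_iff det_mul upper_mult upper_matrix_inv)
  ultimately have "flag_act k F \<in> flag_orbit Borel_subgroup (coordinate_flag w)"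
    by (auto simp: flag_orbit_def)
  then show ?thesis using bk(2) by (auto simp: C flag_orbit_def)
qed

section \<open>Closed rank conditions on Schubert varieties\<close>

definition orthonormal_on :: "'n set \<Rightarrow> 'n::{finite,wellorder} cmat \<Rightarrow> bool" where
  "orthonormal_on I Q \<longleftrightarrow> (\<forall>x\<in>I. \<forall>y\<in>I. herm (Q $ x) (Q $ y) = (if x = y then 1 else 0)) \<and> (\<forall>x. x \<notin> I \<longrightarrow> Q $ x = 0)"

lemma exists_orthonormal:
  fixes V :: "'n::{finite,wellorder} cvec set"
  assumes V: "vec.subspace V" and I: "card I \<le> vec.dim V"
  shows "\<exists>Q. orthonormal_on I Q \<and> (\<forall>x\<in>I. Q $ x \<in> V)"
proof -
  have "\<exists>Q. orthonormal_on J Q \<and> (\<forall>x\<in>J. Q $ x \<in> V)" if "J \<subseteq> I" for J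
    using finite[of J] that
  proof (induction J rule: finite_induct)
    case empty
    show ?case by (intro exI[of _ 0]) (auto simp: orthonormal_on_def)
  next
    case (insert a J)
    then obtain Q where Q: "orthonormal_on J Q" "\<And>x. x \<in> J \<Longrightarrow> Q $ x \<in> V" by auto
    define W where "W = vec.span ((\<lambda>x. Q $ x) ` J)"
    have "vec.dim W \<le> card J"
      unfolding W_def vec.dim_span by (rule order_trans[OF vec.dim_le_card'[OF finite_imageI] card_image_le]) auto
    also have "card J < card I" using insert.prems insert.hyps
      by (metis card_mono card_insert_disjoint finite_code less_eq_Suc_le)
    finally have "vec.dim W < vec.dim V" using I by linarith
    then have "\<not> V \<subseteq> W" using vec.dim_subset[of V W] by linarith
    then obtain v where v: "v \<in> V" "v \<notin> W" by blast
    obtain u where u: "u \<in> V" "herm u u = 1" "\<And>y. y \<in> J \<Longrightarrow> herm u (Q $ y) = 0"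
    proof -
      have "(\<lambda>x. Q $ x) ` J \<subseteq> V" using Q(2) by auto
      moreover have "herm (Q $ y) (Q $ z) = (if y = z then 1 else 0)" if "y \<in> J" "z \<in> J" for y z
        using Q(1) that unfolding orthonormal_on_def by blast
      moreover have "vec.subspace W" "(\<lambda>x. Q $ x) ` J \<subseteq> W"
        unfolding W_def by (auto simp: vec.span_base)
      ultimately have "\<exists>u\<in>V. herm u u = 1 \<and> (\<forall>y\<in>J. herm u (Q $ y) = 0)"
        using gram_schmidt_step[of J "\<lambda>x. Q $ x" V v W] v V by blast
      then show thesis using that by blast
    qed
    have u': "herm (Q $ y) u = 0" if "y \<in> J" for y using u(3)[OF that] herm_swap[of "Q $ y" u] by simp
    define Q' :: "'n cmat" where "Q' = (\<chi> x. if x = a then u else Q $ x)"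
    have Q'nth: "Q' $ x = (if x = a then u else Q $ x)" for x by (simp add: Q'_def)
    have "orthonormal_on (insert a J) Q'"
      using Q(1) u u' insert.hyps unfolding orthonormal_on_def Q'nth by auto
    moreover have "\<forall>x\<in>insert a J. Q' $ x \<in> V" using Q(2) u(1) by (simp add: Q'nth)
    ultimately show ?case by blast
  qed
  then show ?thesis by blast
qed

lemma orthonormal_card_le_dim:
  fixes V :: "'n::{finite,wellorder} cvec set"
  assumes V: "vec.subspace V" and Q: "orthonormal_on I Q" "\<And>x. x \<in> I \<Longrightarrow> Q $ x \<in> V"
  shows "card I \<le> vec.dim V"
proof -
  have inj: "inj_on (\<lambda>x. Q $ x) I"
  proof (rule inj_onI)
    fix x y assume *: "x \<in> I" "y \<in> I" "Q $ x = Q $ y"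
    have "herm (Q $ x) (Q $ x) = 1" using Q(1) *(1) by (simp add: orthonormal_on_def)
    then have "herm (Q $ x) (Q $ y) = 1" by (simp only: *(3))
    moreover have "herm (Q $ x) (Q $ y) = (if x = y then 1 else 0)"
      using Q(1) *(1,2) unfolding orthonormal_on_def by blast
    ultimately show "x = y" by (simp split: if_splits)
  qed
  have "vec.independent ((\<lambda>x. Q $ x) ` I)"
    unfolding vec.dependent_finite[OF finite_imageI[OF finite]]
  proof clarify
    fix u x assume s: "(\<Sum>v\<in>($) Q ` I. u v *s v) = 0" and x: "x \<in> I" "u (Q $ x) \<noteq> 0"
    have "(\<Sum>z\<in>I. u (Q $ z) *s Q $ z) = 0" using s by (subst (asm) sum.reindex[OF inj]) simp
    then have "herm (\<Sum>z\<in>I. u (Q $ z) *s Q $ z) (Q $ x) = 0" by (simp add: herm_def)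
    then have "(\<Sum>z\<in>I. u (Q $ z) * herm (Q $ z) (Q $ x)) = 0" by (simp add: herm_sum_left)
    moreover have "(\<Sum>z\<in>I. u (Q $ z) * herm (Q $ z) (Q $ x)) = (\<Sum>z\<in>I. if z = x then u (Q $ x) else 0)"
      using Q(1) x(1) by (intro sum.cong) (auto simp: orthonormal_on_def)
    ultimately show False using x by simp
  qed
  then have "card ((\<lambda>x. Q $ x) ` I) \<le> vec.dim V"
    using Q(2) by (intro vec.independent_card_le_dim) auto
  then show ?thesis by (simp add: card_image[OF inj])
qed

text \<open>In \<open>orthonormal_on\<close> the rows outside \<open>I\<close> are pinned to 0, so
  that systems indexed by \<open>I\<close> form a bounded set of matrices.\<close>

lemma compact_orthonormal: "compact {Q :: 'n::{finite,wellorder} cmat. orthonormal_on I Q}"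
proof -
  have "closed {Q :: 'n cmat. orthonormal_on I Q}"
    unfolding orthonormal_on_def herm_def vec_eq_iff Ball_def
    by (intro closed_Collect_conj closed_Collect_all closed_Collect_imp closed_Collect_eq
        open_Collect_const continuous_intros)
  moreover have "bounded {Q :: 'n cmat. orthonormal_on I Q}"
  proof (rule boundedI)
    fix Q :: "'n cmat" assume "Q \<in> {Q. orthonormal_on I Q}"
    then have Q: "orthonormal_on I Q" by simp
    show "norm Q \<le> real CARD('n) * real CARD('n)"
    proof (rule norm_mat_le)
      fix i j
      have "norm (Q $ i) \<le> 1"
      proof (cases "i \<in> I")
        case True
        then have "herm (Q $ i) (Q $ i) = 1" using Q by (simp add: orthonormal_on_def)
        then have "of_real ((norm (Q $ i))\<^sup>2) = (1::complex)" by (simp only: herm_self)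
        then have "(norm (Q $ i))\<^sup>2 = 1" using of_real_eq_1_iff by blast
        then show ?thesis by (simp add: abs_square_eq_1)
      qed (use Q in \<open>simp add: orthonormal_on_def\<close>)
      then show "cmod (Q $ i $ j) \<le> 1" using order_trans[OF Finite_Cartesian_Product.norm_nth_le] by blast
    qed
  qed
  ultimately show ?thesis by (simp add: compact_eq_bounded_closed)
qed

text \<open>A closed set is projected along the compact factor of orthonormal systems, so the
  existential quantifier preserves closedness.\<close>

lemma closed_rank_condition:
  "closed {g :: 'n::{finite,wellorder} cmat. \<exists>Q. orthonormal_on I Q \<and>
     (\<forall>x\<in>I. Q $ x \<in> std_space i \<and> g *v Q $ x \<in> std_space j)}"
proof -
  have "closed {(Q, g :: 'n cmat). \<forall>x\<in>I. Q $ x \<in> std_space i \<and> g *v Q $ x \<in> std_space j}"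
    unfolding std_space_def matrix_vector_mult_def mem_Collect_eq Ball_def case_prod_beta vec_lambda_beta
    by (intro closed_Collect_conj closed_Collect_all closed_Collect_imp closed_Collect_eq
        open_Collect_const continuous_intros)
  from closed_compact_projection[OF compact_orthonormal[of I] this]
  show ?thesis by simp
qed

lemma coordinate_flag_rank:
  fixes F :: "'n::{finite,wellorder} flag"
  assumes F: "F \<in> flag_orbit Borel_subgroup (coordinate_flag w)"
  shows "vec.dim (F i \<inter> std_space j) = card {x \<in> wperm w ` {z :: 'n. rk z < i}. rk x < j}"
proof -
  obtain b where b: "b \<in> Borel_subgroup" "F = flag_act b (coordinate_flag w)"
    using F by (auto simp: flag_orbit_def)
  have ib: "invertible b" and ub: "upper b" using b by (auto simp: Borel_invertible Borel_iff)
  have "F i \<inter> std_space j = (*v) b ` (coordinate_flag w i \<inter> std_space j)"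
    unfolding b(2) flag_act_def image_Int[OF invertible_inj[OF ib]] upper_image_std_space[OF ub ib] ..
  also have "vec.dim \<dots> = vec.dim (coordinate_flag w i \<inter> std_space j :: 'n cvec set)"
    by (rule vec.dim_image_eq) (use invertible_inj[OF ib] in \<open>auto intro: inj_on_subset\<close>)
  also have "coordinate_flag w i \<inter> std_space j
      = {v :: 'n cvec. \<forall>x. x \<notin> {x \<in> wperm w ` {z. rk z < i}. rk x < j} \<longrightarrow> v $ x = 0}"
    unfolding coordinate_flag_wperm std_space_def by (auto simp: not_less)
  finally show ?thesis by (simp only: dim_substandard_cart)
qed

text \<open>The dimension of the intersection with a fixed subspace can only jump up in a limit:
  flags obeying the bound form a closed set, and on the cell there is equality.\<close>

lemma schubert_rank:
  fixes F :: "'n::{finite,wellorder} flag"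
  assumes w: "w permutes {1..CARD('n)}" and F: "F \<in> schubert_variety w"
  shows "card {x \<in> wperm w ` {z :: 'n. rk z < i}. rk x < j} \<le> vec.dim (F i \<inter> std_space j)"
proof -
  define I where "I = {x \<in> wperm w ` {z :: 'n. rk z < i}. rk x < j}"
  define K where "K = {F :: 'n flag. F \<in> flags \<and> card I \<le> vec.dim (F i \<inter> std_space j)}"
  define Z where "Z = {g :: 'n cmat. \<exists>Q. orthonormal_on I Q \<and>
     (\<forall>x\<in>I. Q $ x \<in> std_space i \<and> g *v Q $ x \<in> std_space j)}"
  have cZ: "closed Z" unfolding Z_def by (rule closed_rank_condition)
  have ZK: "fl g \<in> K \<longleftrightarrow> g \<in> Z" if g: "g \<in> SL_complex" for g
  proof -
    have ig: "invertible g" by (rule SL_complex_invertible[OF g])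
    define V where "V = {a \<in> std_space i. g *v a \<in> std_space j}"
    have sV: "vec.subspace V"
      unfolding V_def vec.subspace_def using subspace_std_space
      by (auto simp: vec.subspace_0 vec.subspace_add vec.subspace_scale matrix_vector_right_distrib
          vec.scale matrix_vector_mult_0_right)
    have "fl g i \<inter> std_space j = (*v) g ` V" by (auto simp: fl_nth V_def)
    moreover have "vec.dim ((*v) g ` V) = vec.dim V"
      by (rule vec.dim_image_eq) (use invertible_inj[OF ig] in \<open>auto intro: inj_on_subset\<close>)
    ultimately have "fl g \<in> K \<longleftrightarrow> card I \<le> vec.dim V" by (simp add: K_def fl_in_flags[OF ig])
    also have "\<dots> \<longleftrightarrow> g \<in> Z"
      using exists_orthonormal[OF sV, of I] orthonormal_card_le_dim[OF sV, of I]
      unfolding Z_def V_def by blast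
    finally show ?thesis .
  qed
  have "closedin flag_topology K"
    unfolding closedin_def topspace_flag_topology
  proof
    show "K \<subseteq> flags" by (auto simp: K_def)
    have "{g \<in> SL_complex. flag_act g (coordinate_flag id) \<in> flags - K} = SL_complex \<inter> - Z"
      using ZK fl_in_flags[OF SL_complex_invertible] by (auto simp: fl_def)
    then show "openin flag_topology (flags - K)"
      unfolding openin_flag_topology using cZ by (auto simp: openin_open open_Compl)
  qed
  moreover have "flag_orbit Borel_subgroup (coordinate_flag w) \<subseteq> K"
  proof
    fix G :: "'n flag" assume G: "G \<in> flag_orbit Borel_subgroup (coordinate_flag w)"
    then have "G \<in> flags"
      using schubert_cell_subset[OF w] closure_of_subset_topspace[of flag_topology]
      unfolding schubert_variety_def topspace_flag_topology by blast
    then show "G \<in> K" using coordinate_flag_rank[OF G, of i j] by (simp add: K_def I_def)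
  qed
  ultimately have "schubert_variety w \<subseteq> K"
    unfolding schubert_variety_def by (rule closure_of_minimal[rotated])
  then show ?thesis using F by (auto simp: K_def I_def)
qed

section \<open>Isotropic flags subject to the rank conditions\<close>

lemma dim_le_coordinates:
  fixes V :: "'n::finite cvec set"
  assumes V: "vec.subspace V" and J: "\<And>v. v \<in> V \<Longrightarrow> (\<And>x. x \<in> J \<Longrightarrow> v $ x = 0) \<Longrightarrow> v = 0"
  shows "vec.dim V \<le> card J"
proof -
  define P :: "'n cmat" where "P = (\<chi> x y. if x = y \<and> x \<in> J then 1 else 0)"
  have Pnth: "(P *v v) $ x = (if x \<in> J then v $ x else 0)" for v x
    unfolding matrix_vector_nth by (subst mult_sum_nonzero_term[of x]) (auto simp: P_def)
  have "inj_on ((*v) P) V"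
  proof (rule inj_onI)
    fix u v assume uv: "u \<in> V" "v \<in> V" "P *v u = P *v v"
    have "u - v = 0"
    proof (rule J)
      show "u - v \<in> V" by (rule vec.subspace_diff[OF V uv(1,2)])
      fix x assume "x \<in> J"
      then show "(u - v) $ x = 0" using arg_cong[OF uv(3), of "\<lambda>t. t $ x"] by (simp add: Pnth)
    qed
    then show "u = v" by simp
  qed
  then have "vec.dim V = vec.dim ((*v) P ` V)"
    by (intro vec.dim_image_eq[symmetric]) (simp_all add: vec.span_eq_iff[THEN iffD2, OF V])
  also have "\<dots> \<le> vec.dim {v :: 'n cvec. \<forall>x. x \<notin> J \<longrightarrow> v $ x = 0}"
    by (rule vec.dim_subset) (auto simp: Pnth)
  finally show ?thesis by (simp add: dim_substandard_cart)
qed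

lemma half_mono: "z < y \<Longrightarrow> y < rho y \<Longrightarrow> z < rho z" for y z :: "'n::{finite,wellorder}"
  using rho_less_iff[of y z] by (meson order.strict_trans)

text \<open>Induction over the pairs from the outside inwards. Entries of column \<open>y\<close> at
  indices of earlier pairs vanish by orthogonality, those beyond \<open>k\<close> or before
  \<open>l\<close> by rank conditions, those in between by \<open>adj\<close>; isotropy fixes the
  ratio of the remaining two.\<close>

lemma schubert_paired:
  fixes A :: "'n::{finite,wellorder} cmat"
  assumes A: "iso_frame A" and w: "w permutes {1..CARD('n)}" and F: "fl A \<in> schubert_variety w"
    and order: "\<And>y :: 'n. y < rho y \<Longrightarrow> wperm w (rho y) < wperm w y"
    and adj: "\<And>y z :: 'n. y < rho y \<Longrightarrow> y < z \<Longrightarrow> z < rho y \<Longrightarrow> wperm w (rho y) < wperm w z \<Longrightarrow> wperm w z < wperm w y \<Longrightarrow> False"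
  shows "paired w A"
proof -
  note un = iso_frame_unitary[OF A]
  note iA = unitary_invertible[OF un]
  have inj: "wperm w x = wperm w y \<longleftrightarrow> x = y" for x y :: 'n
    using wperm_bij[OF w] by (simp add: bij_def inj_eq)
  have surj: "\<exists>z. x = wperm w z" for x :: 'n using wperm_bij[OF w] by (metis bij_pointE)
  have col: "(\<Sum>z\<in>UNIV. cnj (A $ z $ a) * A $ z $ b) = (if a = b then 1 else 0)" for a b
    using un by (simp add: unitary_columns)
  have "\<exists>s\<in>{\<i>, - \<i>}. A $ wperm w y $ y \<noteq> 0 \<and> A $ wperm w (rho y) $ y = s * A $ wperm w y $ y \<and>
     (\<forall>x. x \<noteq> wperm w y \<longrightarrow> x \<noteq> wperm w (rho y) \<longrightarrow> A $ x $ y = 0)" if "y < rho y" for y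
    using that
  proof (induction y rule: less_induct)
    case (less y)
    define k where "k = wperm w y"
    define l where "l = wperm w (rho y)"
    have y: "y < rho y" by (rule less.prems)
    have lk: "l < k" using order[OF y] by (simp add: l_def k_def)
    have IHn: "A $ wperm w z $ z \<noteq> 0" and IH0: "x \<noteq> wperm w z \<Longrightarrow> x \<noteq> wperm w (rho z) \<Longrightarrow> A $ x $ z = 0"
      if "z < y" for x z using less.IH[OF that half_mono[OF that y]] by blast+
    have IHl: "A $ wperm w (rho z) $ z \<noteq> 0" if "z < y" for z
      using less.IH[OF that half_mono[OF that y]] by auto
    have rz: "rho y < rho z" if "z < y" for z using that by (simp add: rho_less_iff)
    have sup0: "A $ wperm w z $ y = 0" "A $ wperm w (rho z) $ y = 0" if z: "z < y" for z
    proof -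
      obtain s where s: "s \<in> {\<i>, - \<i>}" "A $ wperm w (rho z) $ z = s * A $ wperm w z $ z"
        using less.IH[OF z half_mono[OF z y]] by blast
      have ne: "wperm w z \<noteq> wperm w (rho z)" using half_mono[OF z y] by (auto simp: inj)
      have zy: "z \<noteq> y" "rho z \<noteq> y" using z y rz[OF z] by auto
      have "(\<Sum>x\<in>UNIV. cnj (A $ x $ z) * A $ x $ y) = 0" "(\<Sum>x\<in>UNIV. cnj (A $ x $ rho z) * A $ x $ y) = 0"
        using zy by (simp_all add: col)
      then have "cnj (A $ wperm w z $ z) * A $ wperm w z $ y + cnj (s * A $ wperm w z $ z) * A $ wperm w (rho z) $ y = 0"
        "A $ wperm w z $ z * A $ wperm w z $ y + s * A $ wperm w z $ z * A $ wperm w (rho z) $ y = 0"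
        using sum_two_terms[OF ne, of "\<lambda>x. cnj (A $ x $ z) * A $ x $ y"]
          sum_two_terms[OF ne, of "\<lambda>x. A $ x $ z * A $ x $ y"] IH0[OF z]
        by (auto simp: iso_frame_cnj[OF A] s(2))
      from sign_pair_kernel[OF this s(1) IHn[OF z]]
      show "A $ wperm w z $ y = 0" "A $ wperm w (rho z) $ y = 0" by auto
    qed
    have inner: "\<exists>z. x = wperm w z \<and> y \<le> z \<and> z \<le> rho y" if nz: "A $ x $ y \<noteq> 0" for x
    proof -
      obtain z where z: "x = wperm w z" using surj by blast
      have "\<not> z < y" using sup0(1) nz z by auto
      moreover have "\<not> rho y < z"
      proof
        assume "rho y < z"
        then have "rho z < y" using rho_less_iff[of z "rho y"] by simp
        then show False using sup0(2)[of "rho z"] nz z by simp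
      qed
      ultimately show ?thesis using z by (auto simp: not_less)
    qed
    \<comment> \<open>With a nonzero entry beyond \<open>k\<close>, the vectors of the member at
      \<open>y\<close> that end at \<open>k\<close> or earlier are determined by their coordinates
      in \<open>J\<close>; the rank condition demands one dimension more.\<close>
    have above: "A $ x $ y = 0" if kx: "k < x" for x
    proof (rule ccontr)
      assume nz: "A $ x $ y \<noteq> 0"
      obtain z0 where z0: "x = wperm w z0" "y \<le> z0" "z0 \<le> rho y" using inner[OF nz] by blast
      define J where "J = wperm w ` {z. z < y \<and> wperm w z \<le> k}"
      define V where "V = fl A (Suc (rk y)) \<inter> std_space (Suc (rk k))"
      have "vec.dim V \<le> card J"
      proof (rule dim_le_coordinates)
        show "vec.subspace V" unfolding V_def by (intro vec.subspace_inter) auto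
        fix v assume v: "v \<in> V" and vJ: "\<And>x. x \<in> J \<Longrightarrow> v $ x = 0"
        obtain u where u: "u \<in> std_space (Suc (rk y))" "v = A *v u" using v by (auto simp: V_def fl_nth)
        have u0: "u $ z = 0" if "y < z" for z
          using u(1) that by (auto simp: std_space_def Suc_le_eq rk_less_iff)
        have vk: "v $ z = 0" if "k < z" for z
          using v that by (auto simp: V_def std_space_def Suc_le_eq rk_less_iff)
        have "v $ x = A $ x $ y * u $ y"
          unfolding u(2) matrix_vector_nth
        proof (rule mult_sum_nonzero_term)
          fix z assume "z \<noteq> y"
          then have "z < y \<or> y < z" by auto
          then show "A $ x $ z * u $ z = 0"
          proof
            assume zy: "z < y"
            then have "x \<noteq> wperm w z" "x \<noteq> wperm w (rho z)" using z0 rz[OF zy] by (auto simp: inj)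
            then show ?thesis using IH0[OF zy] by simp
          qed (simp add: u0)
        qed
        then have uy: "u $ y = 0" using vk[OF kx] nz by simp
        have uz: "u $ z = 0" if zy: "z < y" for z
        proof -
          have "v $ wperm w z = A $ wperm w z $ z * u $ z"
            unfolding u(2) matrix_vector_nth
          proof (rule mult_sum_nonzero_term)
            fix c assume cz: "c \<noteq> z"
            show "A $ wperm w z $ c * u $ c = 0"
            proof (cases c y rule: linorder_cases)
              case less
              then have "z \<noteq> rho c" using zy y rz[of c] by auto
              then show ?thesis using IH0[OF less] cz by (simp add: inj)
            qed (simp_all add: uy u0)
          qed
          moreover have "v $ wperm w z = 0"
          proof (cases "wperm w z \<le> k")
            case True
            then show ?thesis using zy by (intro vJ) (auto simp: J_def)
          qed (simp add: vk not_le)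
          ultimately show ?thesis using IHn[OF zy] by simp
        qed
        have "u $ z = 0" for z using uy uz u0 by (cases z y rule: linorder_cases) auto
        then show "v = 0" unfolding u(2) vec_eq_iff matrix_vector_nth by simp
      qed
      moreover have "card (insert k J) \<le> card {x \<in> wperm w ` {z :: 'n. rk z < Suc (rk y)}. rk x < Suc (rk k)}"
        by (rule card_mono) (auto simp: J_def k_def less_Suc_eq_le rk_le_iff)
      moreover have "k \<notin> J" by (auto simp: J_def k_def inj)
      ultimately show False
        using schubert_rank[OF w F, of "Suc (rk y)" "Suc (rk k)"] by (simp add: V_def)
    qed
    \<comment> \<open>The member before position \<open>rho y\<close> is annihilated under the
      bilinear form by all columns up to \<open>y\<close>. With a nonzero entry at \<open>x\<close>,
      the relation with column \<open>y\<close> removes one coordinate, again against the rank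
      condition.\<close>
    have below: "A $ x $ y = 0" if xl: "x < l" for x
    proof (rule ccontr)
      assume nz: "A $ x $ y \<noteq> 0"
      obtain z0 where z0: "x = wperm w z0" "y \<le> z0" "z0 \<le> rho y" using inner[OF nz] by blast
      have z0y: "z0 < rho y" using z0 xl by (auto simp: l_def order_le_less)
      define J where "J = wperm w ` {z. z < rho y \<and> wperm w z < l} - {x}"
      define V where "V = fl A (rk (rho y)) \<inter> std_space (rk l)"
      have "vec.dim V \<le> card J"
      proof (rule dim_le_coordinates)
        show "vec.subspace V" unfolding V_def by (intro vec.subspace_inter) auto
        fix v assume v: "v \<in> V" and vJ: "\<And>x. x \<in> J \<Longrightarrow> v $ x = 0"
        have vl: "v $ z = 0" if "l \<le> z" for z
          using v that by (auto simp: V_def std_space_def rk_le_iff)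
        have ann: "(\<Sum>z\<in>UNIV. A $ z $ a * v $ z) = 0" if a: "a \<le> y" for a
        proof -
          have "rho y \<le> rho a" using a rho_less_iff[of a y] by (auto simp: not_less[symmetric])
          moreover have "ct A *v v \<in> std_space (rk (rho y))"
            using v mem_fl_iff[OF iA] by (simp add: V_def unitary_inv[OF un])
          ultimately have "(ct A *v v) $ rho a = 0" by (auto simp: std_space_def rk_le_iff)
          then show ?thesis by (simp add: matrix_vector_nth iso_frame_cnj[OF A])
        qed
        have J0: "v $ wperm w z = 0" if "z < rho y" "z \<noteq> z0" for z
        proof (cases "wperm w z < l")
          case True
          then show ?thesis using that by (intro vJ) (auto simp: J_def z0(1) inj)
        qed (simp add: vl not_less)
        have out: "v $ wperm w (rho a) = 0" if a: "a < y" for a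
        proof -
          have ne: "wperm w a \<noteq> wperm w (rho a)" using half_mono[OF a y] by (auto simp: inj)
          have "A $ wperm w a $ a * v $ wperm w a + A $ wperm w (rho a) $ a * v $ wperm w (rho a) = 0"
            using ann[of a] sum_two_terms[OF ne, of "\<lambda>z. A $ z $ a * v $ z"] IH0[OF a] a by auto
          moreover have "v $ wperm w a = 0" using a y z0 by (intro J0) auto
          ultimately show ?thesis using IHl[OF a] by simp
        qed
        have v0: "v $ c = 0" if c: "c \<noteq> x" for c
        proof -
          obtain z where z: "c = wperm w z" using surj by blast
          show ?thesis
          proof (cases z "rho y" rule: linorder_cases)
            case less
            then show ?thesis using c z z0 by (simp add: J0 inj)
          next
            case equal
            then show ?thesis using z by (simp add: vl l_def)
          next
            case greater
            then have "rho z < y" using rho_less_iff[of z "rho y"] by simp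
            then show ?thesis using out[of "rho z"] z by simp
          qed
        qed
        have "(\<Sum>z\<in>UNIV. A $ z $ y * v $ z) = A $ x $ y * v $ x"
          by (rule mult_sum_nonzero_term) (simp add: v0)
        then have "v $ x = 0" using ann[of y] nz by simp
        then show "v = 0" using v0 unfolding vec_eq_iff by (metis zero_index)
      qed
      moreover have "card (wperm w ` {z. z < rho y \<and> wperm w z < l})
          \<le> card {x \<in> wperm w ` {z :: 'n. rk z < rk (rho y)}. rk x < rk l}"
        by (rule card_mono) (auto simp: rk_less_iff)
      moreover have "x \<in> wperm w ` {z. z < rho y \<and> wperm w z < l}" using z0 z0y xl by auto
      then have "card J < card (wperm w ` {z. z < rho y \<and> wperm w z < l})"
        unfolding J_def by (intro card_Diff1_less) auto
      ultimately show False
        using schubert_rank[OF w F, of "rk (rho y)" "rk l"] by (simp add: V_def)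
    qed
    have supp: "A $ x $ y = 0" if x: "x \<noteq> k" "x \<noteq> l" for x
    proof (rule ccontr)
      assume nz: "A $ x $ y \<noteq> 0"
      obtain z where z: "x = wperm w z" "y \<le> z" "z \<le> rho y" using inner[OF nz] by blast
      have "l < x" "x < k" using above[of x] below[of x] nz x by (metis linorder_neqE)+
      moreover have "y < z" "z < rho y" using z x by (auto simp: k_def l_def order_le_less)
      ultimately show False using adj[OF y] z(1) by (auto simp: k_def l_def)
    qed
    have "(\<Sum>z\<in>UNIV. A $ z $ y * A $ z $ y) = 0"
      using col[of "rho y" y] y by (simp add: iso_frame_cnj[OF A])
    then have iso: "A $ k $ y * A $ k $ y + A $ l $ y * A $ l $ y = 0"
      using sum_two_terms[of k l "\<lambda>z. A $ z $ y * A $ z $ y"] lk supp by auto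
    have one: "cnj (A $ k $ y) * A $ k $ y + cnj (A $ l $ y) * A $ l $ y = 1"
      using sum_two_terms[of k l "\<lambda>z. cnj (A $ z $ y) * A $ z $ y"] lk supp col[of y y] by auto
    have nz: "A $ k $ y \<noteq> 0" using iso one by auto
    show ?case using sign_ratio[OF iso nz] nz supp by (auto simp: k_def l_def)
  qed
  then show ?thesis unfolding paired_def using order by blast
qed

section \<open>The candidate flags\<close>

definition half_frame :: "(nat \<Rightarrow> nat) \<Rightarrow> ('n \<Rightarrow> complex) \<Rightarrow> 'n::{finite,wellorder} cmat" where
  "half_frame w s = (\<chi> x y. (if x = wperm w y then 1 else 0)
     + (if y < rho y \<and> x = wperm w (rho y) then s y else 0))"

definition signs :: "('n::{finite,wellorder} \<Rightarrow> complex) \<Rightarrow> bool" where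
  "signs s \<longleftrightarrow> (\<forall>y. y < rho y \<longrightarrow> s y \<in> {\<i>, - \<i>})"

text \<open>The columns of \<open>half_frame w s\<close> are the vectors displayed in the theorem.
  Up to a diagonal factor the matrix is \<open>N ** g\<close> with \<open>g\<close> a scaled
  permutation matrix and \<open>N\<close> unipotent: by \<open>order\<close>, the added entry
  \<open>s y\<close> sits at a smaller index than the entry 1 of its column.\<close>

lemma half_frame_cell:
  fixes s :: "'n::{finite,wellorder} \<Rightarrow> complex"
  assumes w: "w permutes {1..CARD('n)}"
    and order: "\<And>y :: 'n. y < rho y \<Longrightarrow> wperm w (rho y) < wperm w y"
  shows "invertible (half_frame w s)" "fl (half_frame w s) \<in> flag_orbit Borel_subgroup (coordinate_flag w)"
proof -
  have inj: "wperm w x = wperm w y \<longleftrightarrow> x = y" for x y :: 'n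
    using wperm_bij[OF w] by (simp add: bij_def inj_eq)
  have surj: "\<exists>z. x = wperm w z" for x :: 'n using wperm_bij[OF w] by (metis bij_pointE)
  define H where "H = half_frame w s"
  have Hnth: "H $ x $ y = (if x = wperm w y then 1 else 0)
     + (if y < rho y \<and> x = wperm w (rho y) then s y else 0)" for x y by (simp add: H_def half_frame_def)
  obtain g :: "'n cmat" and c where dg: "det g = 1" and c: "\<And>x. c x \<noteq> 0"
    and gnth: "\<And>x y. g $ x $ y = (if x = wperm w y then c x else 0)" and fg: "fl g = coordinate_flag w"
    using perm_matrix_exists[OF w] by blast
  have ig: "invertible g" using dg by (simp add: invertible_det_nz)
  define N :: "'n cmat" where "N = (\<chi> x p. H $ x $ (inv (wperm w) p))"
  have Nnth: "N $ x $ wperm w y = H $ x $ y" for x y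
  proof -
    have "inv (wperm w) (wperm w y) = y" by (rule inv_f_f[OF bij_is_inj[OF wperm_bij[OF w]]])
    then show ?thesis by (simp add: N_def)
  qed
  define E :: "'n cmat" where "E = (\<chi> x y. if x = y then c (wperm w y) else 0)"
  have NE: "N ** g = H ** E"
    unfolding vec_eq_iff
  proof (intro allI)
    fix x y
    have "(N ** g) $ x $ y = N $ x $ wperm w y * g $ wperm w y $ y"
      unfolding matrix_mult_nth by (rule mult_sum_nonzero_term) (simp add: gnth)
    moreover have "(H ** E) $ x $ y = H $ x $ y * E $ y $ y"
      unfolding matrix_mult_nth by (rule mult_sum_nonzero_term) (simp add: E_def)
    ultimately show "(N ** g) $ x $ y = (H ** E) $ x $ y" by (simp add: Nnth gnth E_def)
  qed
  have uN: "upper N" unfolding upper_def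
  proof (intro allI impI)
    fix i j :: 'n assume ji: "j < i"
    obtain y where y: "j = wperm w y" using surj by blast
    show "N $ i $ j = 0" using ji order[of y] unfolding y Nnth Hnth by auto
  qed
  have "N $ p $ p = 1" for p
  proof -
    obtain y where y: "p = wperm w y" using surj by blast
    show ?thesis unfolding y Nnth Hnth by (auto simp: inj)
  qed
  moreover have "det N = (\<Prod>i\<in>UNIV. N $ i $ i)" using uN by (intro det_upperdiagonal) (auto simp: upper_def)
  ultimately have dN: "det N = 1" by simp
  have N: "N \<in> Borel_subgroup" using uN dN by (simp add: Borel_iff)
  have "det H * det E = 1" using arg_cong[OF NE, of det] dN dg by (simp add: det_mul)
  then have iH: "invertible H" and iE: "invertible E" by (auto simp: invertible_det_nz)
  show "invertible (half_frame w s)" using iH by (simp add: H_def)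
  have "upper E" by (auto simp: upper_def E_def)
  then have "fl H = flag_act N (coordinate_flag w)"
    using fl_mult_upper[OF iH iE] by (simp add: flag_act_fl NE flip: fg)
  then show "fl (half_frame w s) \<in> flag_orbit Borel_subgroup (coordinate_flag w)"
    using N by (auto simp: flag_orbit_def H_def)
qed

definition paired_with :: "(nat \<Rightarrow> nat) \<Rightarrow> ('n::{finite,wellorder} \<Rightarrow> complex) \<Rightarrow> 'n cmat \<Rightarrow> bool" where
  "paired_with w s A \<longleftrightarrow> (\<forall>y. y < rho y \<longrightarrow> A $ wperm w y $ y \<noteq> 0 \<and>
     A $ wperm w (rho y) $ y = s y * A $ wperm w y $ y \<and>
     (\<forall>x. x \<noteq> wperm w y \<longrightarrow> x \<noteq> wperm w (rho y) \<longrightarrow> A $ x $ y = 0))"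

lemma paired_signs:
  assumes "paired w A"
  shows "\<exists>s. signs s \<and> paired_with w s A"
proof -
  have "\<forall>y. \<exists>s. y < rho y \<longrightarrow> s \<in> {\<i>, - \<i>} \<and> A $ wperm w (rho y) $ y = s * A $ wperm w y $ y"
    using assms unfolding paired_def by blast
  then obtain s where "\<And>y. y < rho y \<Longrightarrow> s y \<in> {\<i>, - \<i>} \<and> A $ wperm w (rho y) $ y = s y * A $ wperm w y $ y"
    by metis
  then show ?thesis using assms unfolding paired_def paired_with_def signs_def by blast
qed

text \<open>Relative to the unitary frame \<open>A\<close>, a column of the half frame in the first
  half is a multiple of the same column of \<open>A\<close>; any later one is a basis vector
  orthogonal to all columns of \<open>A\<close> beyond its position.\<close>

lemma paired_with_flag:
  fixes A :: "'n::{finite,wellorder} cmat"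
  assumes A: "iso_frame A" and w: "w permutes {1..CARD('n)}"
    and order: "\<And>y :: 'n. y < rho y \<Longrightarrow> wperm w (rho y) < wperm w y"
    and pr: "paired_with w s A"
  shows "fl A = fl (half_frame w s)"
proof -
  note un = iso_frame_unitary[OF A]
  note iA = unitary_invertible[OF un]
  have inj: "wperm w x = wperm w y \<longleftrightarrow> x = y" for x y :: 'n
    using wperm_bij[OF w] by (simp add: bij_def inj_eq)
  define H where "H = half_frame w s"
  have Hnth: "H $ x $ y = (if x = wperm w y then 1 else 0)
     + (if y < rho y \<and> x = wperm w (rho y) then s y else 0)" for x y by (simp add: H_def half_frame_def)
  have supp: "z = y \<or> z = rho y" if nz: "A $ wperm w y $ z \<noteq> 0" "z \<noteq> rho z" for y z
  proof (cases "z < rho z")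
    case True
    then have "wperm w y = wperm w z \<or> wperm w y = wperm w (rho z)" using pr nz unfolding paired_with_def by blast
    then show ?thesis by (auto simp: inj)
  next
    case False
    then have h: "rho z < rho (rho z)" using nz(2) by auto
    have "A $ wperm w y $ rho z \<noteq> 0" using nz(1) by (simp add: iso_frame_cnj[OF A])
    then have "wperm w y = wperm w (rho z) \<or> wperm w y = wperm w (rho (rho z))"
      using pr h unfolding paired_with_def by blast
    then show ?thesis by (auto simp: inj)
  qed
  have "upper (ct A ** H)" unfolding upper_def
  proof (intro allI impI)
    fix z y :: 'n assume yz: "y < z"
    show "(ct A ** H) $ z $ y = 0"
    proof (cases "y < rho y")
      case True
      then have a: "A $ wperm w y $ y \<noteq> 0" "A $ wperm w (rho y) $ y = s y * A $ wperm w y $ y"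
        "\<And>x. x \<noteq> wperm w y \<Longrightarrow> x \<noteq> wperm w (rho y) \<Longrightarrow> A $ x $ y = 0"
        using pr unfolding paired_with_def by blast+
      have "H $ x $ y = A $ x $ y / A $ wperm w y $ y" for x
        using True a by (auto simp: Hnth inj)
      then have "(ct A ** H) $ z $ y = (\<Sum>x\<in>UNIV. cnj (A $ x $ z) * A $ x $ y) / A $ wperm w y $ y"
        by (simp add: matrix_mult_nth sum_divide_distrib)
      also have "\<dots> = 0" using un yz by (simp add: unitary_columns)
      finally show ?thesis .
    next
      case False
      have "(ct A ** H) $ z $ y = ct A $ z $ wperm w y * H $ wperm w y $ y"
        unfolding matrix_mult_nth by (rule mult_sum_nonzero_term) (use False in \<open>simp add: Hnth\<close>)
      moreover have "A $ wperm w y $ z = 0"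
      proof (rule ccontr)
        assume nz: "A $ wperm w y $ z \<noteq> 0"
        have "rho z < rho y" "rho y \<le> y" using False yz rho_less_iff[of z y] by auto
        then have "rho z < z" using yz by (meson order.strict_trans order_less_le_trans)
        then have "z \<noteq> rho z" by auto
        then have "z = rho y" using supp[OF nz] yz by auto
        then show False using yz False by auto
      qed
      ultimately show ?thesis by simp
    qed
  qed
  then show ?thesis
    using fl_eq_iff[OF iA half_frame_cell(1)[OF w order]] by (simp add: H_def unitary_inv[OF un])
qed

text \<open>The explicit frame: in positions \<open>y\<close> and \<open>rho y\<close> the vector of
  the half frame and its conjugate, divided by \<open>sqrt 2\<close>, and a basis vector in the
  middle for odd dimension. Thus every choice of signs gives an isotropic flag.\<close>

lemma half_frame_iso:
  fixes s :: "'n::{finite,wellorder} \<Rightarrow> complex"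
  assumes w: "w permutes {1..CARD('n)}" and s: "signs s"
  defines "A \<equiv> (\<chi> x y. (if x = wperm w y then (if y < rho y then of_real (1 / sqrt 2) else if y = rho y then 1 else cnj (s (rho y)) * of_real (1 / sqrt 2)) else 0)
    + (if x = wperm w (rho y) then (if y < rho y then s y * of_real (1 / sqrt 2) else if y = rho y then 0 else of_real (1 / sqrt 2)) else 0)) :: 'n cmat"
  shows "iso_frame A" "paired_with w s A"
proof -
  have inj: "wperm w x = wperm w y \<longleftrightarrow> x = y" for x y :: 'n
    using wperm_bij[OF w] by (simp add: bij_def inj_eq)
  define r where "r = complex_of_real (1 / sqrt 2)"
  have rr: "r * r = 1 / 2" "cnj r = r" "r \<noteq> 0" by (simp_all add: r_def flip: of_real_mult)
  define p where "p y = (if y < rho y then r else if y = rho y then 1 else cnj (s (rho y)) * r)" for y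
  define q where "q y = (if y < rho y then s y * r else if y = rho y then 0 else r)" for y
  have Anth: "A $ x $ y = (if x = wperm w y then p y else 0) + (if x = wperm w (rho y) then q y else 0)" for x y
    by (simp add: A_def p_def q_def r_def)
  have ss: "cnj (s y) * s y = 1" "s y * s y = - 1" "cnj (s y) * cnj (s y) = -1" if "y < rho y" for y
    using s that by (auto simp: signs_def)
  have rho_inj: "rho x = rho y \<longleftrightarrow> x = y" for x y :: 'n by (metis rho_rho)
  have "unitary A" unfolding unitary_columns
  proof (intro allI)
    fix a b :: 'n
    have "(\<Sum>z\<in>UNIV. cnj (A $ z $ a) * A $ z $ b)
      = (\<Sum>z\<in>UNIV. if z = wperm w a then cnj (p a) * A $ z $ b else 0)
        + (\<Sum>z\<in>UNIV. if z = wperm w (rho a) then cnj (q a) * A $ z $ b else 0)"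
      unfolding sum.distrib[symmetric] by (intro sum.cong) (auto simp: Anth[of _ a] distrib_right)
    also have "\<dots> = cnj (p a) * A $ wperm w a $ b + cnj (q a) * A $ wperm w (rho a) $ b" by simp
    also have "\<dots> = (if a = b then 1 else 0)"
    proof (cases "a = b")
      case True
      have sq: "r * r + (cnj t * r) * (t * r) = 1" if "cnj t * t = 1" for t
      proof -
        have "r * r + (cnj t * r) * (t * r) = r * r + (cnj t * t) * (r * r)" by (simp add: mult_ac)
        then show ?thesis by (simp add: that rr(1))
      qed
      show ?thesis
      proof (cases a "rho a" rule: linorder_cases)
        case less
        then have "p a = r" "q a = s a * r" "A $ wperm w a $ a = p a" "A $ wperm w (rho a) $ a = q a"
          by (auto simp: p_def q_def Anth inj)
        then show ?thesis using True sq[OF ss(1)[OF less]] rr(2) by simp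
      next
        case equal
        then have "p a = 1" "q a = 0" "A $ wperm w a $ a = 1" by (auto simp: p_def q_def Anth inj)
        then show ?thesis using True by simp
      next
        case greater
        then have h: "rho a < rho (rho a)" by simp
        have "p a = cnj (s (rho a)) * r" "q a = r" "A $ wperm w a $ a = p a" "A $ wperm w (rho a) $ a = q a"
          using greater by (auto simp: p_def q_def Anth inj)
        then show ?thesis using True sq[of "cnj (s (rho a))"] ss(1)[OF h] rr(2)
          by (simp add: mult.commute add.commute)
      qed
    next
      case False
      show ?thesis
      proof (cases "a = rho b")
        case True
        then have ab: "a \<noteq> rho a" "rho a = b" using False by auto
        then have nb: "b \<noteq> rho b" by auto
        have "cnj (p a) * q b + cnj (q a) * p b = 0"
        proof (cases a "rho a" rule: linorder_cases)
          case less
          then have "p a = r" "q a = s a * r" "p b = cnj (s a) * r" "q b = r"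
            using ab by (auto simp: p_def q_def)
          then have "cnj (p a) * q b + cnj (q a) * p b = r * r + (cnj (s a) * cnj (s a)) * (r * r)"
            by (simp add: rr(2) mult_ac)
          then show ?thesis by (simp add: ss(3)[OF less])
        next
          case greater
          then have h: "b < rho b" using ab True by auto
          then have "p b = r" "q b = s b * r" "p a = cnj (s b) * r" "q a = r"
            using ab True greater by (auto simp: p_def q_def)
          then have "cnj (p a) * q b + cnj (q a) * p b = (s b * s b) * (r * r) + r * r"
            by (simp add: rr(2) mult_ac)
          then show ?thesis by (simp add: ss(2)[OF h])
        qed (use ab in simp)
        then show ?thesis using False True ab nb by (simp add: Anth inj)
      next
        case nr: False
        then have "rho a \<noteq> b" by auto
        then show ?thesis using False nr by (simp add: Anth inj rho_inj)
      qed
    qed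
    finally show "(\<Sum>z\<in>UNIV. cnj (A $ z $ a) * A $ z $ b) = (if a = b then 1 else 0)" .
  qed
  moreover have "A $ x $ rho y = cnj (A $ x $ y)" for x y
  proof (cases y "rho y" rule: linorder_cases)
    case less
    then have "p (rho y) = cnj (s y) * r" "q (rho y) = r" "p y = r" "q y = s y * r"
      by (auto simp: p_def q_def)
    then show ?thesis unfolding Anth by (simp add: rr(2))
  next
    case equal
    then have "p y = 1" "q y = 0" "rho y = y" by (auto simp: p_def q_def)
    then show ?thesis unfolding Anth by simp
  next
    case greater
    then have "p (rho y) = r" "q (rho y) = s (rho y) * r" "p y = cnj (s (rho y)) * r" "q y = r"
      by (auto simp: p_def q_def)
    then show ?thesis unfolding Anth by (simp add: rr(2))
  qed
  ultimately show "iso_frame A" by (simp add: iso_frame_def)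
  show "paired_with w s A" unfolding paired_with_def
  proof (intro allI impI)
    fix y :: 'n assume y: "y < rho y"
    then have "p y = r" "q y = s y * r" "wperm w y \<noteq> wperm w (rho y)" by (auto simp: p_def q_def inj)
    then show "A $ wperm w y $ y \<noteq> 0 \<and> A $ wperm w (rho y) $ y = s y * A $ wperm w y $ y \<and>
        (\<forall>x. x \<noteq> wperm w y \<longrightarrow> x \<noteq> wperm w (rho y) \<longrightarrow> A $ x $ y = 0)"
      unfolding Anth using rr(3) by simp
  qed
qed

section \<open>Membership in the base cycle and orientation\<close>

lemma iso_frame_transition:
  fixes A B :: "'n::{finite,wellorder} cmat"
  assumes A: "iso_frame A" and B: "iso_frame B"
  shows "real_mat (A ** ct B)" "transpose (A ** ct B) ** (A ** ct B) = mat 1"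
    "transpose (A ** ct B) = B ** ct A"
proof -
  have bij: "bij (rho :: 'n \<Rightarrow> 'n)" by (rule o_bij[of rho]) (auto simp: o_def)
  show re: "real_mat (A ** ct B)" unfolding real_mat_def Reals_cnj_iff
  proof (intro allI)
    fix p q
    \<comment> \<open>Conjugation reverses the columns of both frames in the same way, which only
      permutes the summands.\<close>
    have "cnj ((A ** ct B) $ p $ q) = (\<Sum>z\<in>UNIV. A $ p $ rho z * cnj (B $ q $ rho z))"
      by (simp add: matrix_mult_nth iso_frame_cnj[OF A] iso_frame_cnj[OF B])
    also have "\<dots> = (\<Sum>z\<in>UNIV. A $ p $ z * cnj (B $ q $ z))"
      by (rule sum.reindex_bij_betw[OF bij])
    finally show "cnj ((A ** ct B) $ p $ q) = (A ** ct B) $ p $ q" by (simp add: matrix_mult_nth)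
  qed
  have "transpose (A ** ct B) = ct (A ** ct B)" using real_unitary[OF re] by simp
  also have "\<dots> = B ** ct A" by (simp add: ct_mult) (simp add: vec_eq_iff matrix_mult_nth)
  finally show t: "transpose (A ** ct B) = B ** ct A" .
  have "B ** ct A ** (A ** ct B) = B ** (ct A ** A) ** ct B" by (simp add: matrix_mul_assoc)
  then show "transpose (A ** ct B) ** (A ** ct B) = mat 1"
    using iso_frame_unitary[OF A] by (simp add: t unitary_def unitary_right[OF iso_frame_unitary[OF B]])
qed

lemma iso_frame_in_orbit:
  fixes A B :: "'n::{finite,wellorder} cmat"
  assumes A: "iso_frame A" and B: "iso_frame B" and C: "C = flag_orbit SO_real F" and BC: "fl B \<in> C"
    and det: "det (A ** ct B) = 1"
  shows "fl A \<in> C"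
proof -
  have "A ** ct B \<in> SO_real" using iso_frame_transition[OF A B] det by (simp add: SO_real_iff)
  moreover have "fl A = flag_act (A ** ct B) (fl B)"
    using iso_frame_unitary[OF B] by (simp add: flag_act_fl unitary_def flip: matrix_mul_assoc)
  moreover obtain R where R: "R \<in> SO_real" "fl B = flag_act R F" using BC by (auto simp: C flag_orbit_def)
  ultimately have "fl A = flag_act (A ** ct B ** R) F" "A ** ct B ** R \<in> SO_real"
    by (simp_all add: flag_act_mult SO_real_mult)
  then show ?thesis unfolding C flag_orbit_def by blast
qed

text \<open>In odd dimension the middle column is its own conjugate; changing its sign keeps the
  flag and the isotropy but corrects the determinant.\<close>

lemma iso_frame_in_orbit_odd:
  fixes A B :: "'n::{finite,wellorder} cmat"
  assumes A: "iso_frame A" and B: "iso_frame B" and C: "C = flag_orbit SO_real F" and BC: "fl B \<in> C"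
    and odd: "odd CARD('n)"
  shows "fl A \<in> C"
proof (cases "det (A ** ct B) = 1")
  case True
  then show ?thesis by (rule iso_frame_in_orbit[OF A B C BC])
next
  case False
  define y0 :: 'n where "y0 = en (CARD('n) div 2)"
  have ry: "rho y0 = y0"
  proof -
    have "CARD('n) - 1 - CARD('n) div 2 = CARD('n) div 2" using odd by (elim oddE) simp
    moreover have "CARD('n) div 2 < CARD('n)" by simp
    ultimately show ?thesis unfolding y0_def rho_def by (simp only: rk_en)
  qed
  define e :: "'n \<Rightarrow> complex" where "e y = (if y = y0 then - 1 else 1)" for y
  have ee: "cnj (e a) * e a = 1" "e (rho a) = e a" "cnj (e a) = e a" for a
    using ry by (auto simp: e_def)
  define E :: "'n cmat" where "E = (\<chi> x y. if x = y then e y else 0)"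
  have AE: "(A ** E) $ x $ y = e y * A $ x $ y" for x y
    unfolding matrix_mult_nth by (subst mult_sum_nonzero_term[of y]) (auto simp: E_def)
  have "iso_frame (A ** E)" unfolding iso_frame_def unitary_columns AE
  proof (intro conjI allI)
    fix a b
    have "(\<Sum>z\<in>UNIV. cnj (e a * A $ z $ a) * (e b * A $ z $ b))
        = cnj (e a) * e b * (\<Sum>z\<in>UNIV. cnj (A $ z $ a) * A $ z $ b)"
      by (simp add: sum_distrib_left mult_ac)
    then show "(\<Sum>z\<in>UNIV. cnj (e a * A $ z $ a) * (e b * A $ z $ b)) = (if a = b then 1 else 0)"
      using iso_frame_unitary[OF A] ee(1) by (simp add: unitary_columns)
  qed (simp add: ee iso_frame_cnj[OF A])
  moreover have "det E = (\<Prod>i\<in>UNIV. E $ i $ i)" by (rule det_upperdiagonal) (auto simp: E_def)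
  then have dE: "det E = -1" by (simp add: E_def e_def)
  moreover have "det (A ** ct B) = -1"
    using det_real_orthogonal[OF iso_frame_transition(2)[OF A B]] False by blast
  then have "det (A ** E ** ct B) = 1" using dE by (simp add: det_mul)
  ultimately have "fl (A ** E) \<in> C" by (intro iso_frame_in_orbit[OF _ B C BC]) auto
  moreover have "fl (A ** E) = fl A"
    using dE by (intro fl_mult_upper unitary_invertible[OF iso_frame_unitary[OF A]])
      (auto simp: invertible_det_nz upper_def E_def)
  ultimately show ?thesis by simp
qed

text \<open>For even \<open>n\<close> the columns of an isotropic frame pair up without fixed point, so a real matrix
  fixing the flag has eigenvalues in conjugate pairs and hence positive determinant.\<close>

lemma iso_frame_orientation:
  fixes A B :: "'n::{finite,wellorder} cmat"
  assumes A: "iso_frame A" and B: "iso_frame B" and even: "even CARD('n)"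
    and g: "g \<in> SL_real" "fl A = flag_act g (fl B)"
  shows "det (A ** ct B) = 1"
proof (rule ccontr)
  define k where "k = A ** ct B"
  assume "det (A ** ct B) \<noteq> 1"
  then have dk: "det k = -1"
    using det_real_orthogonal[OF iso_frame_transition(2)[OF A B]] by (auto simp: k_def)
  note unA = iso_frame_unitary[OF A] and unB = iso_frame_unitary[OF B]
  note iB = unitary_invertible[OF unB]
  \<comment> \<open>A real matrix that fixes \<open>fl B\<close> and, under the assumption to be
    refuted, has determinant -1.\<close>
  define h where "h = transpose k ** g"
  have tk: "transpose k = B ** ct A" unfolding k_def by (rule iso_frame_transition(3)[OF A B])
  have rh: "real_mat h" unfolding h_def k_def
    using g(1) by (intro real_mat_mult real_mat_transpose iso_frame_transition(1)[OF A B]) (auto simp: SL_real_iff)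
  have dh: "det h = -1" using dk g(1) by (simp add: h_def det_mul SL_real_iff)
  have ih: "invertible h" using dh by (simp add: invertible_det_nz)
  have "flag_act h (fl B) = flag_act (transpose k) (fl A)" by (simp add: h_def g(2) flag_act_mult)
  also have "\<dots> = fl B"
    using unA by (simp add: tk flag_act_fl unitary_def flip: matrix_mul_assoc)
  finally have "fl (h ** B) = fl B" by (simp add: flag_act_fl)
  define U where "U = ct B ** (h ** B)"
  have uU: "upper U"
    using fl_eq_iff[OF iB invertible_mult[OF ih iB]] \<open>fl (h ** B) = fl B\<close> by (simp add: U_def unitary_inv[OF unB])
  have dU: "det U = -1"
  proof -
    have "det (ct B) * det B = 1"
      using arg_cong[OF unB[unfolded unitary_def], of det] by (simp add: det_mul)
    then show ?thesis by (simp add: U_def det_mul dh)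
  qed
  have cU: "U $ rho a $ rho a = cnj (U $ a $ a)" for a
    using rh by (simp add: U_def matrix_mult_nth iso_frame_cnj[OF B] real_mat_def Reals_cnj_iff)
  define Hf where "Hf = {a :: 'n. a < rho a}"
  have nofix: "a \<noteq> rho a" for a :: 'n
  proof
    assume "a = rho a"
    then have "rk a = CARD('n) - 1 - rk a" by (metis rho_rk)
    then have "CARD('n) = 2 * rk a + 1" using rk_less[of a] by linarith
    then show False using even by simp
  qed
  have split: "(UNIV :: 'n set) = Hf \<union> rho ` Hf"
  proof -
    have "a \<in> rho ` Hf" if "a \<notin> Hf" for a
    proof -
      have "rho a < rho (rho a)" using that nofix[of a] by (auto simp: Hf_def not_less order_le_less)
      then show ?thesis by (intro image_eqI[of _ _ "rho a"]) (auto simp: Hf_def)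
    qed
    then show ?thesis by auto
  qed
  have dis: "Hf \<inter> rho ` Hf = {}" by (auto simp: Hf_def)
  have injr: "inj_on rho Hf" by (rule inj_onI) (metis rho_rho)
  have "det U = (\<Prod>a\<in>UNIV. U $ a $ a)" using uU by (intro det_upperdiagonal) (auto simp: upper_def)
  also have "\<dots> = (\<Prod>a\<in>Hf. U $ a $ a) * (\<Prod>a\<in>rho ` Hf. U $ a $ a)"
    unfolding split by (rule prod.union_disjoint) (use dis in auto)
  also have "(\<Prod>a\<in>rho ` Hf. U $ a $ a) = (\<Prod>a\<in>Hf. cnj (U $ a $ a))"
    by (simp add: prod.reindex[OF injr] cU)
  also have "(\<Prod>a\<in>Hf. U $ a $ a) * \<dots> = of_real ((cmod (\<Prod>a\<in>Hf. U $ a $ a))\<^sup>2)"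
    by (simp only: complex_norm_square cnj_prod)
  finally have "Re (det U) \<ge> 0" by (simp only: Re_complex_of_real zero_le_power2)
  then show False using dU by simp
qed

text \<open>Reflection in the coordinate \<open>l\<close>, a real orthogonal map of determinant -1.
  Among the columns of the first half it affects only column \<open>y1\<close>, where it reverses
  the sign.\<close>

lemma paired_with_flip:
  fixes A :: "'n::{finite,wellorder} cmat"
  assumes A: "iso_frame A" and w: "w permutes {1..CARD('n)}" and pr: "paired_with w s A"
    and y1: "y1 < rho y1"
  shows "\<exists>A'. iso_frame A' \<and> paired_with w (s(y1 := - s y1)) A' \<and> det (A' ** B) = - det (A ** B)"
proof -
  have inj: "wperm w x = wperm w y \<longleftrightarrow> x = y" for x y :: 'n
    using wperm_bij[OF w] by (simp add: bij_def inj_eq)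
  have rho_inj: "rho x = rho y \<longleftrightarrow> x = y" for x y :: 'n by (metis rho_rho)
  define l where "l = wperm w (rho y1)"
  define e :: "'n \<Rightarrow> complex" where "e x = (if x = l then - 1 else 1)" for x
  define E :: "'n cmat" where "E = (\<chi> x y. if x = y then e y else 0)"
  have EA: "(E ** A) $ x $ y = e x * A $ x $ y" for x y
    unfolding matrix_mult_nth by (subst mult_sum_nonzero_term[of x]) (auto simp: E_def)
  have "cnj (e z * A $ z $ a) * (e z * A $ z $ b) = cnj (A $ z $ a) * A $ z $ b" for z a b
    by (simp add: e_def)
  then have "unitary (E ** A)"
    using iso_frame_unitary[OF A] unfolding unitary_columns EA by presburger
  then have "iso_frame (E ** A)"
    unfolding iso_frame_def EA by (simp add: iso_frame_cnj[OF A]) (simp add: e_def)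
  moreover have "paired_with w (s(y1 := - s y1)) (E ** A)"
    unfolding paired_with_def EA
  proof (intro allI impI)
    fix y :: 'n assume y: "y < rho y"
    have a: "A $ wperm w y $ y \<noteq> 0" "A $ wperm w (rho y) $ y = s y * A $ wperm w y $ y"
        "\<forall>x. x \<noteq> wperm w y \<longrightarrow> x \<noteq> wperm w (rho y) \<longrightarrow> A $ x $ y = 0"
      using pr y unfolding paired_with_def by blast+
    have "y \<noteq> rho y1" using y y1 by auto
    then have e1: "e (wperm w y) = 1" by (simp add: e_def l_def inj)
    have e2: "e (wperm w (rho y)) = (if y = y1 then -1 else 1)" by (simp add: e_def l_def inj rho_inj)
    show "e (wperm w y) * A $ wperm w y $ y \<noteq> 0 \<and>
        e (wperm w (rho y)) * A $ wperm w (rho y) $ y = (s(y1 := - s y1)) y * (e (wperm w y) * A $ wperm w y $ y) \<and>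
        (\<forall>x. x \<noteq> wperm w y \<longrightarrow> x \<noteq> wperm w (rho y) \<longrightarrow> e x * A $ x $ y = 0)"
      using a by (simp add: e1 e2)
  qed
  moreover have "det (E ** A ** B) = - det (A ** B)"
  proof -
    have "det E = (\<Prod>i\<in>UNIV. E $ i $ i)" by (rule det_upperdiagonal) (auto simp: E_def)
    then have "det E = -1" by (simp add: E_def e_def)
    then show ?thesis by (simp add: det_mul)
  qed
  ultimately show ?thesis by blast
qed

section \<open>Counting the candidate flags\<close>

lemma half_frame_inj:
  fixes s s' :: "'n::{finite,wellorder} \<Rightarrow> complex"
  assumes w: "w permutes {1..CARD('n)}" and eq: "fl (half_frame w s) = fl (half_frame w s')"
    and y: "y < rho y"
  shows "s y = s' y"
proof -
  have inj: "wperm w x = wperm w y \<longleftrightarrow> x = y" for x y :: 'n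
    using wperm_bij[OF w] by (simp add: bij_def inj_eq)
  have Hnth: "half_frame w s $ x $ y = (if x = wperm w y then 1 else 0)
     + (if y < rho y \<and> x = wperm w (rho y) then s y else 0)" for x y s by (simp add: half_frame_def)
  have "half_frame w s' *v axis y 1 \<in> fl (half_frame w s) (Suc (rk y))"
    using axis_std_space[of y] by (auto simp: eq fl_nth)
  then obtain u where u: "u \<in> std_space (Suc (rk y))" "half_frame w s' *v axis y 1 = half_frame w s *v u"
    by (auto simp: fl_nth)
  have u0: "u $ z = 0" if "y < z" for z
    using u(1) that by (auto simp: std_space_def Suc_le_eq rk_less_iff)
  have z0: "half_frame w s $ wperm w y $ z = 0" "half_frame w s $ wperm w (rho y) $ z = 0" if z: "z < y" for z
  proof -
    have "rho y < rho z" using z by (simp add: rho_less_iff)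
    then show "half_frame w s $ wperm w y $ z = 0" "half_frame w s $ wperm w (rho y) $ z = 0"
      using z y by (auto simp: Hnth inj)
  qed
  have val: "half_frame w s' $ x $ y = half_frame w s $ x $ y * u $ y"
    if "\<And>z. z < y \<Longrightarrow> half_frame w s $ x $ z = 0" for x
  proof -
    have "half_frame w s' $ x $ y = (half_frame w s *v u) $ x" by (simp flip: u(2))
    also have "\<dots> = half_frame w s $ x $ y * u $ y"
      unfolding matrix_vector_nth
    proof (rule mult_sum_nonzero_term)
      fix c assume "c \<noteq> y"
      then have "c < y \<or> y < c" by auto
      then show "half_frame w s $ x $ c * u $ c = 0" using that u0 by auto
    qed
    finally show ?thesis .
  qed
  have ne: "y \<noteq> rho y" using y by auto
  \<comment> \<open>Both columns have the entry 1 at \<open>wperm w y\<close>, where earlier columns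
    vanish. This normalization rules out a scalar, so the entries at \<open>wperm w (rho y)\<close>
    can be compared.\<close>
  have "u $ y = 1" using val[of "wperm w y"] z0 ne by (simp add: Hnth inj)
  then show ?thesis using val[of "wperm w (rho y)"] z0 ne y by (simp add: Hnth inj)
qed

lemma half_positions:
  fixes y :: "'n::{finite,wellorder}"
  shows "y < rho y \<longleftrightarrow> rk y < CARD('n) div 2"
proof -
  have "y < rho y \<longleftrightarrow> rk y < CARD('n) - 1 - rk y" by (simp only: rho_rk flip: rk_less_iff)
  then show ?thesis using rk_less[of y] by auto
qed

lemma card_sign_functions:
  "card (PiE {y :: 'n::{finite,wellorder}. y < rho y} (\<lambda>_. {\<i>, - \<i>})) = 2 ^ (CARD('n) div 2)"
proof -
  have "card {y :: 'n. y < rho y} = CARD('n) div 2"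
    unfolding half_positions by (rule card_rk_less) simp
  moreover have "card {\<i>, - \<i>} = 2"
    by (simp add: card_insert_if complex_eq_iff)
  ultimately show ?thesis by (simp only: card_PiE[OF finite] prod_constant)
qed

text \<open>\<open>signs\<close> leaves the values outside the first half free, although they do not
  influence the flag; extensional functions remove this ambiguity and allow an injective
  parametrization.\<close>

lemma half_frame_flags:
  "{fl (half_frame w s) | s. signs (s :: 'n::{finite,wellorder} \<Rightarrow> complex)}
    = (\<lambda>s. fl (half_frame w s)) ` PiE {y. y < rho y} (\<lambda>_. {\<i>, - \<i>})"
proof (intro set_eqI iffI)
  fix p assume "p \<in> {fl (half_frame w s) | s. signs (s :: 'n \<Rightarrow> complex)}"
  then obtain s :: "'n \<Rightarrow> complex" where s: "signs s" "p = fl (half_frame w s)" by blast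
  have "half_frame w (restrict s {y. y < rho y}) = half_frame w s"
    by (auto simp: half_frame_def vec_eq_iff)
  moreover have "restrict s {y. y < rho y} \<in> PiE {y. y < rho y} (\<lambda>_. {\<i>, - \<i>})"
    using s(1) by (auto simp: signs_def)
  ultimately show "p \<in> (\<lambda>s. fl (half_frame w s)) ` PiE {y. y < rho y} (\<lambda>_. {\<i>, - \<i>})"
    using s(2) by (intro image_eqI[of _ _ "restrict s {y. y < rho y}"]) simp_all
qed (auto simp: signs_def PiE_def Pi_def)

lemma half_frame_inj_on:
  assumes w: "w permutes {1..CARD('n)}"
  shows "inj_on (\<lambda>s. fl (half_frame w s)) (PiE {y :: 'n::{finite,wellorder}. y < rho y} (\<lambda>_. {\<i>, - \<i>}))"
proof (rule inj_onI)
  fix s s' :: "'n \<Rightarrow> complex"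
  assume s: "s \<in> PiE {y. y < rho y} (\<lambda>_. {\<i>, - \<i>})" "s' \<in> PiE {y. y < rho y} (\<lambda>_. {\<i>, - \<i>})"
    and eq: "fl (half_frame w s) = fl (half_frame w s')"
  show "s = s'"
  proof (rule PiE_ext[OF s])
    fix y :: 'n assume "y \<in> {y. y < rho y}"
    then show "s y = s' y" using half_frame_inj[OF w eq] by simp
  qed
qed

section \<open>Translation into the explicit lists of vectors\<close>

lemma fl_span:
  fixes A :: "'n::{finite,wellorder} cmat"
  shows "fl A i = vec.span ((\<lambda>y. A *v axis y 1) ` {y. rk y < i})"
proof -
  have "std_space i = vec.span ((\<lambda>y :: 'n. axis y (1::complex)) ` {y. rk y < i})"
    unfolding span_axes std_space_def by (auto simp: not_less)
  then have "fl A i = vec.span ((*v) A ` (\<lambda>y. axis y 1) ` {y. rk y < i})"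
    by (simp add: fl_nth vec.span_image)
  then show ?thesis by (simp add: image_image)
qed

lemma flag_of_columns:
  fixes A :: "'n::{finite,wellorder} cmat"
  shows "flag_of (map (\<lambda>j. A *v axis (en j) 1) [0..<CARD('n)]) = fl A"
proof
  fix i
  have "set (take i (map (\<lambda>j. A *v axis (en j) 1) [0..<CARD('n)]))
      = (\<lambda>j. A *v axis (en j) 1) ` {..<min i CARD('n)}"
    by (simp add: take_map take_upt min_def lessThan_atLeast0)
  also have "\<dots> = (\<lambda>y. A *v axis y 1) ` {y :: 'n. rk y < i}"
  proof (intro set_eqI iffI)
    fix v assume "v \<in> (\<lambda>j. A *v axis (en j) 1) ` {..<min i CARD('n)}"
    then obtain j where j: "j < i" "j < CARD('n)" "v = A *v axis (en j) 1" by auto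
    then show "v \<in> (\<lambda>y. A *v axis y 1) ` {y. rk y < i}"
      by (intro image_eqI[of _ _ "en j"]) auto
  next
    fix v assume "v \<in> (\<lambda>y. A *v axis y 1) ` {y :: 'n. rk y < i}"
    then obtain y :: 'n where y: "rk y < i" "v = A *v axis y 1" by auto
    then show "v \<in> (\<lambda>j. A *v axis (en j) 1) ` {..<min i CARD('n)}"
      by (intro image_eqI[of _ _ "rk y"]) auto
  qed
  finally show "flag_of (map (\<lambda>j. A *v axis (en j) 1) [0..<CARD('n)]) i = fl A i"
    by (simp add: flag_of_def fl_span)
qed

lemma intersection_flag_half_frame:
  fixes s :: "nat \<Rightarrow> complex"
  assumes w: "map w [1..<CARD('n) + 1] = one_line CARD('n) k lstar l"
  shows "intersection_flag k lstar l s = fl (half_frame w (\<lambda>y :: 'n::{finite,wellorder}. s (Suc (rk y))))"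
proof -
  define n where "n = CARD('n)"
  define m where "m = n div 2"
  define H :: "'n cmat" where "H = half_frame w (\<lambda>y. s (Suc (rk y)))"
  define vs :: "'n cvec list" where "vs = map (\<lambda>j. s j *s basis_vec (l j) + basis_vec (k j)) [1..<m + 1]
     @ (if odd n then [basis_vec lstar] else []) @ map (\<lambda>j. basis_vec (l j)) (rev [1..<m + 1])"
  have nm: "n = m + (if odd n then 1 else 0) + m" unfolding m_def by presburger
  have "length vs = m + (if odd n then 1 else 0) + m" by (simp add: vs_def del: upt_Suc)
  then have len: "length vs = n" using nm by (simp only:)
  have w1: "w (Suc j) = one_line n k lstar l ! j" if "j < n" for j
    using arg_cong[OF w[folded n_def], of "\<lambda>xs. xs ! j"] that by (simp del: upt_Suc)
  have wk: "w (Suc j) = k (Suc j)" if "j < m" for j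
    using w1[of j] that nm by (simp add: one_line_def nth_append flip: m_def del: upt_Suc)
  \<comment> \<open>The tail of the one-line notation is reversed: counted from the end, starting
    with 0, entry \<open>j\<close> is \<open>l (Suc j)\<close>, whether or not the middle entry is
    present.\<close>
  have wl: "w (n - j) = l (Suc j)" if j: "j < m" for j
  proof -
    define i where "i = n - 1 - j"
    have i: "i < n" "n - j = Suc i" "m \<le> i" using j nm by (auto simp: i_def)
    show ?thesis
    proof (cases "odd n")
      case True
      then have "i = Suc (m + (m - 1 - j))" using j nm by (simp add: i_def)
      moreover have "\<not> Suc (m + m - Suc j) < m" using j by linarith
      ultimately show ?thesis unfolding i(2) w1[OF i(1)]
        using True j by (simp add: one_line_def nth_append rev_nth flip: m_def del: upt_Suc)
    next
      case False
      then have "i = m + (m - 1 - j)" using j nm by (simp add: i_def)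
      moreover have "\<not> m + m - Suc j < m" using j by linarith
      ultimately show ?thesis unfolding i(2) w1[OF i(1)]
        using False j by (simp add: one_line_def nth_append rev_nth flip: m_def del: upt_Suc)
    qed
  qed
  have vsw: "vs ! j = basis_vec (w (Suc j))" if j: "m \<le> j" "j < n" for j
    unfolding w1[OF j(2)] using j nm
    by (auto simp: vs_def one_line_def nth_append rev_nth nth_Cons' split: if_splits simp flip: m_def simp del: upt_Suc)
  have H: "H *v axis y 1 = axis (wperm w y) 1 + (if y < rho y then s (Suc (rk y)) *s axis (wperm w (rho y)) 1 else 0)" for y
    unfolding axis_mult_complex by (auto simp: vec_eq_iff H_def half_frame_def axis_def)
  have bw: "basis_vec (w (Suc (rk y))) = axis (wperm w y :: 'n) (1::complex)" for y
    by (simp add: basis_vec_en wperm_def)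
  have "vs = map (\<lambda>j. H *v axis (en j) 1) [0..<n]"
  proof (rule nth_equalityI)
    show "length vs = length (map (\<lambda>j. H *v axis (en j) 1) [0..<n])" by (simp add: len)
    fix j assume "j < length vs"
    then have j: "j < n" by (simp add: len)
    define y :: 'n where "y = en j"
    have rk: "rk y = j" using j by (simp add: y_def n_def)
    have hy: "y < rho y \<longleftrightarrow> j < m" unfolding half_positions rk by (simp add: m_def n_def)
    show "vs ! j = map (\<lambda>j. H *v axis (en j) 1) [0..<n] ! j"
    proof (cases "j < m")
      case True
      have "Suc (rk (rho y)) = n - j" using j unfolding rho_rk rk n_def by linarith
      then have "basis_vec (l (Suc j)) = axis (wperm w (rho y)) (1::complex)"
        using bw[of "rho y"] wl[OF True] by simp
      moreover have "basis_vec (k (Suc j)) = axis (wperm w y) (1::complex)"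
        using bw[of y] wk[OF True] by (simp add: rk)
      moreover have "vs ! j = s (Suc j) *s basis_vec (l (Suc j)) + basis_vec (k (Suc j))"
        using True by (simp add: vs_def nth_append del: upt_Suc)
      ultimately show ?thesis using j True hy by (simp add: H rk add.commute flip: y_def)
    next
      case False
      then show ?thesis using j vsw[of j] bw[of y] hy by (simp add: H rk flip: y_def)
    qed
  qed
  moreover have "intersection_flag k lstar l s = flag_of vs"
    by (simp add: intersection_flag_def vs_def m_def n_def del: upt_Suc)
  ultimately show ?thesis using flag_of_columns[of H] by (simp add: n_def H_def)
qed

lemma intersection_flags_half_frames:
  assumes w: "map w [1..<CARD('n) + 1] = one_line CARD('n) k lstar l"
  shows "{intersection_flag k lstar l s | s. \<forall>j\<in>{1..CARD('n) div 2}. s j \<in> {\<i>, - \<i>}}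
    = {fl (half_frame w s) | s. signs (s :: 'n::{finite,wellorder} \<Rightarrow> complex)}"
proof (intro set_eqI iffI)
  fix p :: "'n flag"
  assume "p \<in> {intersection_flag k lstar l s | s. \<forall>j\<in>{1..CARD('n) div 2}. s j \<in> {\<i>, - \<i>}}"
  then obtain s where s: "\<forall>j\<in>{1..CARD('n) div 2}. s j \<in> {\<i>, - \<i>}" "p = intersection_flag k lstar l s" by blast
  have "signs (\<lambda>y :: 'n. s (Suc (rk y)))"
    unfolding signs_def half_positions using s(1) by (auto simp: Suc_le_eq)
  then show "p \<in> {fl (half_frame w s) | s. signs (s :: 'n \<Rightarrow> complex)}"
    using s(2) intersection_flag_half_frame[OF w] by blast
next
  fix p :: "'n flag" assume "p \<in> {fl (half_frame w s) | s. signs (s :: 'n \<Rightarrow> complex)}"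
  then obtain s :: "'n \<Rightarrow> complex" where s: "signs s" "p = fl (half_frame w s)" by blast
  define t where "t j = s (en (j - 1))" for j
  have "t j \<in> {\<i>, - \<i>}" if j: "j \<in> {1..CARD('n) div 2}" for j
  proof -
    have lt: "j - 1 < CARD('n) div 2" "j - 1 < CARD('n)" using j by auto
    then have "(en (j - 1) :: 'n) < rho (en (j - 1))" unfolding half_positions by (simp only: rk_en)
    then show ?thesis using s(1) unfolding signs_def t_def by blast
  qed
  moreover have "p = intersection_flag k lstar l t"
    unfolding intersection_flag_half_frame[OF w] s(2) by (simp add: t_def)
  ultimately show "p \<in> {intersection_flag k lstar l s | s. \<forall>j\<in>{1..CARD('n) div 2}. s j \<in> {\<i>, - \<i>}}" by blast
qed

theorem theorem10:
  fixes D C\<^sub>0 :: "('n::{finite,wellorder}) flag set"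
    and n m lstar :: nat and w k l :: "nat \<Rightarrow> nat"
  assumes "n = CARD('n)" and "n \<ge> 2" and "m = n div 2"
    and "flag_domain D" and "base_cycle D C\<^sub>0"
    and "w permutes {1..n}"
    and "map w [1..<n + 1] = one_line n k lstar l"
    and "schubert_variety w \<in> schubert_complementary C\<^sub>0"
  shows "(n = 2 * m + 1 \<longrightarrow>
            card (schubert_variety w \<inter> C\<^sub>0) = 2 ^ m \<and>
            schubert_variety w \<inter> C\<^sub>0 =
              {intersection_flag k lstar l s | s. \<forall>j\<in>{1..m}. s j \<in> {\<i>, - \<i>}}) \<and>
         (n = 2 * m \<longrightarrow>
            card (schubert_variety w \<inter> C\<^sub>0) = 2 ^ (m - 1) \<and>
            schubert_variety w \<inter> C\<^sub>0 =
              {intersection_flag k lstar l s | s. \<forall>j\<in>{1..m}. s j \<in> {\<i>, - \<i>}} \<inter> D)"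
proof -
  have n: "n = CARD('n)" and m: "m = CARD('n) div 2" using assms(1,3) by auto
  have w: "w permutes {1..CARD('n)}" using assms(6) n by simp
  have D: "flag_domain D" by (rule assms(4))
  obtain F d where F: "F \<in> D" and C: "C\<^sub>0 = flag_orbit SO_real F" and sub: "complex_submanifold d C\<^sub>0"
    using assms(5) unfolding base_cycle_def by blast
  obtain F0 where D0: "D = flag_orbit SL_real F0" using D unfolding flag_domain_def by blast
  have SO_SL: "R \<in> SL_real" if "R \<in> SO_real" for R :: "'n cmat" using that by (simp add: SO_real_def)
  have CD: "C\<^sub>0 \<subseteq> D"
  proof
    fix p assume "p \<in> C\<^sub>0"
    then obtain R where R: "R \<in> SO_real" "p = flag_act R F" by (auto simp: C flag_orbit_def)
    obtain g where g: "g \<in> SL_real" "F = flag_act g F0" using F by (auto simp: D0 flag_orbit_def)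
    have "R ** g \<in> SL_real"
      using SO_SL[OF R(1)] g(1) by (auto simp: SL_real_iff det_mul real_mat_mult)
    then show "p \<in> D" using R(2) g(2) by (auto simp: D0 flag_orbit_def flag_act_mult)
  qed
  have dim: "complex_dim (schubert_variety w :: 'n flag set) + complex_dim C\<^sub>0 = complex_dim (flags :: 'n flag set)"
    and ne: "schubert_variety w \<inter> C\<^sub>0 \<noteq> {}"
    using assms(8) by (auto simp: schubert_complementary_def)
  \<comment> \<open>Transversality is available at points of the open cell, whereas the hypothesis
    provides a point of its closure.\<close>
  obtain c where c: "c \<in> C\<^sub>0" "c \<in> flag_orbit Borel_subgroup (coordinate_flag w)"
    using ne CD cell_meets_orbit[OF D F C] by blast
  obtain B where B: "iso_frame B" "fl B = c" using orbit_iso_frame[OF sub C c(1)] by blast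
  have tr: "transversal_flag (fl B)"
    unfolding transversal_flag_def B(2) using transversal[OF sub C c(1) w dim c(2)] by blast
  have prB: "paired w B" by (rule transversal_paired[OF B(1) tr w]) (simp add: B(2) c(2))
  \<comment> \<open>This condition and \<open>adj\<close> concern \<open>w\<close> alone. Extracted
    at the single point \<open>c\<close>, they serve in the analysis of all points of the
    intersection, including those not yet known to lie in the open cell.\<close>
  have order: "wperm w (rho y) < wperm w y" if "y < rho y" for y :: 'n
    using prB that unfolding paired_def by blast
  have adj: False if "y < rho y" "y < z" "z < rho y" "wperm w (rho y) < wperm w z" "wperm w z < wperm w y" for y z :: 'n
    using transversal_adjacent[OF unitary_invertible[OF iso_frame_unitary[OF B(1)]] prB tr w that] .

  define X where "X = {fl (half_frame w s) | s. signs (s :: 'n \<Rightarrow> complex)}"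
  have X: "X = {intersection_flag k lstar l s | s. \<forall>j\<in>{1..m}. s j \<in> {\<i>, - \<i>}}"
  proof -
    have "map w [1..<CARD('n) + 1] = one_line CARD('n) k lstar l" using assms(7) by (simp only: n)
    then show ?thesis unfolding X_def m by (rule intersection_flags_half_frames[symmetric])
  qed
  have sub1: "schubert_variety w \<inter> C\<^sub>0 \<subseteq> X"
  proof
    fix p assume p: "p \<in> schubert_variety w \<inter> C\<^sub>0"
    then obtain A where A: "iso_frame A" "fl A = p" using orbit_iso_frame[OF sub C] by blast
    have pS: "fl A \<in> schubert_variety w" using p A(2) by simp
    have "paired w A" by (rule schubert_paired[OF A(1) w pS], fact order, fact adj)
    then obtain s where "signs s" "paired_with w s A" using paired_signs by blast
    then show "p \<in> X" using paired_with_flag[OF A(1) w order] A(2) by (auto simp: X_def)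
  qed
  have sub2: "fl (half_frame w s) \<in> schubert_variety w" for s :: "'n \<Rightarrow> complex"
    using half_frame_cell(2)[OF w order] schubert_cell_subset[OF w] by blast
  have frame: "\<exists>A. iso_frame A \<and> paired_with w s A \<and> fl A = fl (half_frame w s)" if "signs s" for s :: "'n \<Rightarrow> complex"
    using half_frame_iso[OF w that] paired_with_flag[OF _ w order] by blast
  define P where "P = PiE {y :: 'n. y < rho y} (\<lambda>_. {\<i>, - \<i>})"
  define f where "f s = fl (half_frame w s)" for s :: "'n \<Rightarrow> complex"
  have XP: "X = f ` P" unfolding X_def f_def P_def by (rule half_frame_flags)
  have injf: "inj_on f P" unfolding f_def P_def by (rule half_frame_inj_on[OF w])
  have cardP: "card P = 2 ^ m" unfolding P_def m by (rule card_sign_functions)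
  have Psigns: "signs s" if "s \<in> P" for s using that by (auto simp: P_def signs_def PiE_def Pi_def)
  show ?thesis
  proof (intro conjI impI)
    assume odd: "n = 2 * m + 1"
    then have "odd CARD('n)" using n by simp
    have "X \<subseteq> C\<^sub>0"
    proof
      fix p assume "p \<in> X"
      then obtain s :: "'n \<Rightarrow> complex" where s: "signs s" "p = fl (half_frame w s)" by (auto simp: X_def)
      obtain A where "iso_frame A" "fl A = p" using frame[OF s(1)] s(2) by blast
      then show "p \<in> C\<^sub>0"
        using iso_frame_in_orbit_odd[OF _ B(1) C _ \<open>odd CARD('n)\<close>] c(1) B(2) by blast
    qed
    then have eq: "schubert_variety w \<inter> C\<^sub>0 = X" using sub1 sub2 by (auto simp: X_def)
    then show "schubert_variety w \<inter> C\<^sub>0 = {intersection_flag k lstar l s | s. \<forall>j\<in>{1..m}. s j \<in> {\<i>, - \<i>}}"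
      using X by simp
    show "card (schubert_variety w \<inter> C\<^sub>0) = 2 ^ m" unfolding eq XP card_image[OF injf] by (rule cardP)
  next
    assume even: "n = 2 * m"
    then have ev: "even CARD('n)" using n by simp
    \<comment> \<open>\<open>B\<close> is a reference frame in \<open>C\<^sub>0\<close>: the
      determinant of \<open>A ** ct B\<close> is the orientation of \<open>fl A\<close> relative to
      it.\<close>
    have orient: "fl A \<in> D \<longleftrightarrow> det (A ** ct B) = 1" "fl A \<in> C\<^sub>0 \<longleftrightarrow> det (A ** ct B) = 1" if A: "iso_frame A" for A
    proof -
      have "det (A ** ct B) = 1" if AD: "fl A \<in> D"
      proof -
        have "fl B \<in> D" using c(1) CD B(2) by blast
        then obtain g where "g \<in> SL_real" "fl A = flag_act g (fl B)"
          using SL_real_orbit AD unfolding D0 by blast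
        then show ?thesis by (rule iso_frame_orientation[OF A B(1) ev])
      qed
      moreover have "fl A \<in> C\<^sub>0" if "det (A ** ct B) = 1"
        using iso_frame_in_orbit[OF A B(1) C _ that] c(1) B(2) by simp
      ultimately show "fl A \<in> D \<longleftrightarrow> det (A ** ct B) = 1" "fl A \<in> C\<^sub>0 \<longleftrightarrow> det (A ** ct B) = 1"
        using CD by blast+
    qed
    have eq: "schubert_variety w \<inter> C\<^sub>0 = X \<inter> D"
    proof
      show "schubert_variety w \<inter> C\<^sub>0 \<subseteq> X \<inter> D" using sub1 CD by blast
      show "X \<inter> D \<subseteq> schubert_variety w \<inter> C\<^sub>0"
      proof
        fix p assume p: "p \<in> X \<inter> D"
        then obtain s :: "'n \<Rightarrow> complex" where s: "signs s" "p = fl (half_frame w s)" by (auto simp: X_def)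
        obtain A where A: "iso_frame A" "fl A = p" using frame[OF s(1)] s(2) by blast
        then have "p \<in> C\<^sub>0" using orient[OF A(1)] p by simp
        then show "p \<in> schubert_variety w \<inter> C\<^sub>0" using sub2 s(2) by simp
      qed
    qed
    then show "schubert_variety w \<inter> C\<^sub>0 = {intersection_flag k lstar l s | s. \<forall>j\<in>{1..m}. s j \<in> {\<i>, - \<i>}} \<inter> D"
      using X by simp

    \<comment> \<open>Changing the sign at the first position reverses the orientation and so
      matches the candidates in \<open>D\<close> with those outside; \<open>n \<ge> 2\<close>
      ensures that this position lies in the first half.\<close>
    define y1 :: 'n where "y1 = en 0"
    have y1: "y1 < rho y1" unfolding half_positions y1_def using assms(2) n by simp
    define flip where "flip s = s(y1 := - s y1)" for s :: "'n \<Rightarrow> complex"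
    have flipP: "flip s \<in> P" if "s \<in> P" for s
      using that y1 by (auto simp: P_def flip_def PiE_def Pi_def extensional_def)
    have flip2: "flip (flip s) = s" for s by (auto simp: flip_def)
    have flipD: "f (flip s) \<in> D \<longleftrightarrow> f s \<notin> D" if sP: "s \<in> P" for s
    proof -
      obtain A where A: "iso_frame A" "paired_with w s A" "fl A = f s"
        using frame[OF Psigns[OF sP]] by (auto simp: f_def)
      obtain A' where A': "iso_frame A'" "paired_with w (flip s) A'" "det (A' ** ct B) = - det (A ** ct B)"
        using paired_with_flip[OF A(1) w A(2) y1, of "ct B"] by (auto simp: flip_def)
      have "fl A' = f (flip s)" unfolding f_def by (rule paired_with_flag[OF A'(1) w order A'(2)])
      moreover have "det (A ** ct B) = 1 \<or> det (A ** ct B) = -1"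
        by (rule det_real_orthogonal[OF iso_frame_transition(2)[OF A(1) B(1)]])
      ultimately show ?thesis using orient(1)[OF A(1)] orient(1)[OF A'(1)] A(3) A'(3) by auto
    qed
    define G where "G = {s \<in> P. f s \<in> D}"
    have finP: "finite P" unfolding P_def by (intro finite_PiE) auto
    have "bij_betw flip G (P - G)"
    proof (rule bij_betw_byWitness[of _ flip])
      show "flip ` G \<subseteq> P - G" using flipP flipD by (auto simp: G_def)
      show "flip ` (P - G) \<subseteq> G" using flipP flipD by (auto simp: G_def)
    qed (simp_all add: flip2)
    then have "card G = card (P - G)" by (rule bij_betw_same_card)
    also have "\<dots> = card P - card G" using finP by (intro card_Diff_subset) (auto simp: G_def)
    finally have "2 * card G = 2 ^ m"
      using cardP card_mono[OF finP, of G] by (auto simp: G_def)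
    moreover have "m \<noteq> 0" using assms(2) even by auto
    ultimately have "card G = 2 ^ (m - 1)" by (cases m) auto
    moreover have "X \<inter> D = f ` G" unfolding XP G_def by auto
    moreover have "inj_on f G" using injf by (rule inj_on_subset) (auto simp: G_def)
    ultimately show "card (schubert_variety w \<inter> C\<^sub>0) = 2 ^ (m - 1)" by (simp add: eq card_image)
  qed
qed

end
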